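(* Every automorphic $2$-loop is solvable; that is, every automorphic loop $Q$ with $|Q|=2^m$ for some integer $m\ge 1$ is solvable.
   Context: A loop $(Q,\cdot)$ is a set with a binary operation such that for all $a,b\in Q$ the equations $ax=b$ and $ya=b$ have unique solutions, and there is a neutral element $1$. $R_a:x\mapsto xa$, $L_a:x\mapsto ax$; $\mathrm{Mlt}(Q)=\langle R_x,L_x\mid x\in Q\rangle$; $\mathrm{Inn}(Q)$ is the stabilizer of $1$ in $\mathrm{Mlt}(Q)$. A loop is automorphic if $\mathrm{Inn}(Q)\le \mathrm{Aut}(Q)$. A finite loop is a $2$-loop if its order is $2^m$ for some $m\ge1$. A subloop is normal if it is the kernel of a homomorphism. $Q$ is solvable if there is a series $1=Q_0\le\cdots\le Q_n=Q$ with $Q_i$ normal in $Q_{i+1}$ and every $Q_{i+1}/Q_i$ an abelian group. *)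

theory Defs
  imports Main "HOL-Library.FuncSet"
begin

definition loop :: "'a set \<Rightarrow> ('a \<Rightarrow> 'a \<Rightarrow> 'a) \<Rightarrow> 'a \<Rightarrow> bool" where
  "loop Q m e \<longleftrightarrow> e \<in> Q \<and> (\<forall>a\<in>Q. \<forall>b\<in>Q. m a b \<in> Q)
     \<and> (\<forall>a\<in>Q. m e a = a \<and> m a e = a)
     \<and> (\<forall>a\<in>Q. \<forall>b\<in>Q. (\<exists>!x. x \<in> Q \<and> m a x = b) \<and> (\<exists>!y. y \<in> Q \<and> m y a = b))"

inductive_set Mlt :: "'a set \<Rightarrow> ('a \<Rightarrow> 'a \<Rightarrow> 'a) \<Rightarrow> ('a \<Rightarrow> 'a) set"
  for Q :: "'a set" and m :: "'a \<Rightarrow> 'a \<Rightarrow> 'a" where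
  Mlt_id: "restrict id Q \<in> Mlt Q m"
| Mlt_R: "x \<in> Q \<Longrightarrow> restrict (\<lambda>y. m y x) Q \<in> Mlt Q m"
| Mlt_L: "x \<in> Q \<Longrightarrow> restrict (\<lambda>y. m x y) Q \<in> Mlt Q m"
| Mlt_comp: "f \<in> Mlt Q m \<Longrightarrow> g \<in> Mlt Q m \<Longrightarrow> compose Q f g \<in> Mlt Q m"
| Mlt_inv: "f \<in> Mlt Q m \<Longrightarrow> restrict (inv_into Q f) Q \<in> Mlt Q m"

definition Inn :: "'a set \<Rightarrow> ('a \<Rightarrow> 'a \<Rightarrow> 'a) \<Rightarrow> 'a \<Rightarrow> ('a \<Rightarrow> 'a) set" where
  "Inn Q m e = {f \<in> Mlt Q m. f e = e}"

definition loop_aut :: "'a set \<Rightarrow> ('a \<Rightarrow> 'a \<Rightarrow> 'a) \<Rightarrow> ('a \<Rightarrow> 'a) set" where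
  "loop_aut Q m = {f. bij_betw f Q Q \<and> (\<forall>a\<in>Q. \<forall>b\<in>Q. f (m a b) = m (f a) (f b))}"

definition automorphic_loop :: "'a set \<Rightarrow> ('a \<Rightarrow> 'a \<Rightarrow> 'a) \<Rightarrow> 'a \<Rightarrow> bool" where
  "automorphic_loop Q m e \<longleftrightarrow> loop Q m e \<and> Inn Q m e \<subseteq> loop_aut Q m"

definition two_loop :: "'a set \<Rightarrow> ('a \<Rightarrow> 'a \<Rightarrow> 'a) \<Rightarrow> 'a \<Rightarrow> bool" where
  "two_loop Q m e \<longleftrightarrow> loop Q m e \<and> finite Q \<and> (\<exists>k::nat. k \<ge> 1 \<and> card Q = 2 ^ k)"

definition subloop :: "'a set \<Rightarrow> 'a set \<Rightarrow> ('a \<Rightarrow> 'a \<Rightarrow> 'a) \<Rightarrow> 'a \<Rightarrow> bool" where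
  "subloop S Q m e \<longleftrightarrow> S \<subseteq> Q \<and> loop S m e"

definition loop_hom :: "('a \<Rightarrow> 'b) \<Rightarrow> 'a set \<Rightarrow> ('a \<Rightarrow> 'a \<Rightarrow> 'a) \<Rightarrow> 'b set \<Rightarrow> ('b \<Rightarrow> 'b \<Rightarrow> 'b) \<Rightarrow> bool" where
  "loop_hom h Q m L m' \<longleftrightarrow> h \<in> Q \<rightarrow> L \<and> (\<forall>a\<in>Q. \<forall>b\<in>Q. h (m a b) = m' (h a) (h b))"

text \<open>N is normal in the loop (Q,m,e) iff N is the kernel of a homomorphism from Q to some loop.
  The target loop is taken with carrier in type 'a set, which is large enough to hold
  (an isomorphic copy of) every homomorphic image of Q.\<close>

definition normal_subloop :: "'a set \<Rightarrow> 'a set \<Rightarrow> ('a \<Rightarrow> 'a \<Rightarrow> 'a) \<Rightarrow> 'a \<Rightarrow> bool" where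
  "normal_subloop N Q m e \<longleftrightarrow>
     (\<exists>(L :: 'a set set) m' e' h. loop L m' e' \<and> loop_hom h Q m L m' \<and> N = {x \<in> Q. h x = e'})"

definition lcoset :: "('a \<Rightarrow> 'a \<Rightarrow> 'a) \<Rightarrow> 'a \<Rightarrow> 'a set \<Rightarrow> 'a set" where
  "lcoset m x N = (\<lambda>n. m x n) ` N"

definition quot_carrier :: "'a set \<Rightarrow> 'a set \<Rightarrow> ('a \<Rightarrow> 'a \<Rightarrow> 'a) \<Rightarrow> 'a set set" where
  "quot_carrier Q N m = (\<lambda>x. lcoset m x N) ` Q"

definition quot_mult :: "'a set \<Rightarrow> ('a \<Rightarrow> 'a \<Rightarrow> 'a) \<Rightarrow> 'a set \<Rightarrow> 'a set \<Rightarrow> 'a set" where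
  "quot_mult N m A B = lcoset m (m (SOME a. a \<in> A) (SOME b. b \<in> B)) N"

definition quot_abelian_group :: "'a set \<Rightarrow> 'a set \<Rightarrow> ('a \<Rightarrow> 'a \<Rightarrow> 'a) \<Rightarrow> bool" where
  "quot_abelian_group Q N m \<longleftrightarrow>
     (\<forall>A\<in>quot_carrier Q N m. \<forall>B\<in>quot_carrier Q N m. \<forall>C\<in>quot_carrier Q N m.
        quot_mult N m (quot_mult N m A B) C = quot_mult N m A (quot_mult N m B C)
      \<and> quot_mult N m A B = quot_mult N m B A)"

definition solvable_loop :: "'a set \<Rightarrow> ('a \<Rightarrow> 'a \<Rightarrow> 'a) \<Rightarrow> 'a \<Rightarrow> bool" where
  "solvable_loop Q m e \<longleftrightarrow>
     (\<exists>(n::nat) S. S 0 = {e} \<and> S n = Q \<and>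
        (\<forall>i<n. subloop (S i) Q m e \<and> subloop (S (Suc i)) Q m e \<and> S i \<subseteq> S (Suc i)
              \<and> normal_subloop (S i) (S (Suc i)) m e
              \<and> quot_abelian_group (S (Suc i)) (S i) m))"

end

theory Submission
  imports Defs "HOL-Algebra.Sylow" "HOL-Algebra.Multiplicative_Group" "HOL-Combinatorics.Perm"
begin

text \<open>
  Factoring out a maximal proper subloop invariant under inner mappings, it suffices to show that
  an automorphic loop \<open>Q\<close> of order \<open>2\<^sup>k\<close> without proper nontrivial subloops invariant under its
  automorphism group \<open>H\<close> is an abelian group.

  Inversion \<open>J\<close> is an antiautomorphism. The elements \<open>x\<close> for which the translation \<open>L\<^sub>x\<close> commutes
  with \<open>J\<close> form an invariant subloop. If it were trivial, the conjugates \<open>L\<^sub>x J L\<^sub>x\<inverse>\<close> would be distinct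
  and lie in a single Sylow 2-subgroup, and a central element of that group would fix every point.
  Hence \<open>J = 1\<close>, and \<open>Q\<close> is commutative of exponent two.

  Let \<open>N\<close> be the set of \<open>u\<close> with \<open>L\<^sub>u\<^sup>2 = 1\<close>. It is nontrivial, because \<open>y = z \ L\<^sub>p\<^sup>2 z\<close> satisfies that
  \<open>L\<^sub>y\<^sup>2\<close> fixes \<open>z\<close> and all fixed points of \<open>L\<^sub>p\<^sup>2\<close>. For \<open>u \<in> N\<close> the involutions \<open>y \<mapsto> y \ u\<close> commute and
  generate a regular elementary abelian group, so that \<open>Q\<close> becomes a vector space over the field with
  two elements on which \<open>H\<close> acts linearly. For \<open>u, f \<in> N\<close> put \<open>\<beta> = L\<^sub>u\<^sub>f\<^sup>2\<close>; then \<open>\<epsilon>(u,f) = 1 + \<beta>\<close> is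
  additive in \<open>u\<close> and in \<open>f\<close> and has square zero. If \<open>\<beta> \<noteq> 1\<close> has as many fixed points as possible,
  the image of \<open>\<epsilon>(u,f)\<close> lies in \<open>N\<close> and \<open>\<epsilon>\<close> vanishes on it. By the Baer--Suzuki theorem \<open>\<beta>\<close> inverts
  some \<open>\<theta> \<noteq> 1\<close> of odd order, since otherwise its conjugates would have common fixed points forming an
  invariant subloop; averaging \<open>\<epsilon>\<close> over the powers of \<open>\<theta>\<close> contradicts this. So every \<open>\<beta>\<close> is trivial,
  \<open>N = Q\<close>, and the loop operation is the vector space addition.
\<close>

unbundle permutation_syntax

lemma perm_inverse_mult_cancel [simp]: "inverse a * (a * b) = (b :: 'a perm)"
  by (simp add: mult.assoc [symmetric])

lemma perm_mult_inverse_cancel [simp]: "a * (inverse a * b) = (b :: 'a perm)"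
  by (simp add: mult.assoc [symmetric])

lemma perm_left_cancel [simp]: "a * b = a * c \<longleftrightarrow> b = (c :: 'a perm)"
  by (metis perm_inverse_mult_cancel)

lemma perm_right_cancel [simp]: "b * a = c * a \<longleftrightarrow> b = (c :: 'a perm)"
  by (metis mult.assoc mult_1_right perm.right_inverse)

lemma perm_apply_mult [simp]: "(a * b) \<langle>$\<rangle> x = a \<langle>$\<rangle> (b \<langle>$\<rangle> x)"
  by (simp add: apply_times)

lemma perm_apply_inverse [simp]:
  "inverse a \<langle>$\<rangle> (a \<langle>$\<rangle> x) = x" "a \<langle>$\<rangle> (inverse a \<langle>$\<rangle> x) = x"
  by (metis apply_one id_apply perm.left_inverse perm_apply_mult,
      metis apply_one id_apply perm.right_inverse perm_apply_mult)

section \<open>Finite groups of permutations\<close>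

text \<open>Finiteness turns closure under products into closure under inverses, which
  \<open>perm_group_inverse\<close> extracts.\<close>

definition perm_group :: "'a perm set \<Rightarrow> bool" where
  "perm_group P \<longleftrightarrow> finite P \<and> 1 \<in> P \<and> (\<forall>a\<in>P. \<forall>b\<in>P. a * b \<in> P)"

lemma perm_groupD:
  assumes "perm_group P"
  shows "finite P" "1 \<in> P" "a \<in> P \<Longrightarrow> b \<in> P \<Longrightarrow> a * b \<in> P"
  using assms by (auto simp: perm_group_def)

lemma perm_group_power: "perm_group P \<Longrightarrow> a \<in> P \<Longrightarrow> a ^ n \<in> P"
  by (induction n) (auto simp: perm_group_def)

text \<open>Two powers of \<open>a\<close> coincide by finiteness; cancelling makes a power of
  \<open>a\<close> its inverse.\<close>

lemma perm_group_inverse: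
  assumes P: "perm_group P" and a: "a \<in> P"
  shows "inverse a \<in> P"
proof -
  have "range (\<lambda>n. a ^ n) \<subseteq> P" using perm_group_power [OF P a] by auto
  then have "finite (range (\<lambda>n. a ^ n))" using perm_groupD(1) [OF P] finite_subset by blast
  then have "\<not> inj (\<lambda>n. a ^ n)" using finite_imageD infinite_UNIV_nat by blast
  then obtain i j :: nat where "i < j" "a ^ i = a ^ j"
    by (metis injI linorder_neqE_nat)
  then have "a ^ i * a ^ (j - i) = a ^ i * 1"
    by (metis le_add_diff_inverse less_imp_le mult_1_right power_add)
  then have "a ^ (j - i) = 1" by (simp only: perm_left_cancel)
  then have "a * a ^ (j - i - 1) = 1"
    using \<open>i < j\<close> by (metis Suc_diff_1 power_Suc zero_less_diff)
  then have "inverse a = a ^ (j - i - 1)"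
    by (metis mult_1_right perm_inverse_mult_cancel)
  then show ?thesis using perm_group_power [OF P a] by simp
qed

text \<open>Bridge through which Lagrange, Sylow and element orders are imported.\<close>

definition perm_monoid :: "'a perm set \<Rightarrow> 'a perm monoid" where
  "perm_monoid P = \<lparr>carrier = P, monoid.mult = (*), one = 1\<rparr>"

lemma perm_monoid_simps [simp]:
  "carrier (perm_monoid P) = P" "a \<otimes>\<^bsub>perm_monoid P\<^esub> b = a * b" "\<one>\<^bsub>perm_monoid P\<^esub> = 1"
  "Coset.order (perm_monoid P) = card P"
  by (simp_all add: perm_monoid_def Coset.order_def)

lemma group_perm_monoid: "perm_group P \<Longrightarrow> Group.group (perm_monoid P)"
  by (rule groupI) (auto simp: perm_group_def mult.assoc intro!: bexI [OF _ perm_group_inverse])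

lemma perm_monoid_inv: "perm_group P \<Longrightarrow> a \<in> P \<Longrightarrow> m_inv (perm_monoid P) a = inverse a"
  by (rule group.inv_equality [OF group_perm_monoid]) (auto simp: perm_group_inverse)

lemma perm_monoid_pow: "a [^]\<^bsub>perm_monoid P\<^esub> (n::nat) = a ^ n"
  by (induction n) (simp_all add: power_commutes)

lemma perm_subgroup:
  assumes "perm_group P" "perm_group A" "A \<subseteq> P"
  shows "subgroup A (perm_monoid P)"
  by (rule group.subgroupI [OF group_perm_monoid [OF assms(1)]])
    (use assms perm_groupD(2) [OF assms(2)] in \<open>auto simp: perm_groupD(1,3) perm_monoid_inv perm_group_inverse subset_iff\<close>)

lemma subgroup_perm_group:
  assumes "perm_group P" "subgroup A (perm_monoid P)"
  shows "perm_group A" "A \<subseteq> P"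
proof -
  show "A \<subseteq> P" using subgroup.subset [OF assms(2)] by simp
  then show "perm_group A"
    using subgroup.m_closed [OF assms(2)] subgroup.one_closed [OF assms(2)] perm_groupD(1) [OF assms(1)]
    by (auto simp: perm_group_def finite_subset)
qed

lemma perm_group_card_dvd:
  assumes "perm_group P" "perm_group A" "A \<subseteq> P"
  shows "card A dvd card P"
  using group.lagrange [OF group_perm_monoid [OF assms(1)] perm_subgroup [OF assms]]
  by (metis dvd_triv_right perm_monoid_simps(4))

lemma perm_group_power_card: "perm_group P \<Longrightarrow> a \<in> P \<Longrightarrow> a ^ card P = 1"
  using group.pow_order_eq_1 [OF group_perm_monoid, of P a] by (simp add: perm_monoid_pow)

lemma perm_group_coprime_powers:
  assumes "perm_group P" "a \<in> P" "a ^ i = 1" "a ^ j = 1" "coprime i j"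
  shows "a = 1"
proof -
  interpret G: group "perm_monoid P" by (rule group_perm_monoid [OF assms(1)])
  have "G.ord a dvd i" "G.ord a dvd j"
    using assms G.pow_eq_id [of a i] G.pow_eq_id [of a j] by (auto simp: perm_monoid_pow)
  then have "G.ord a dvd 1" using assms(5) by (meson coprime_common_divisor)
  then show ?thesis using G.pow_eq_id [of a 1] assms(2) by (simp add: perm_monoid_pow)
qed

text \<open>The fibres of \<open>a \<mapsto> act a x\<close> over the orbit are left translates of
  the stabilizer. Actions are arbitrary functions, so that points, conjugation and cosets are all
  covered.\<close>

lemma orbit_stabilizer_card:
  assumes P: "perm_group P" and x: "x \<in> X"
    and act_one: "\<And>x. x \<in> X \<Longrightarrow> act 1 x = x"
    and act_mult: "\<And>a b x. a \<in> P \<Longrightarrow> b \<in> P \<Longrightarrow> x \<in> X \<Longrightarrow> act (a * b) x = act a (act b x)"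
    and act_closed: "\<And>a x. a \<in> P \<Longrightarrow> x \<in> X \<Longrightarrow> act a x \<in> X"
  shows "card ((\<lambda>a. act a x) ` P) * card {a \<in> P. act a x = x} = card P"
proof -
  have fibre: "card {a \<in> P. act a x = y} = card {a \<in> P. act a x = x}" if "y \<in> (\<lambda>a. act a x) ` P" for y
  proof -
    from that obtain b where b: "b \<in> P" "act b x = y" by auto
    have ib: "inverse b \<in> P" using perm_group_inverse P b by blast
    have "act (inverse b) y = x"
      using act_mult [OF ib b(1) x] act_one [OF x] b by simp
    then have "bij_betw ((*) b) {a \<in> P. act a x = x} {a \<in> P. act a x = y}"
      by (intro bij_betwI [where g = "(*) (inverse b)"])
        (auto simp: perm_groupD [OF P] b ib act_mult x)
    then show ?thesis by (simp add: bij_betw_same_card)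
  qed
  have "card P = (\<Sum>y\<in>(\<lambda>a. act a x) ` P. card {a \<in> P. act a x = y})"
    using sum.image_gen [OF perm_groupD(1) [OF P], of "\<lambda>_. 1::nat" "\<lambda>a. act a x"] by simp
  then show ?thesis using fibre by simp
qed

text \<open>Orbits have 2-power size, so every orbit outside the fixed points is even; these orbits
  partition the complement of the fixed points.\<close>

lemma parity_fixed_points:
  assumes P: "perm_group P" "card P = 2 ^ n" and X: "finite X"
    and act_one: "\<And>x. x \<in> X \<Longrightarrow> act 1 x = x"
    and act_mult: "\<And>a b x. a \<in> P \<Longrightarrow> b \<in> P \<Longrightarrow> x \<in> X \<Longrightarrow> act (a * b) x = act a (act b x)"
    and act_closed: "\<And>a x. a \<in> P \<Longrightarrow> x \<in> X \<Longrightarrow> act a x \<in> X"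
  shows "even (card X) \<longleftrightarrow> even (card {x \<in> X. \<forall>a\<in>P. act a x = x})"
proof -
  let ?F = "{x \<in> X. \<forall>a\<in>P. act a x = x}" and ?orb = "\<lambda>x. (\<lambda>a. act a x) ` P"
  note os = orbit_stabilizer_card [where P = P and X = X and act = act, OF P(1) _ act_one act_mult act_closed]
  have self: "x \<in> ?orb x" if "x \<in> X" for x
    using act_one [OF that] perm_groupD(2) [OF P(1)] by (metis imageI)
  have orb_eq: "?orb y = ?orb x" if x: "x \<in> X" and y: "y \<in> ?orb x" for x y
  proof -
    from y obtain b where b: "b \<in> P" "y = act b x" by auto
    have ib: "inverse b \<in> P" using perm_group_inverse P b by blast
    have "act a y \<in> ?orb x" if "a \<in> P" for a
      using act_mult [OF that b(1) x] perm_groupD(3) [OF P(1) that b(1)] b by (metis imageI)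
    moreover have "act a x \<in> ?orb y" if "a \<in> P" for a
    proof -
      have "act (a * inverse b) y = act a x"
        using act_mult [of "a * inverse b" b x] b x ib that perm_groupD(3) [OF P(1)]
        by (simp add: mult.assoc)
      then show ?thesis using perm_groupD(3) [OF P(1) that ib] by (metis imageI)
    qed
    ultimately show ?thesis by auto
  qed
  have ev: "2 dvd card (?orb x)" if "x \<in> X - ?F" for x
  proof -
    have "card (?orb x) * card {a \<in> P. act a x = x} = 2 ^ n" using os [of x] that P(2) by simp
    then have "card (?orb x) dvd 2 ^ n" by (rule dvdI [OF sym])
    then obtain j where j: "card (?orb x) = 2 ^ j" by (auto simp: divides_primepow_nat)
    have "card (?orb x) \<noteq> 1"
    proof
      assume "card (?orb x) = 1"
      then obtain z where z: "?orb x = {z}" by (meson card_1_singletonE)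
      then have "z = x" using self [of x] that by auto
      then have "act a x = x" if "a \<in> P" for a using that z by (metis imageI singletonD)
      then show False using that by auto
    qed
    then show ?thesis using j by (cases j) auto
  qed
  have U: "\<Union>(?orb ` (X - ?F)) = X - ?F"
  proof
    show "X - ?F \<subseteq> \<Union>(?orb ` (X - ?F))" using self by blast
    show "\<Union>(?orb ` (X - ?F)) \<subseteq> X - ?F"
    proof
      fix y assume "y \<in> \<Union>(?orb ` (X - ?F))"
      then obtain x where x: "x \<in> X - ?F" "y \<in> ?orb x" by auto
      then have yX: "y \<in> X" using act_closed by auto
      have "y \<notin> ?F"
      proof
        assume "y \<in> ?F"
        then have "?orb y = {y}" using perm_groupD(2) [OF P(1)] by auto
        then have "?orb x = {y}" using orb_eq x by auto
        then have "x = y" using self [of x] x by auto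
        then show False using \<open>y \<in> ?F\<close> x by auto
      qed
      then show "y \<in> X - ?F" using yX by auto
    qed
  qed
  have "2 dvd card (\<Union>(?orb ` (X - ?F)))"
  proof (rule dvd_partition)
    show "finite (\<Union>(?orb ` (X - ?F)))" unfolding U using X by simp
    show "\<forall>c\<in>?orb ` (X - ?F). 2 dvd card c" using ev by (simp only: ball_simps) (rule ballI)
    show "\<forall>c1\<in>?orb ` (X - ?F). \<forall>c2\<in>?orb ` (X - ?F). c1 \<noteq> c2 \<longrightarrow> c1 \<inter> c2 = {}"
    proof (intro ballI impI)
      fix c1 c2 assume "c1 \<in> ?orb ` (X - ?F)" "c2 \<in> ?orb ` (X - ?F)" "c1 \<noteq> c2"
      then obtain x1 x2 where x: "x1 \<in> X" "x2 \<in> X" "c1 = ?orb x1" "c2 = ?orb x2" by (elim imageE DiffE)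
      have False if "y \<in> c1" "y \<in> c2" for y
      proof -
        have "?orb y = c1" "?orb y = c2"
          unfolding x by (rule orb_eq, fact, use that x in \<open>simp only:\<close>)+
        then show False using \<open>c1 \<noteq> c2\<close> by simp
      qed
      then show "c1 \<inter> c2 = {}" by blast
    qed
  qed
  then have "even (card (X - ?F))" using U by simp
  moreover have "card X = card ?F + card (X - ?F)"
  proof -
    have "X = ?F \<union> (X - ?F)" by blast
    moreover have "card (?F \<union> (X - ?F)) = card ?F + card (X - ?F)"
      by (rule card_Un_disjoint) (use X in auto)
    ultimately show ?thesis by simp
  qed
  ultimately show ?thesis by simp
qed

text \<open>Under conjugation the fixed points are the central elements; their number is even and
  they include \<open>1\<close>, so there is another.\<close>

lemma two_group_center:
  assumes P: "perm_group P" "card P = 2 ^ n" and n: "n \<noteq> 0"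
  obtains z where "z \<in> P" "z \<noteq> 1" "\<And>a. a \<in> P \<Longrightarrow> a * z = z * a"
proof -
  let ?F = "{x \<in> P. \<forall>a\<in>P. a * x * inverse a = x}"
  have "even (card P) \<longleftrightarrow> even (card ?F)"
    by (rule parity_fixed_points [OF P perm_groupD(1) [OF P(1)]])
      (auto simp: mult.assoc perm_groupD [OF P(1)] perm_group_inverse [OF P(1)])
  then have "even (card ?F)" using P n by simp
  moreover have "1 \<in> ?F" using perm_groupD [OF P(1)] by simp
  ultimately have "?F \<noteq> {1}" by force
  then obtain z where "z \<in> ?F" "z \<noteq> 1" using \<open>1 \<in> ?F\<close> by blast
  moreover have "a * z = z * a" if "a \<in> P" for a
  proof -
    have "a * z * inverse a * a = z * a" using \<open>z \<in> ?F\<close> that by simp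
    then show ?thesis by (simp add: mult.assoc)
  qed
  ultimately show ?thesis using that by blast
qed

lemma image_mult_perm: "(*) (a * b) ` S = (*) a ` ((*) b ` S)" for a b :: "'a perm"
  by (simp add: image_image mult.assoc)

lemma coset_stabilizer:
  assumes A: "perm_group A" "A \<subseteq> P"
  shows "{a \<in> P. (*) a ` A = A} = A"
proof
  show "{a \<in> P. (*) a ` A = A} \<subseteq> A"
    using perm_groupD(2) [OF A(1)] by (auto, metis imageI mult_1_right)
  show "A \<subseteq> {a \<in> P. (*) a ` A = A}"
  proof
    fix a assume a: "a \<in> A"
    have "b \<in> (*) a ` A" if "b \<in> A" for b
      using perm_groupD(3) [OF A(1) perm_group_inverse [OF A(1) a] that]
      by (metis imageI perm_mult_inverse_cancel)
    then show "a \<in> {a \<in> P. (*) a ` A = A}" using a A perm_groupD(3) [OF A(1)] by auto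
  qed
qed

lemma cosets_closed:
  assumes "perm_group P" "a \<in> P" "S \<in> (\<lambda>g. (*) g ` A) ` P"
  shows "(*) a ` S \<in> (\<lambda>g. (*) g ` A) ` P"
  using assms perm_groupD(3) [OF assms(1)] by (auto simp: image_mult_perm [symmetric])

lemma coset_self:
  assumes "perm_group P"
  shows "A \<in> (\<lambda>g. (*) g ` A) ` P"
  using perm_groupD(2) [OF assms] by (force intro: image_eqI [of _ _ 1])

lemma coset_card:
  assumes P: "perm_group P" and A: "perm_group A" "A \<subseteq> P"
  shows "card ((\<lambda>g. (*) g ` A) ` P) * card A = card P"
proof -
  have "card ((\<lambda>a. (*) a ` A) ` P) * card {a \<in> P. (*) a ` A = A} = card P"
    by (rule orbit_stabilizer_card [where X = "(\<lambda>g. (*) g ` A) ` P" and act = "\<lambda>a S. (*) a ` S",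
        OF P coset_self [OF P] _ _ cosets_closed [OF P]]) (auto simp: image_mult_perm)
  then show ?thesis using coset_stabilizer [OF A] by simp
qed

text \<open>Normalizers grow in 2-groups: \<open>A\<close> acts on the even number of its cosets in
  \<open>P\<close> and fixes the coset \<open>A\<close>, hence fixes a second coset, whose
  representative normalizes \<open>A\<close>.\<close>

lemma two_group_normalizer:
  assumes P: "perm_group P" "card P = 2 ^ n" and A: "perm_group A" "A \<subseteq> P" "A \<noteq> P"
  obtains g where "g \<in> P" "g \<notin> A" "\<And>a. a \<in> A \<Longrightarrow> inverse g * a * g \<in> A"
proof -
  let ?X = "(\<lambda>g. (*) g ` A) ` P"
  have stab: "{a \<in> P. (*) a ` A = A} = A" by (rule coset_stabilizer [OF A(1,2)])
  have closed: "\<And>a S. a \<in> P \<Longrightarrow> S \<in> ?X \<Longrightarrow> (*) a ` S \<in> ?X" by (rule cosets_closed [OF P(1)])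
  have AX: "A \<in> ?X" by (rule coset_self [OF P(1)])
  have cX: "card ?X * card A = 2 ^ n" using coset_card [OF P(1) A(1,2)] P by simp
  then have "card ?X dvd 2 ^ n" "card A dvd 2 ^ n" by (metis dvd_triv_left, metis dvd_triv_right)
  then obtain i j where ij: "card ?X = 2 ^ i" "card A = 2 ^ j" by (auto simp: divides_primepow_nat)
  have "i \<noteq> 0"
  proof
    assume "i = 0"
    then have "card A = card P" using cX ij P by simp
    then show False using A card_subset_eq perm_groupD(1) [OF P(1)] by blast
  qed
  then have even: "even (card ?X)" using ij by simp
  let ?F = "{S \<in> ?X. \<forall>a\<in>A. (*) a ` S = S}"
  have "even (card ?X) \<longleftrightarrow> even (card ?F)"
    by (rule parity_fixed_points [OF A(1) ij(2)])
      (use perm_groupD(1) [OF P(1)] closed A in \<open>auto simp: image_mult_perm image_image mult.assoc\<close>)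
  then have ev: "even (card ?F)" using even by simp
  have AF: "A \<in> ?F" using AX stab by blast
  have "?F \<noteq> {A}"
  proof
    assume *: "?F = {A}"
    show False using ev unfolding * by simp
  qed
  moreover have "\<exists>S\<in>F'. S \<noteq> A" if "A \<in> F'" "F' \<noteq> {A}" for F' using that by blast
  ultimately obtain S where S: "S \<in> ?F" "S \<noteq> A" using AF by meson
  have "S \<in> ?X" using S(1) unfolding mem_Collect_eq by (rule conjunct1)
  then obtain g where g: "g \<in> P" "S = (*) g ` A" by (elim imageE)
  have "g \<notin> A"
  proof
    assume "g \<in> A"
    then have "(*) g ` A = A" using stab by blast
    then show False using S g by simp
  qed
  moreover have "inverse g * a * g \<in> A" if "a \<in> A" for a
  proof -
    have "a * (g * 1) \<in> (*) g ` A"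
    proof -
      have "(*) a ` S = S" using S(1) that by simp
      moreover have "g * 1 \<in> S" using g perm_groupD(2) [OF A(1)] by blast
      ultimately show ?thesis using g by blast
    qed
    then obtain b where "b \<in> A" "a * g = g * b" by auto
    then show ?thesis by (simp add: mult.assoc)
  qed
  ultimately show ?thesis using that g by blast
qed

lemma sylow_two_subgroup:
  assumes "perm_group P"
  obtains A a m where "perm_group A" "A \<subseteq> P" "card A = 2 ^ a" "card P = 2 ^ a * m" "odd m"
proof -
  have "card P \<noteq> 0" using perm_groupD(1,2) [OF assms] by auto
  then obtain m where m: "card P = 2 ^ multiplicity 2 (card P) * m" "odd m"
    using multiplicity_decompose' [of "card P" 2] by auto
  obtain A where "subgroup A (perm_monoid P)" "card A = 2 ^ multiplicity 2 (card P)"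
    using sylow_thm [OF two_is_prime_nat group_perm_monoid [OF assms]] m perm_groupD(1) [OF assms]
    by (metis perm_monoid_simps(1,4))
  then show ?thesis using that m subgroup_perm_group [OF assms] by blast
qed

section \<open>The Baer--Suzuki theorem for involutions\<close>

definition two_group :: "'a perm set \<Rightarrow> bool" where
  "two_group P \<longleftrightarrow> perm_group P \<and> (\<forall>a\<in>P. \<exists>n. a ^ (2 ^ n) = 1)"

text \<open>An odd prime divisor would give, by Sylow, a subgroup of that prime order, whose
  elements also have 2-power order and so are trivial.\<close>

lemma two_group_card:
  assumes "two_group P"
  obtains n where "card P = 2 ^ n"
proof -
  have P: "perm_group P" using assms by (simp add: two_group_def)
  have "card P \<noteq> 0" using perm_groupD(1,2) [OF P] by auto
  then obtain m where m: "card P = 2 ^ multiplicity 2 (card P) * m" "odd m"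
    using multiplicity_decompose' [of "card P" 2] by auto
  have "m = 1"
  proof (rule ccontr)
    assume "m \<noteq> 1"
    then obtain p where p: "prime p" "p dvd m" by (meson prime_factor_nat)
    then have "card P = p ^ 1 * (card P div p)" using m by (metis dvd_mult dvd_mult_div_cancel power_one_right)
    then obtain A where A: "subgroup A (perm_monoid P)" "card A = p ^ 1"
      using sylow_thm [OF p(1) group_perm_monoid [OF P], of 1 "card P div p"] perm_groupD(1) [OF P] by auto
    have Ag: "perm_group A" "A \<subseteq> P" using subgroup_perm_group [OF P A(1)] by auto
    have "A \<noteq> {1}" using A p by (auto simp: prime_nat_iff)
    then obtain a where a: "a \<in> A" "a \<noteq> 1" using perm_groupD(2) [OF Ag(1)] by blast
    obtain n where "a ^ (2 ^ n) = 1" using a Ag assms by (auto simp: two_group_def)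
    moreover have "a ^ p = 1" using perm_group_power_card [OF Ag(1) a(1)] A by simp
    moreover have "coprime p (2 ^ n)"
      using p m by (metis coprime_power_right_iff dvd_trans prime_imp_coprime primes_dvd_imp_eq two_is_prime_nat)
    ultimately show False using perm_group_coprime_powers [OF Ag(1) a(1)] a(2) by blast
  qed
  then show ?thesis using that m by simp
qed

lemma two_group_subset: "two_group P \<Longrightarrow> perm_group A \<Longrightarrow> A \<subseteq> P \<Longrightarrow> two_group A"
  by (auto simp: two_group_def)

text \<open>The elements \<open>r ^ i * s ^ j\<close> with \<open>r = s * t\<close> form a dihedral
  group, as \<open>s\<close> inverts \<open>r\<close>. Their explicit form serves to place
  \<open>B\<close> inside any group containing \<open>s\<close> and \<open>t\<close>.\<close>

lemma dihedral_two_group: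
  fixes s t :: "'a perm"
  assumes H: "perm_group H" "s \<in> H" "t \<in> H" and inv: "s * s = 1" "t * t = 1" and ord: "(s * t) ^ (2 ^ n) = 1"
  obtains B where "two_group B" "B \<subseteq> H" "s \<in> B" "t \<in> B"
    "\<And>x. x \<in> B \<Longrightarrow> \<exists>i j. x = (s * t) ^ i * s ^ j"
proof -
  define r where "r = s * t"
  define B where "B = {r ^ i * s ^ j | i j. True}"
  have rH: "r \<in> H" using perm_groupD(3) [OF H(1)] H by (simp add: r_def)
  \<comment> \<open>The power \<open>2 ^ n - 1\<close> stands for the inverse of \<open>r\<close>,
    keeping all exponents natural numbers.\<close>
  have rr: "r ^ (2 ^ n - 1) * r = 1" "r * r ^ (2 ^ n - 1) = 1"
    using ord by (auto simp: r_def [symmetric] power_Suc2 [symmetric] power_Suc [symmetric] simp del: power_Suc)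
  have ts: "t * s = r ^ (2 ^ n - 1)"
  proof -
    have "(t * s) * r = 1" using inv by (metis mult.assoc mult_1_right r_def)
    then show ?thesis using rr by (metis perm_right_cancel)
  qed
  have sr: "s * r = r ^ (2 ^ n - 1) * s"
    using inv ts by (metis mult.assoc r_def)
  have sri: "s * r ^ i = r ^ ((2 ^ n - 1) * i) * s" for i
  proof (induction i)
    case (Suc i)
    have "s * r ^ Suc i = (s * r ^ i) * r" by (simp only: power_Suc2 mult.assoc)
    also have "\<dots> = r ^ ((2 ^ n - 1) * i) * (s * r)" by (simp add: Suc mult.assoc)
    also have "\<dots> = r ^ ((2 ^ n - 1) * i + (2 ^ n - 1)) * s" by (simp only: sr power_add mult.assoc)
    finally show ?case by (simp add: algebra_simps)
  qed simp
  have srij: "\<exists>l. s ^ j * r ^ i = r ^ l * s ^ j" for i j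
  proof (induction j)
    case (Suc j)
    then obtain l where "s ^ j * r ^ i = r ^ l * s ^ j" by blast
    then have "s ^ Suc j * r ^ i = (s * r ^ l) * s ^ j" by (simp add: mult.assoc)
    then show ?case using sri by (auto simp: mult.assoc)
  qed (auto intro: exI [of _ i])
  have BH: "B \<subseteq> H" using perm_group_power [OF H(1)] H rH perm_groupD(3) [OF H(1)] by (auto simp: B_def)
  have "perm_group B"
    unfolding perm_group_def
  proof (intro conjI ballI)
    show "finite B" using BH perm_groupD(1) [OF H(1)] finite_subset by blast
    show "1 \<in> B" by (force simp: B_def intro: exI [of _ 0])
    fix a b assume "a \<in> B" "b \<in> B"
    then obtain i j k l where a: "a = r ^ i * s ^ j" and b: "b = r ^ k * s ^ l" by (auto simp: B_def)
    obtain q where "s ^ j * r ^ k = r ^ q * s ^ j" using srij by blast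
    then have "a * b = r ^ (i + q) * s ^ (j + l)"
      unfolding a b power_add by (metis mult.assoc)
    then show "a * b \<in> B" by (auto simp: B_def)
  qed
  moreover have "\<exists>k. a ^ (2 ^ k) = 1" if "a \<in> B" for a
  proof -
    from that obtain i j where a: "a = r ^ i * s ^ j" by (auto simp: B_def)
    have s2: "s ^ j = (if even j then 1 else s)"
      using inv by (induction j) auto
    show ?thesis
    proof (cases "even j")
      case True
      then have "a ^ (2 ^ n) = (r ^ (2 ^ n)) ^ i" by (simp add: a s2 power_mult [symmetric] mult.commute)
      then show ?thesis using ord by (metis power_one r_def)
    next
      case False
      have ri: "r ^ i * r ^ ((2 ^ n - 1) * i) = (r ^ (2 ^ n)) ^ i"
        by (simp add: power_add [symmetric] power_mult [symmetric] algebra_simps)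
      have "a * a = r ^ i * (s * r ^ i) * s" using False by (simp add: a s2 mult.assoc)
      also have "\<dots> = r ^ i * r ^ ((2 ^ n - 1) * i) * (s * s)" by (simp only: sri mult.assoc)
      also have "\<dots> = 1" using inv ri ord by (simp add: r_def)
      finally have "a ^ (2 ^ 1) = 1" by (simp add: power2_eq_square)
      then show ?thesis by blast
    qed
  qed
  moreover have "s \<in> B" by (force simp: B_def intro: exI [of _ 0] exI [of _ 1])
  moreover have "t \<in> B"
  proof -
    have "t = s * r" using inv by (simp add: r_def mult.assoc [symmetric])
    then show ?thesis using sr by (force simp: B_def intro: exI [of _ 1])
  qed
  moreover have "\<exists>i j. x = (s * t) ^ i * s ^ j" if "x \<in> B" for x
    using that by (auto simp: B_def r_def)
  ultimately show ?thesis using that [of B] BH unfolding two_group_def by blast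
qed

text \<open>The subgroup generated by a subset \<open>S\<close> of \<open>H\<close>; intersecting
  only subgroups of the finite group \<open>H\<close> keeps it finite.\<close>

definition perm_span :: "'a perm set \<Rightarrow> 'a perm set \<Rightarrow> 'a perm set" where
  "perm_span H S = \<Inter>{P. perm_group P \<and> S \<subseteq> P \<and> P \<subseteq> H}"

lemma perm_span_least: "perm_group P \<Longrightarrow> S \<subseteq> P \<Longrightarrow> P \<subseteq> H \<Longrightarrow> perm_span H S \<subseteq> P"
  by (auto simp: perm_span_def)

lemma perm_span:
  assumes "perm_group H" "S \<subseteq> H"
  shows "perm_group (perm_span H S)" "S \<subseteq> perm_span H S" "perm_span H S \<subseteq> H"
proof -
  show "perm_span H S \<subseteq> H" using assms by (auto simp: perm_span_def)
  then have "finite (perm_span H S)" using perm_groupD(1) [OF assms(1)] finite_subset by blast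
  then show "perm_group (perm_span H S)" by (auto simp: perm_group_def perm_span_def)
  show "S \<subseteq> perm_span H S" by (auto simp: perm_span_def)
qed

text \<open>The elements whose conjugate by \<open>g\<close> stays in the span form a subgroup
  containing \<open>S\<close>.\<close>

lemma perm_span_conj:
  assumes H: "perm_group H" "S \<subseteq> H" "g \<in> H" and S: "\<And>x. x \<in> S \<Longrightarrow> g * x * inverse g \<in> S"
    and x: "x \<in> perm_span H S"
  shows "g * x * inverse g \<in> perm_span H S"
proof -
  note sp = perm_span [OF H(1,2)]
  let ?P = "{x \<in> H. g * x * inverse g \<in> perm_span H S}"
  have "perm_group ?P"
    unfolding perm_group_def
  proof (intro conjI ballI)
    show "finite ?P" using perm_groupD(1) [OF H(1)] by auto
    show "1 \<in> ?P" using perm_groupD(2) [OF H(1)] perm_groupD(2) [OF sp(1)] by simp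
    fix a b assume ab: "a \<in> ?P" "b \<in> ?P"
    have "g * (a * b) * inverse g = (g * a * inverse g) * (g * b * inverse g)"
      by (simp add: mult.assoc)
    then show "a * b \<in> ?P" using ab perm_groupD(3) [OF H(1)] perm_groupD(3) [OF sp(1)] by auto
  qed
  then have "perm_span H S \<subseteq> ?P" by (rule perm_span_least) (use H S sp in auto)
  then show ?thesis using x by auto
qed

text \<open>Alperin and Lyons: two distinct maximal sets of conjugates generating a 2-group, chosen with the
  largest intersection, are joined by conjugates normalizing that intersection.\<close>
theorem baer_suzuki:
  fixes b :: "'a perm"
  assumes H: "perm_group H" and b: "b \<in> H" "b * b = 1"
    and two: "\<And>g. g \<in> H \<Longrightarrow> \<exists>n. (b * (g * b * inverse g)) ^ (2 ^ n) = 1"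
  obtains P where "two_group P" "P \<subseteq> H" "\<And>g. g \<in> H \<Longrightarrow> g * b * inverse g \<in> P"
proof -
  note Hm = perm_groupD(3) [OF H] and Hi = perm_group_inverse [OF H]
  define D where "D = (\<lambda>g. g * b * inverse g) ` H"
  have DH: "D \<subseteq> H" using Hm Hi b by (auto simp: D_def)
  have finD: "finite D" using perm_groupD(1) [OF H] by (simp add: D_def)
  have Dconj: "g * d * inverse g \<in> D" if "g \<in> H" "d \<in> D" for g d
  proof -
    from that obtain k where k: "k \<in> H" "d = k * b * inverse k" by (auto simp: D_def)
    then have "g * d * inverse g = (g * k) * b * inverse (g * k)" by (simp add: mult.assoc)
    then show ?thesis using Hm that k unfolding D_def by blast
  qed
  have Dinv: "d * d = 1" if "d \<in> D" for d
    using that b by (auto simp: D_def mult.assoc) (metis mult.assoc mult_1_left perm.right_inverse)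
  have Dinv': "inverse d = d" if "d \<in> D" for d
    using Dinv [OF that] by (metis mult_1_right perm_inverse_mult_cancel)
  have conj_pow: "(g * x * inverse g) ^ k = g * x ^ k * inverse g" for g x :: "'a perm" and k
    by (induction k) (auto simp: mult.assoc)
  have Dtwo: "\<exists>n. (s * t) ^ (2 ^ n) = 1" if "s \<in> D" "t \<in> D" for s t
  proof -
    from that obtain g k where gk: "g \<in> H" "k \<in> H" "s = g * b * inverse g" "t = k * b * inverse k"
      by (auto simp: D_def)
    let ?h = "inverse g * k"
    have "s * t = g * (b * (?h * b * inverse ?h)) * inverse g" using gk by (simp add: mult.assoc)
    moreover obtain n where "(b * (?h * b * inverse ?h)) ^ (2 ^ n) = 1" using two Hm Hi gk by blast
    ultimately have "(s * t) ^ (2 ^ n) = 1" by (simp only: conj_pow) simp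
    then show ?thesis ..
  qed
  \<comment> \<open>Sets of conjugates lying in a common 2-subgroup of \<open>H\<close>; the theorem
    amounts to \<open>D \<in> \<S>\<close>.\<close>
  define \<S> where "\<S> = {S. S \<subseteq> D \<and> two_group (perm_span H S)}"
  have finS: "finite \<S>" using finD by (simp add: \<S>_def)
  have SH: "S \<subseteq> H" if "S \<in> \<S>" for S using that DH by (auto simp: \<S>_def)
  have in_S: "S \<in> \<S>" if "S \<subseteq> D" "two_group P" "S \<subseteq> P" "P \<subseteq> H" for S P
    using that two_group_subset [OF that(2)] perm_span [OF H, of S] DH perm_span_least [of P S H]
    by (auto simp: \<S>_def two_group_def)
  define maxi where "maxi S \<longleftrightarrow> S \<in> \<S> \<and> (\<forall>T\<in>\<S>. S \<subseteq> T \<longrightarrow> T = S)" for S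
  have ext: "\<exists>U. maxi U \<and> S \<subseteq> U" if "S \<in> \<S>" for S
    using finite_has_maximal2 [OF finS that] by (metis maxi_def)
  \<comment> \<open>A maximal set contains every conjugate in the 2-group it generates, since adding
    one leaves it inside that 2-group.\<close>
  have maxi_eq: "x \<in> S" if "maxi S" "x \<in> D" "x \<in> perm_span H S" for S x
  proof -
    have S: "S \<subseteq> D" "two_group (perm_span H S)" "S \<subseteq> H" using that SH by (auto simp: maxi_def \<S>_def)
    have "insert x S \<in> \<S>"
      by (rule in_S [OF _ S(2)]) (use that S perm_span [OF H S(3)] in auto)
    then show ?thesis using that unfolding maxi_def by blast
  qed
  show thesis
  proof (cases "D \<in> \<S>")
    case True
    then show thesis using that [of "perm_span H D"] perm_span [OF H DH] by (auto simp: \<S>_def D_def)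
  next
    case False
    have single: "\<exists>U. maxi U \<and> d \<in> U" if d: "d \<in> D" for d
    proof -
      have dH: "d \<in> H" using d DH by blast
      obtain n where "(d * d) ^ (2 ^ n) = 1" using Dtwo d by blast
      then obtain B where "two_group B" "B \<subseteq> H" "d \<in> B"
        using dihedral_two_group [OF H dH dH Dinv [OF d] Dinv [OF d]] by metis
      then have "{d} \<in> \<S>" using in_S d by blast
      then show ?thesis using ext by blast
    qed
    have bD: "b \<in> D" using perm_groupD(2) [OF H] by (force simp: D_def)
    obtain S0 where S0: "maxi S0" using single bD by blast
    have "\<exists>T0. maxi T0 \<and> T0 \<noteq> S0"
    proof (rule ccontr)
      assume "\<not> ?thesis"
      then have "D \<subseteq> S0" using single by blast
      then have "S0 = D" using S0 by (auto simp: maxi_def \<S>_def)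
      then show False using S0 False by (simp add: maxi_def)
    qed
    then obtain T0 where T0: "maxi T0" "T0 \<noteq> S0" by blast
    define pairs where "pairs = {(S, T). maxi S \<and> maxi T \<and> S \<noteq> T}"
    have "pairs \<subseteq> \<S> \<times> \<S>" by (auto simp: pairs_def maxi_def)
    then have "finite pairs" using finS finite_subset by blast
    moreover have "(S0, T0) \<in> pairs" using S0 T0 by (auto simp: pairs_def)
    ultimately obtain q where q: "q \<in> pairs" "\<And>q'. q' \<in> pairs \<Longrightarrow> card (fst q' \<inter> snd q') \<le> card (fst q \<inter> snd q)"
      using Max_in [of "(\<lambda>q. card (fst q \<inter> snd q)) ` pairs"] Max_ge [of "(\<lambda>q. card (fst q \<inter> snd q)) ` pairs"]
      by (metis (no_types, lifting) empty_iff finite_imageI imageE image_eqI)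
    obtain S T where ST: "q = (S, T)" by fastforce
    have mS: "maxi S" and mT: "maxi T" and ne: "S \<noteq> T" using q ST by (auto simp: pairs_def)
    define R where "R = S \<inter> T"
    \<comment> \<open>By the choice of the pair, two maximal sets sharing \<open>R\<close> and one
      more element coincide.\<close>
    have big: "U = U'" if "maxi U" "maxi U'" "R \<subseteq> U \<inter> U'" "x \<in> U \<inter> U'" "x \<notin> R" for U U' x
    proof (rule ccontr)
      assume "U \<noteq> U'"
      then have "(U, U') \<in> pairs" using that by (auto simp: pairs_def)
      then have "card (U \<inter> U') \<le> card R" using q(2) ST by (force simp: R_def)
      moreover have "R \<subset> U \<inter> U'" using that by blast
      moreover have "finite (U \<inter> U')" using that finD by (auto simp: maxi_def \<S>_def intro: finite_subset)
      ultimately show False by (meson leD psubset_card_mono)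
    qed
    have RH: "R \<subseteq> H" "R \<subseteq> D" using mS SH by (auto simp: R_def maxi_def \<S>_def)
    have Rconj: "r * x * inverse r \<in> R" if "r \<in> R" "x \<in> R" for r x
    proof -
      have "r * x * inverse r \<in> U" if U: "maxi U" "R \<subseteq> U" for U
      proof (rule maxi_eq [OF U(1)])
        show "r * x * inverse r \<in> D" using Dconj RH \<open>r \<in> R\<close> \<open>x \<in> R\<close> by blast
        have sp: "perm_group (perm_span H U)" "U \<subseteq> perm_span H U"
          using perm_span [OF H, of U] U SH by (auto simp: maxi_def)
        show "r * x * inverse r \<in> perm_span H U"
          by (intro perm_groupD(3) [OF sp(1)] perm_group_inverse [OF sp(1)])
            (use sp(2) U(2) \<open>r \<in> R\<close> \<open>x \<in> R\<close> in auto)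
      qed
      then show ?thesis using mS mT by (auto simp: R_def)
    qed
    \<comment> \<open>Some conjugate in \<open>S'\<close> outside \<open>R\<close> normalizes
      \<open>R\<close>, because normalizers grow in the 2-group generated by
      \<open>S'\<close>.\<close>
    have grow: "\<exists>s. s \<in> S' \<and> s \<notin> R \<and> (\<forall>r\<in>R. s * r * inverse s \<in> R)" if S': "maxi S'" "R \<subseteq> S'" "S' \<noteq> R" for S'
    proof -
      have S'H: "S' \<subseteq> H" "two_group (perm_span H S')" using S' SH by (auto simp: maxi_def \<S>_def)
      let ?P = "perm_span H S'"
      have sp: "perm_group ?P" "S' \<subseteq> ?P" "?P \<subseteq> H" using perm_span [OF H S'H(1)] by auto
      define N where "N = {x \<in> ?P. \<forall>r\<in>R. x * r * inverse x \<in> R}"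
      have N: "perm_group N"
        unfolding perm_group_def
      proof (intro conjI ballI)
        show "finite N" using perm_groupD(1) [OF sp(1)] by (simp add: N_def)
        show "1 \<in> N" using perm_groupD(2) [OF sp(1)] by (simp add: N_def)
        fix x y assume xy: "x \<in> N" "y \<in> N"
        have "(x * y) * r * inverse (x * y) = x * (y * r * inverse y) * inverse x" for r
          by (simp add: mult.assoc)
        then show "x * y \<in> N" using xy perm_groupD(3) [OF sp(1)] by (auto simp: N_def)
      qed
      have RN: "R \<subseteq> N" using Rconj S' sp by (auto simp: N_def)
      show ?thesis
      proof (cases "N = ?P")
        case True
        obtain s where "s \<in> S'" "s \<notin> R" using S' by blast
        then show ?thesis using True sp by (auto simp: N_def)
      next
        case False
        obtain n where "card ?P = 2 ^ n" using two_group_card S'H by blast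
        \<comment> \<open>\<open>g\<close> normalizes \<open>N\<close> but lies outside it, so
          conjugation by it moves some \<open>r\<close> in \<open>R\<close> out of \<open>R\<close>
          while keeping it in \<open>N\<close>.\<close>
        then obtain g where g: "g \<in> ?P" "g \<notin> N" "\<And>a. a \<in> N \<Longrightarrow> inverse g * a * g \<in> N"
          using two_group_normalizer [OF sp(1) _ N] False by (auto simp: N_def)
        have "inverse g \<notin> N" using g perm_group_inverse [OF N] by (metis perm.inverse_inverse)
        then obtain r where r: "r \<in> R" "inverse g * r * g \<notin> R"
          using g perm_group_inverse [OF sp(1)] by (auto simp: N_def)
        have gH: "inverse g \<in> H" "inverse g \<in> ?P" using g sp Hi perm_group_inverse [OF sp(1)] by auto
        let ?s = "inverse g * r * g"
        have "?s \<in> D" using Dconj [OF gH(1), of r] r RH by auto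
        moreover have "?s \<in> ?P"
          by (intro perm_groupD(3) [OF sp(1)]) (use g(1) gH r S' sp(2) in auto)
        ultimately have "?s \<in> S'" using maxi_eq S' by blast
        moreover have "?s \<in> N" using g r RN by blast
        ultimately show ?thesis using r by (auto simp: N_def)
      qed
    qed
    have "S \<noteq> R" "T \<noteq> R" using mS mT ne unfolding R_def maxi_def by blast+
    then obtain s t where s: "s \<in> S" "s \<notin> R" "\<And>r. r \<in> R \<Longrightarrow> s * r * inverse s \<in> R"
      and t: "t \<in> T" "t \<notin> R" "\<And>r. r \<in> R \<Longrightarrow> t * r * inverse t \<in> R"
      using grow [of S] grow [of T] mS mT by (auto simp: R_def)
    have stD: "s \<in> D" "t \<in> D" using s t mS mT by (auto simp: maxi_def \<S>_def)
    then have stH: "s \<in> H" "t \<in> H" using DH by auto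
    obtain n where "(s * t) ^ (2 ^ n) = 1" using Dtwo stD by blast
    then obtain B where B: "two_group B" "B \<subseteq> H" "s \<in> B" "t \<in> B"
      and Bform: "\<And>x. x \<in> B \<Longrightarrow> \<exists>i j. x = (s * t) ^ i * s ^ j"
      using dihedral_two_group [OF H stH Dinv [OF stD(1)] Dinv [OF stD(2)]] by metis
    let ?A = "perm_span H R"
    have A: "perm_group ?A" "R \<subseteq> ?A" "?A \<subseteq> H" using perm_span [OF H RH(1)] by auto
    have Atwo: "two_group ?A"
    proof -
      have "S \<in> \<S>" using mS by (simp add: maxi_def)
      then have "two_group (perm_span H S)" "R \<subseteq> perm_span H S" "perm_span H S \<subseteq> H"
        using perm_span [OF H SH] by (auto simp: \<S>_def R_def)
      then show ?thesis using two_group_subset A perm_span_least by (metis two_group_def)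
    qed
    define normA where "normA = {x \<in> H. \<forall>a\<in>?A. x * a * inverse x \<in> ?A}"
    have nA: "perm_group normA"
      unfolding perm_group_def
    proof (intro conjI ballI)
      show "finite normA" using perm_groupD(1) [OF H] by (simp add: normA_def)
      show "1 \<in> normA" using perm_groupD(2) [OF H] by (simp add: normA_def)
      fix x y assume xy: "x \<in> normA" "y \<in> normA"
      have "(x * y) * a * inverse (x * y) = x * (y * a * inverse y) * inverse x" for a
        by (simp add: mult.assoc)
      then show "x * y \<in> normA" using xy Hm by (auto simp: normA_def)
    qed
    have "s \<in> normA" "t \<in> normA"
      using perm_span_conj [OF H RH(1)] stH s t by (auto simp: normA_def)
    then have Bn: "B \<subseteq> normA"
      using Bform perm_group_power [OF nA] perm_groupD(3) [OF nA] by (metis subsetI)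
    have Bg: "perm_group B" using B by (simp add: two_group_def)
    \<comment> \<open>\<open>B\<close> normalizes \<open>?A\<close>, so these products form a group;
      it is a 2-group because both factors are.\<close>
    define C where "C = {a * x | a x. a \<in> ?A \<and> x \<in> B}"
    have CH: "C \<subseteq> H" using A B Hm unfolding C_def by blast
    have swap: "\<exists>a'\<in>?A. x * a = a' * x" if "x \<in> B" "a \<in> ?A" for x a
    proof -
      have "x * a * inverse x \<in> ?A" using Bn that by (auto simp: normA_def)
      moreover have "x * a = (x * a * inverse x) * x" by (simp add: mult.assoc)
      ultimately show ?thesis by blast
    qed
    have Cg: "perm_group C"
      unfolding perm_group_def
    proof (intro conjI ballI)
      show "finite C" using CH perm_groupD(1) [OF H] finite_subset by blast
      show "1 \<in> C" using perm_groupD(2) [OF A(1)] perm_groupD(2) [OF Bg] by (force simp: C_def)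
      fix c c' assume "c \<in> C" "c' \<in> C"
      then obtain a x a' x' where c: "c = a * x" "c' = a' * x'" "a \<in> ?A" "a' \<in> ?A" "x \<in> B" "x' \<in> B"
        by (auto simp: C_def)
      obtain a'' where "a'' \<in> ?A" "x * a' = a'' * x" using swap c by blast
      then have "c * c' = (a * a'') * (x * x')" using c by (metis mult.assoc)
      then show "c * c' \<in> C"
        using c \<open>a'' \<in> ?A\<close> perm_groupD(3) [OF A(1)] perm_groupD(3) [OF Bg] unfolding C_def by blast
    qed
    \<comment> \<open>Modulo \<open>?A\<close> the powers are those of \<open>x\<close>, so a
      suitable 2-power lands in \<open>?A\<close>.\<close>
    have powC: "\<exists>a\<in>?A. (a0 * x) ^ k = a * x ^ k" if a0x: "a0 \<in> ?A" "x \<in> B" for a0 x k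
    proof (induction k)
      case 0
      then show ?case using perm_groupD(2) [OF A(1)] by auto
    next
      case (Suc k)
      then obtain a where a: "a \<in> ?A" "(a0 * x) ^ k = a * x ^ k" by blast
      obtain a' where a': "a' \<in> ?A" "x * a = a' * x" using swap a0x a by blast
      have "(a0 * x) ^ Suc k = a0 * (x * a) * x ^ k" using a by (simp add: mult.assoc)
      also have "\<dots> = (a0 * a') * x ^ Suc k" by (simp only: a' power_Suc mult.assoc)
      finally show ?case using a' a0x perm_groupD(3) [OF A(1)] by blast
    qed
    have "two_group C"
      unfolding two_group_def
    proof (intro conjI ballI Cg)
      fix c assume "c \<in> C"
      then obtain a0 x where c: "c = a0 * x" "a0 \<in> ?A" "x \<in> B" by (auto simp: C_def)
      obtain k where "x ^ (2 ^ k) = 1" using B c by (auto simp: two_group_def)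
      then obtain a where a: "a \<in> ?A" "c ^ (2 ^ k) = a" using powC [OF c(2,3), of "2 ^ k"] c by auto
      then obtain l where "a ^ (2 ^ l) = 1" using Atwo by (auto simp: two_group_def)
      then have "c ^ (2 ^ (k + l)) = 1" using a by (simp add: power_add power_mult)
      then show "\<exists>n. c ^ (2 ^ n) = 1" ..
    qed
    moreover have "insert s (insert t R) \<subseteq> C" (is "?I \<subseteq> C")
      using perm_groupD(2) [OF A(1)] perm_groupD(2) [OF Bg] A B by (force simp: C_def)
    moreover have "?I \<subseteq> D" using stD RH by simp
    ultimately have "?I \<in> \<S>" using in_S CH by metis
    \<comment> \<open>A maximal set through \<open>s\<close>, \<open>t\<close> and \<open>R\<close>
      meets both \<open>S\<close> and \<open>T\<close> in more than \<open>R\<close>, hence equals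
      both.\<close>
    then obtain U where U: "maxi U" "insert s (insert t R) \<subseteq> U" using ext by blast
    have "U = S" using big [OF U(1) mS, of s] U s by (auto simp: R_def)
    moreover have "U = T" using big [OF U(1) mT, of t] U t by (auto simp: R_def)
    ultimately show thesis using ne by simp
  qed
qed

section \<open>Permutations of a finite carrier\<close>

text \<open>Extends a bijection of a finite \<open>Q\<close> by the identity, so that it becomes an
  element of the group \<open>'a perm\<close>.\<close>

definition perm_on :: "'a set \<Rightarrow> ('a \<Rightarrow> 'a) \<Rightarrow> 'a perm" where
  "perm_on Q f = Perm (\<lambda>x. if x \<in> Q then f x else x)"

lemma perm_on_apply:
  assumes "finite Q" "bij_betw f Q Q"
  shows "perm_on Q f \<langle>$\<rangle> x = (if x \<in> Q then f x else x)"
proof -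
  have "bij_betw (\<lambda>x. if x \<in> Q then f x else x) Q Q"
    using assms(2) by (simp cong: bij_betw_cong)
  moreover have "bij_betw (\<lambda>x. if x \<in> Q then f x else x) (- Q) (- Q)"
    by (simp add: bij_betw_def inj_on_def)
  ultimately have "bij_betw (\<lambda>x. if x \<in> Q then f x else x) (Q \<union> - Q) (Q \<union> - Q)"
    by (rule bij_betw_combine) simp
  then have "bij (\<lambda>x. if x \<in> Q then f x else x)" by simp
  moreover have "finite {x. (if x \<in> Q then f x else x) \<noteq> x}"
    by (rule finite_subset [OF _ assms(1)]) auto
  ultimately show ?thesis by (simp add: perm_on_def Perm_inverse)
qed

definition sym_perms :: "'a set \<Rightarrow> 'a perm set" where
  "sym_perms Q = {p. \<forall>x. x \<notin> Q \<longrightarrow> p \<langle>$\<rangle> x = x}"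

lemma sym_perms_closed [simp]:
  "1 \<in> sym_perms Q"
  "p \<in> sym_perms Q \<Longrightarrow> q \<in> sym_perms Q \<Longrightarrow> p * q \<in> sym_perms Q"
  "p \<in> sym_perms Q \<Longrightarrow> inverse p \<in> sym_perms Q"
  by (auto simp: sym_perms_def) (metis perm_apply_inverse(1))

lemma sym_perms_apply [simp]:
  assumes "p \<in> sym_perms Q"
  shows "p \<langle>$\<rangle> x \<in> Q \<longleftrightarrow> x \<in> Q"
  using assms by (auto simp: sym_perms_def) (metis perm_apply_inverse(1))

lemma perm_on_sym:
  assumes "finite Q" "bij_betw f Q Q"
  shows "perm_on Q f \<in> sym_perms Q"
  by (simp add: sym_perms_def perm_on_apply [OF assms])

lemma sym_perms_eqI:
  assumes "p \<in> sym_perms Q" "q \<in> sym_perms Q" "\<And>x. x \<in> Q \<Longrightarrow> p \<langle>$\<rangle> x = q \<langle>$\<rangle> x"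
  shows "p = q"
proof (rule perm_eqI)
  fix x
  show "p \<langle>$\<rangle> x = q \<langle>$\<rangle> x" using assms by (cases "x \<in> Q") (auto simp: sym_perms_def)
qed

lemma finite_sym_perms:
  assumes "finite Q"
  shows "finite (sym_perms Q)"
proof (rule inj_on_finite [where f = "\<lambda>p. restrict (apply p) Q" and B = "Q \<rightarrow>\<^sub>E Q"])
  show "inj_on (\<lambda>p. restrict (apply p) Q) (sym_perms Q)"
  proof (rule inj_onI, rule sym_perms_eqI)
    fix p q x assume "restrict (apply p) Q = restrict (apply q) Q" "x \<in> Q"
    then show "p \<langle>$\<rangle> x = q \<langle>$\<rangle> x" by (metis restrict_apply')
  qed
  show "(\<lambda>p. restrict (apply p) Q) ` sym_perms Q \<subseteq> Q \<rightarrow>\<^sub>E Q" by auto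
  show "finite (Q \<rightarrow>\<^sub>E Q)" using assms by (simp add: finite_PiE)
qed

section \<open>Loops with automorphic inner mappings\<close>

locale loop_on =
  fixes Q :: "'a set" and m :: "'a \<Rightarrow> 'a \<Rightarrow> 'a" (infixl "\<cdot>" 70) and e :: 'a
  assumes is_loop: "loop Q m e"
begin

lemma unit_closed [simp]: "e \<in> Q"
  and mult_closed [simp]: "x \<in> Q \<Longrightarrow> y \<in> Q \<Longrightarrow> x \<cdot> y \<in> Q"
  and unit_left [simp]: "x \<in> Q \<Longrightarrow> e \<cdot> x = x"
  and unit_right [simp]: "x \<in> Q \<Longrightarrow> x \<cdot> e = x"
  using is_loop by (auto simp: loop_def)

lemma mult_left_cancel [simp]: "x \<in> Q \<Longrightarrow> y \<in> Q \<Longrightarrow> z \<in> Q \<Longrightarrow> x \<cdot> y = x \<cdot> z \<longleftrightarrow> y = z"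
  using is_loop unfolding loop_def by (metis mult_closed)

lemma mult_right_cancel [simp]: "x \<in> Q \<Longrightarrow> y \<in> Q \<Longrightarrow> z \<in> Q \<Longrightarrow> y \<cdot> x = z \<cdot> x \<longleftrightarrow> y = z"
  using is_loop unfolding loop_def by (metis mult_closed)

definition ld :: "'a \<Rightarrow> 'a \<Rightarrow> 'a" where
  "ld x y = (THE z. z \<in> Q \<and> x \<cdot> z = y)"

lemma ld: "x \<in> Q \<Longrightarrow> y \<in> Q \<Longrightarrow> ld x y \<in> Q \<and> x \<cdot> ld x y = y"
  unfolding ld_def by (rule theI') (use is_loop in \<open>auto simp: loop_def\<close>)

lemma ld_closed [simp]: "x \<in> Q \<Longrightarrow> y \<in> Q \<Longrightarrow> ld x y \<in> Q"
  and mult_ld [simp]: "x \<in> Q \<Longrightarrow> y \<in> Q \<Longrightarrow> x \<cdot> ld x y = y"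
  using ld by auto

lemma ld_mult [simp]: "x \<in> Q \<Longrightarrow> y \<in> Q \<Longrightarrow> ld x (x \<cdot> y) = y"
  by (metis ld mult_closed mult_left_cancel)

lemma ld_eqI: "x \<in> Q \<Longrightarrow> z \<in> Q \<Longrightarrow> x \<cdot> z = y \<Longrightarrow> ld x y = z"
  by auto

lemma ld_self [simp]: "x \<in> Q \<Longrightarrow> ld x x = e" "x \<in> Q \<Longrightarrow> ld e x = x"
  by (auto intro!: ld_eqI)

lemma bij_betw_mult: "x \<in> Q \<Longrightarrow> bij_betw (\<lambda>y. x \<cdot> y) Q Q"
  by (rule bij_betw_byWitness [where f' = "ld x"]) auto

lemma obtain_left_factor:
  assumes "x \<in> Q" "y \<in> Q"
  obtains z where "z \<in> Q" "z \<cdot> x = y"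
  using is_loop assms unfolding loop_def by metis

definition endo :: "('a \<Rightarrow> 'a) \<Rightarrow> bool" where
  "endo f \<longleftrightarrow> (\<forall>x\<in>Q. f x \<in> Q) \<and> (\<forall>x\<in>Q. \<forall>y\<in>Q. f (x \<cdot> y) = f x \<cdot> f y)"

lemma endo_closed: "endo f \<Longrightarrow> x \<in> Q \<Longrightarrow> f x \<in> Q"
  and endo_mult: "endo f \<Longrightarrow> x \<in> Q \<Longrightarrow> y \<in> Q \<Longrightarrow> f (x \<cdot> y) = f x \<cdot> f y"
  by (auto simp: endo_def)

lemma endo_ld: "endo f \<Longrightarrow> x \<in> Q \<Longrightarrow> y \<in> Q \<Longrightarrow> f (ld x y) = ld (f x) (f y)"
  by (rule sym, rule ld_eqI) (auto simp: endo_closed endo_mult [symmetric])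

lemma endo_unit: "endo f \<Longrightarrow> f e = e"
  using endo_ld [of f e e] by (simp add: endo_closed)

text \<open>The standard inner mappings: \<open>inner_T\<close> compares right with left
  translation, and \<open>inner_L\<close> below compares the composite of the left translations by
  \<open>x\<close> and \<open>y\<close> with that by \<open>x \<cdot> y\<close>.\<close>

definition inner_T :: "'a \<Rightarrow> 'a \<Rightarrow> 'a" where
  "inner_T x y = ld x (y \<cdot> x)"

definition inner_L :: "'a \<Rightarrow> 'a \<Rightarrow> 'a \<Rightarrow> 'a" where
  "inner_L x y z = ld (x \<cdot> y) (x \<cdot> (y \<cdot> z))"

lemma inner_closed [simp]:
  "x \<in> Q \<Longrightarrow> y \<in> Q \<Longrightarrow> inner_T x y \<in> Q"
  "x \<in> Q \<Longrightarrow> y \<in> Q \<Longrightarrow> z \<in> Q \<Longrightarrow> inner_L x y z \<in> Q"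
  by (auto simp: inner_T_def inner_L_def)

end

text \<open>The automorphic hypothesis in the form inherited by inner-invariant subloops and their
  quotients.\<close>

locale aloop = loop_on +
  assumes endo_T: "x \<in> Q \<Longrightarrow> endo (inner_T x)"
    and endo_L: "x \<in> Q \<Longrightarrow> y \<in> Q \<Longrightarrow> endo (inner_L x y)"
begin

definition J :: "'a \<Rightarrow> 'a" where
  "J x = ld x e"

lemma J_closed [simp]: "x \<in> Q \<Longrightarrow> J x \<in> Q"
  and mult_J [simp]: "x \<in> Q \<Longrightarrow> x \<cdot> J x = e"
  by (auto simp: J_def)

lemma inner_T_self [simp]: "x \<in> Q \<Longrightarrow> inner_T x x = x"
  by (simp add: inner_T_def)

text \<open>\<open>inner_T x\<close> is multiplicative and fixes \<open>x\<close>, so it can be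
  applied to \<open>y = x \<cdot> ld x y\<close> factor by factor.\<close>

lemma inner_T_alt:
  assumes "x \<in> Q" "y \<in> Q"
  shows "inner_T x y = ld x y \<cdot> x"
proof -
  have "inner_T x y = x \<cdot> inner_T x (ld x y)"
    using endo_mult [OF endo_T [OF assms(1)], of x "ld x y"] assms by simp
  then show ?thesis using assms by (simp add: inner_T_def)
qed

lemma J_mult [simp]: "x \<in> Q \<Longrightarrow> J x \<cdot> x = e"
  using inner_T_alt [of x e] endo_unit [OF endo_T] by (simp add: J_def)

lemma J_J [simp]: "x \<in> Q \<Longrightarrow> J (J x) = x"
  unfolding J_def by (rule ld_eqI) (auto simp: J_def [symmetric])

text \<open>The two formulas for \<open>inner_T x\<close> are compared at
  \<open>x \<cdot> y\<close>.\<close>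

lemma flexible: "x \<in> Q \<Longrightarrow> y \<in> Q \<Longrightarrow> (x \<cdot> y) \<cdot> x = x \<cdot> (y \<cdot> x)"
  using inner_T_alt [of x "x \<cdot> y"]
  by (simp add: inner_T_def) (metis mult_closed mult_ld)

lemma endo_J: "endo f \<Longrightarrow> x \<in> Q \<Longrightarrow> f (J x) = J (f x)"
  by (simp add: J_def endo_ld endo_unit)

text \<open>The inner mapping \<open>T\<^sub>a \<circ> L\<^sub>a\<^sub>,\<^sub>x\<close> fixes \<open>a\<close> and sends \<open>x \ z\<close> to \<open>(x \<cdot> a) \ (z \<cdot> a)\<close>.\<close>
lemma antiautomorphic_inverse:
  assumes w: "w \<in> Q" and v: "v \<in> Q"
  shows "J (w \<cdot> v) = J v \<cdot> J w"
proof -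
  define a where "a = w \<cdot> v"
  have a: "a \<in> Q" using assms by (simp add: a_def)
  \<comment> \<open>With this \<open>x\<close>, the endomorphism \<open>f\<close> defined next turns
    left division by \<open>x\<close> into left division by \<open>w\<close>.\<close>
  obtain x where x: "x \<in> Q" "x \<cdot> a = w" using obtain_left_factor [OF a w] by blast
  define f where "f z = inner_T a (inner_L a x z)" for z
  have endo: "endo f"
    using endo_T [OF a] endo_L [OF a x(1)] by (auto simp: endo_def f_def)
  have f_ld: "f (ld x z) = ld w (z \<cdot> a)" if z: "z \<in> Q" for z
  proof -
    have T_a: "inner_T a (a \<cdot> y) = y \<cdot> a" if "y \<in> Q" for y
      using that a by (simp add: inner_T_alt)
    have "f (ld x z) = inner_T a (ld (a \<cdot> x) (a \<cdot> z))"
      using a x z by (simp add: f_def inner_L_def)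
    then show ?thesis using a x z by (simp add: endo_ld [OF endo_T] T_a)
  qed
  \<comment> \<open>Flexibility makes \<open>inner_L a x\<close> fix \<open>a\<close>, hence
    \<open>f\<close> fixes \<open>a\<close> and \<open>J a\<close>.\<close>
  have "inner_L a x a = a"
    unfolding inner_L_def using flexible [of a x] a x(1) by (metis ld_mult mult_closed)
  then have "f a = a" using a by (simp add: f_def)
  then have f_Ja: "f (J a) = J a" using endo_J [OF endo a] by simp
  \<comment> \<open>\<open>f_ld\<close> at \<open>e\<close> gives \<open>f x = J v\<close>; at
    \<open>J a\<close> it yields \<open>J v \<cdot> J w = J a\<close>.\<close>
  have "f (J x) = ld w a" using f_ld [of e] a by (simp add: J_def)
  then have "f (J x) = v" using w v by (simp add: a_def)
  then have fx: "f x = J v" using endo_J [OF endo x(1)] endo_closed [OF endo x(1)] by (metis J_J)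
  have "f (ld x (J a)) = J w" using f_ld [of "J a"] a w by (simp add: J_def [of w])
  then have "ld (J v) (J a) = J w" using endo_ld [OF endo x(1), of "J a"] a fx f_Ja by simp
  then show ?thesis using a v by (metis J_closed a_def mult_ld)
qed

end

text \<open>Both kinds of inner mapping are words in translations and their inverses, hence agree on
  \<open>Q\<close> with members of \<open>Inn Q m e\<close>.\<close>

lemma automorphic_loop_aloop:
  assumes "automorphic_loop Q m e"
  shows "aloop Q m e"
proof -
  interpret loop_on Q m e using assms by unfold_locales (simp add: automorphic_loop_def)
  have inn: "endo f"
    if "g \<in> Mlt Q m" "\<And>x. x \<in> Q \<Longrightarrow> g x = f x" "f e = e" "\<And>x. x \<in> Q \<Longrightarrow> f x \<in> Q" for f g
  proof -
    have "g \<in> Inn Q m e" using that by (simp add: Inn_def)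
    then have "g \<in> loop_aut Q m" using assms by (auto simp: automorphic_loop_def)
    then have "g (m x y) = m (g x) (g y)" if "x \<in> Q" "y \<in> Q" for x y
      using that by (simp add: loop_aut_def)
    then show ?thesis using that unfolding endo_def by (metis mult_closed)
  qed
  have inv_L: "inv_into Q (restrict (\<lambda>y. m x y) Q) z = ld x z" if "x \<in> Q" "z \<in> Q" for x z
  proof -
    have "inv_into Q (restrict (m x) Q) (restrict (m x) Q (ld x z)) = ld x z"
      by (rule inv_into_f_f) (use that in \<open>auto simp: inj_on_def\<close>)
    then show ?thesis using that by simp
  qed
  have M_inv: "restrict (inv_into Q (restrict (\<lambda>y. m x y) Q)) Q \<in> Mlt Q m" if "x \<in> Q" for x
    using that by (intro Mlt.intros)
  show ?thesis
  proof
    fix x assume x: "x \<in> Q"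
    show "endo (inner_T x)"
    proof (rule inn)
      show "compose Q (restrict (inv_into Q (restrict (\<lambda>y. m x y) Q)) Q) (restrict (\<lambda>y. m y x) Q) \<in> Mlt Q m"
        using x M_inv by (intro Mlt_comp Mlt_R) auto
    qed (use x in \<open>auto simp: compose_def inv_L inner_T_def\<close>)
    fix y assume y: "y \<in> Q"
    show "endo (inner_L x y)"
    proof (rule inn)
      show "compose Q (restrict (inv_into Q (restrict (\<lambda>z. m (m x y) z) Q)) Q)
          (compose Q (restrict (\<lambda>z. m x z) Q) (restrict (\<lambda>z. m y z) Q)) \<in> Mlt Q m"
        using x y M_inv by (intro Mlt_comp Mlt_L) auto
    qed (use x y in \<open>auto simp: compose_def inv_L inner_L_def\<close>)
  qed
qed


section \<open>Automorphisms and translations as permutations\<close>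

locale finite_aloop = aloop +
  assumes finite_Q [simp]: "finite Q"
begin

definition L :: "'a \<Rightarrow> 'a perm" where
  "L x = perm_on Q (\<lambda>y. x \<cdot> y)"

lemma L_sym [simp]: "x \<in> Q \<Longrightarrow> L x \<in> sym_perms Q"
  and L_apply [simp]: "x \<in> Q \<Longrightarrow> y \<in> Q \<Longrightarrow> L x \<langle>$\<rangle> y = x \<cdot> y"
  by (simp_all add: L_def perm_on_sym perm_on_apply bij_betw_mult)

lemma inv_L_apply [simp]: "x \<in> Q \<Longrightarrow> y \<in> Q \<Longrightarrow> inverse (L x) \<langle>$\<rangle> y = ld x y"
  by (metis L_apply ld_closed mult_ld perm_apply_inverse(1))

lemma L_unit [simp]: "L e = 1"
  by (rule sym_perms_eqI [of _ Q]) simp_all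

text \<open>The full automorphism group, of which the inner mappings are only a part.\<close>

definition H :: "'a perm set" where
  "H = {h \<in> sym_perms Q. \<forall>x\<in>Q. \<forall>y\<in>Q. h \<langle>$\<rangle> (x \<cdot> y) = (h \<langle>$\<rangle> x) \<cdot> (h \<langle>$\<rangle> y)}"

lemma H_one [simp]: "1 \<in> H"
  and H_mult [simp]: "h \<in> H \<Longrightarrow> k \<in> H \<Longrightarrow> h * k \<in> H"
  and H_subset: "H \<subseteq> sym_perms Q"
  by (auto simp: H_def)

lemma HI:
  assumes "p \<in> sym_perms Q" "endo (apply p)"
  shows "p \<in> H"
  using assms by (auto simp: H_def endo_def)

lemma H_sym [simp]: "h \<in> H \<Longrightarrow> h \<in> sym_perms Q"
  and H_apply_mult: "h \<in> H \<Longrightarrow> x \<in> Q \<Longrightarrow> y \<in> Q \<Longrightarrow> h \<langle>$\<rangle> (x \<cdot> y) = (h \<langle>$\<rangle> x) \<cdot> (h \<langle>$\<rangle> y)"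
  by (auto simp: H_def)

lemma H_apply_closed [simp]: "h \<in> H \<Longrightarrow> h \<langle>$\<rangle> x \<in> Q \<longleftrightarrow> x \<in> Q"
  by simp

lemma H_endo: "h \<in> H \<Longrightarrow> endo (apply h)"
  by (auto simp: endo_def H_apply_mult)

lemma H_unit [simp]: "h \<in> H \<Longrightarrow> h \<langle>$\<rangle> e = e"
  using endo_unit [OF H_endo] by simp

lemma H_apply_ld: "h \<in> H \<Longrightarrow> x \<in> Q \<Longrightarrow> y \<in> Q \<Longrightarrow> h \<langle>$\<rangle> (ld x y) = ld (h \<langle>$\<rangle> x) (h \<langle>$\<rangle> y)"
  using endo_ld [OF H_endo] by simp

lemma perm_group_H: "perm_group H"
  unfolding perm_group_def using finite_subset [OF H_subset finite_sym_perms [OF finite_Q]] by simp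

lemma H_inverse [simp]: "h \<in> H \<Longrightarrow> inverse h \<in> H"
  by (rule perm_group_inverse [OF perm_group_H])

lemma H_L: "h \<in> H \<Longrightarrow> x \<in> Q \<Longrightarrow> h * L x = L (h \<langle>$\<rangle> x) * h"
  by (rule sym_perms_eqI [of _ Q]) (auto simp: H_apply_mult)

text \<open>The mapping \<open>inner_L x y\<close> as a permutation, arranged so that
  \<open>L x * L y = L (x \<cdot> y) * hh x y\<close>.\<close>

definition hh :: "'a \<Rightarrow> 'a \<Rightarrow> 'a perm" where
  "hh x y = inverse (L (x \<cdot> y)) * L x * L y"

lemma hh_H [simp]:
  assumes "x \<in> Q" "y \<in> Q"
  shows "hh x y \<in> H"
proof (rule HI)
  show "hh x y \<in> sym_perms Q" using assms by (simp add: hh_def)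
  show "endo (apply (hh x y))"
    using endo_L [OF assms] assms by (simp add: endo_def hh_def inner_L_def)
qed

lemma L_L: "L x * L y = L (x \<cdot> y) * hh x y"
  by (simp add: hh_def mult.assoc)

lemma hh_apply: "x \<in> Q \<Longrightarrow> y \<in> Q \<Longrightarrow> z \<in> Q \<Longrightarrow> hh x y \<langle>$\<rangle> z = ld (x \<cdot> y) (x \<cdot> (y \<cdot> z))"
  by (simp add: hh_def)

definition T :: "'a \<Rightarrow> 'a perm" where
  "T x = perm_on Q (inner_T x)"

lemma T_apply [simp]: "x \<in> Q \<Longrightarrow> y \<in> Q \<Longrightarrow> T x \<langle>$\<rangle> y = inner_T x y"
  and T_H [simp]: "x \<in> Q \<Longrightarrow> T x \<in> H"
proof -
  have bij: "bij_betw (inner_T x) Q Q" if "x \<in> Q" for x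
  proof -
    have "inj_on (inner_T x) Q"
      using that by (auto simp: inj_on_def inner_T_def) (metis mult_closed mult_ld mult_right_cancel)
    moreover have "inner_T x ` Q \<subseteq> Q" using that by auto
    ultimately show ?thesis by (simp add: bij_betw_def endo_inj_surj)
  qed
  show ap: "x \<in> Q \<Longrightarrow> y \<in> Q \<Longrightarrow> T x \<langle>$\<rangle> y = inner_T x y" for x y
    using bij by (simp add: T_def perm_on_apply)
  show "T x \<in> H" if "x \<in> Q"
  proof (rule HI)
    show "T x \<in> sym_perms Q" using bij that by (simp add: T_def perm_on_sym)
    show "endo (apply (T x))" using endo_T [OF that] that ap by (simp add: endo_def)
  qed
qed

end

section \<open>Inversion in a characteristically simple automorphic loop of 2-power order\<close>

locale char_simple_aloop = finite_aloop +
  assumes char_simple: "S \<subseteq> Q \<Longrightarrow> e \<in> S \<Longrightarrow> (\<And>x y. x \<in> S \<Longrightarrow> y \<in> S \<Longrightarrow> x \<cdot> y \<in> S) \<Longrightarrow>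
      (\<And>h x. h \<in> H \<Longrightarrow> x \<in> S \<Longrightarrow> h \<langle>$\<rangle> x \<in> S) \<Longrightarrow> S = {e} \<or> S = Q"
    and card_Q: "\<exists>k. card Q = 2 ^ k"
begin

definition Jp :: "'a perm" where
  "Jp = perm_on Q J"

lemma Jp_apply [simp]: "x \<in> Q \<Longrightarrow> Jp \<langle>$\<rangle> x = J x"
  and Jp_sym [simp]: "Jp \<in> sym_perms Q"
proof -
  have bij: "bij_betw J Q Q" by (rule bij_betw_byWitness [where f' = J]) auto
  show "x \<in> Q \<Longrightarrow> Jp \<langle>$\<rangle> x = J x" "Jp \<in> sym_perms Q"
    using bij by (simp_all add: Jp_def perm_on_apply perm_on_sym)
qed

lemma Jp_Jp: "Jp * Jp = 1"
  by (rule sym_perms_eqI [of _ Q]) auto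

lemma Jp_H: "h \<in> H \<Longrightarrow> h * Jp = Jp * h"
  by (rule sym_perms_eqI [of _ Q]) (auto simp: endo_J [OF H_endo])

text \<open>\<open>J\<close> reverses products and so turns left into right translation; right
  translation by \<open>a\<close> is \<open>L a * T a\<close>.\<close>

lemma Jp_L: "x \<in> Q \<Longrightarrow> Jp * L x = L (J x) * T (J x) * Jp"
  by (rule sym_perms_eqI [of _ Q]) (auto simp: antiautomorphic_inverse inner_T_def)

text \<open>The group generated by left translations, automorphisms and inversion: all its elements
  have this normal form, because translations can be moved to the left past \<open>H\<close> and
  \<open>Jp\<close>.\<close>

definition G :: "'a perm set" where
  "G = {L x * h * j | x h j. x \<in> Q \<and> h \<in> H \<and> j \<in> {1, Jp}}"

lemma G_intro: "x \<in> Q \<Longrightarrow> h \<in> H \<Longrightarrow> L x * h \<in> G" "x \<in> Q \<Longrightarrow> h \<in> H \<Longrightarrow> L x * h * Jp \<in> G"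
  unfolding G_def by (force, blast)

lemma L_G: "x \<in> Q \<Longrightarrow> L x \<in> G"
  using G_intro(1) [of x 1] by simp

lemma Jp_G: "Jp \<in> G"
  using G_intro(2) [of e 1] by simp

lemma G_cases:
  assumes "g \<in> G"
  obtains x h where "x \<in> Q" "h \<in> H" "g = L x * h" | x h where "x \<in> Q" "h \<in> H" "g = L x * h * Jp"
  using assms unfolding G_def by force

lemma G_sym [simp]: "g \<in> G \<Longrightarrow> g \<in> sym_perms Q"
  by (erule G_cases) simp_all

lemma G_L_form:
  assumes "x \<in> Q" "h \<in> H" "y \<in> Q"
  shows "\<exists>z\<in>Q. \<exists>k\<in>H. L x * h * L y = L z * k"
proof -
  have "L x * h * L y = L x * L (h \<langle>$\<rangle> y) * h" using assms by (simp add: H_L mult.assoc)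
  also have "\<dots> = L (x \<cdot> (h \<langle>$\<rangle> y)) * (hh x (h \<langle>$\<rangle> y) * h)" by (simp add: hh_def mult.assoc)
  finally show ?thesis using assms H_mult hh_H mult_closed H_apply_closed by metis
qed

lemma G_H: "g \<in> G \<Longrightarrow> h \<in> H \<Longrightarrow> g * h \<in> G"
proof (erule G_cases)
  fix x k assume "x \<in> Q" "k \<in> H" "g = L x * k" "h \<in> H"
  then show "g * h \<in> G" using G_intro(1) [of x "k * h"] by (simp add: mult.assoc)
next
  fix x k assume "x \<in> Q" "k \<in> H" "g = L x * k * Jp" "h \<in> H"
  then show "g * h \<in> G" using G_intro(2) [of x "k * h"] Jp_H [of h] by (simp add: mult.assoc)
qed

lemma G_Jp: "g \<in> G \<Longrightarrow> g * Jp \<in> G"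
  by (erule G_cases) (simp_all add: G_intro, simp add: G_intro mult.assoc Jp_Jp)

lemma G_L: "g \<in> G \<Longrightarrow> y \<in> Q \<Longrightarrow> g * L y \<in> G"
proof (erule G_cases)
  fix x h assume "y \<in> Q" "x \<in> Q" "h \<in> H" "g = L x * h"
  then show "g * L y \<in> G" using G_L_form [of x h y] G_intro(1) by fastforce
next
  fix x h assume *: "y \<in> Q" "x \<in> Q" "h \<in> H" "g = L x * h * Jp"
  then have "g * L y = L x * h * L (J y) * (T (J y) * Jp)" by (simp add: mult.assoc Jp_L)
  moreover obtain z k where "z \<in> Q" "k \<in> H" "L x * h * L (J y) = L z * k"
    using G_L_form [of x h "J y"] * by auto
  ultimately have "g * L y = L z * (k * T (J y)) * Jp" by (simp add: mult.assoc [symmetric])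
  then show "g * L y \<in> G" using G_intro(2) [of z "k * T (J y)"] * \<open>z \<in> Q\<close> \<open>k \<in> H\<close> by simp
qed

lemma perm_group_G: "perm_group G"
  unfolding perm_group_def
proof (intro conjI ballI)
  show "finite G" using finite_subset [OF _ finite_sym_perms [OF finite_Q]] G_sym by blast
  show "1 \<in> G" using L_G [of e] by simp
  fix g g' assume "g \<in> G" "g' \<in> G"
  from \<open>g' \<in> G\<close> show "g * g' \<in> G"
    by (rule G_cases) (use \<open>g \<in> G\<close> in \<open>auto simp: mult.assoc [symmetric] G_L G_H G_Jp\<close>)
qed

text \<open>Inversion transported from \<open>e\<close> to the point \<open>x\<close>.\<close>

definition Jc :: "'a \<Rightarrow> 'a perm" where
  "Jc x = L x * Jp * inverse (L x)"

text \<open>In \<open>g * L x = L y * c\<close> the factor \<open>c\<close> fixes \<open>e\<close>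
  and commutes with \<open>Jp\<close>; so \<open>y = g \<langle>$\<rangle> x\<close>, and
  \<open>c\<close> drops out of the conjugate.\<close>

lemma Jc_conj:
  assumes "g \<in> G" "x \<in> Q"
  shows "g * Jc x * inverse g = Jc (g \<langle>$\<rangle> x)"
proof -
  have key: "Jc (g \<langle>$\<rangle> x) = g * Jc x * inverse g"
    if "y \<in> Q" "c * Jp = Jp * c" "g * L x = L y * c" "c \<langle>$\<rangle> e = e" for y c
  proof -
    have "(g * L x) \<langle>$\<rangle> e = y" unfolding that(3) using that by simp
    then have y: "g \<langle>$\<rangle> x = y" using assms by simp
    have "g * Jc x * inverse g = (g * L x) * Jp * inverse (g * L x)"
      by (simp add: Jc_def mult.assoc)
    also have "\<dots> = L y * (c * Jp) * inverse c * inverse (L y)"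
      unfolding that(3) by (simp add: mult.assoc)
    also have "\<dots> = Jc y" unfolding that(2) by (simp add: Jc_def mult.assoc)
    finally show ?thesis using y by simp
  qed
  from G_L [OF assms] show ?thesis
  proof (rule G_cases)
    fix y h assume "y \<in> Q" "h \<in> H" "g * L x = L y * h"
    then show ?thesis using key [of y h] by (simp add: Jp_H)
  next
    fix y h assume "y \<in> Q" "h \<in> H" "g * L x = L y * h * Jp"
    then show ?thesis using key [of y "h * Jp"]
      by (simp add: mult.assoc Jp_H) (simp add: mult.assoc [symmetric] Jp_H J_def)
  qed
qed

lemma Jc_not_injective: "\<exists>x\<in>Q. x \<noteq> e \<and> Jc x = Jp"
  if "Q \<noteq> {e}"
proof (rule ccontr)
  assume no: "\<not> ?thesis"
  have Jc_e: "Jc e = Jp" by (simp add: Jc_def)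
  have inj: "x = y" if xy: "x \<in> Q" "y \<in> Q" "Jc x = Jc y" for x y
  proof -
    have g: "inverse (L x) \<in> G" using perm_group_inverse [OF perm_group_G L_G] xy by simp
    have "Jc (inverse (L x) \<langle>$\<rangle> y) = Jc (inverse (L x) \<langle>$\<rangle> x)"
      using Jc_conj [OF g] xy by metis
    then have "Jc (ld x y) = Jp" using xy Jc_e by simp
    then have "ld x y = e" using no xy by auto
    then show ?thesis using xy by (metis mult_ld unit_right)
  qed
  have Jp1: "Jp \<noteq> 1"
  proof
    assume "Jp = 1"
    then have "Jc x = Jc e" for x by (simp add: Jc_def)
    then show False using inj unit_closed that by blast
  qed
  obtain A a n where A: "perm_group A" "A \<subseteq> G" "card A = 2 ^ a" "card G = 2 ^ a * n" "odd n"
    using sylow_two_subgroup [OF perm_group_G] by blast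
  obtain k where k: "card Q = 2 ^ k" using card_Q by blast
  have transG: "(\<lambda>g. g \<langle>$\<rangle> e) ` G = Q"
  proof
    show "(\<lambda>g. g \<langle>$\<rangle> e) ` G \<subseteq> Q" by auto
    show "Q \<subseteq> (\<lambda>g. g \<langle>$\<rangle> e) ` G" using L_G by (metis (no_types, lifting) L_apply imageI subsetI unit_closed unit_right)
  qed
  define St where "St = {g \<in> G. g \<langle>$\<rangle> e = e}"
  have "card ((\<lambda>g. g \<langle>$\<rangle> e) ` G) * card St = card G"
    unfolding St_def by (rule orbit_stabilizer_card [OF perm_group_G, of _ Q]) auto
  then have "card Q * card St = card G" by (simp only: transG)
  then have cSt: "2 ^ k * card St = 2 ^ a * n" using A k by simp
  define SA where "SA = {g \<in> A. g \<langle>$\<rangle> e = e}"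
  have cA: "card ((\<lambda>g. g \<langle>$\<rangle> e) ` A) * card SA = 2 ^ a"
    unfolding SA_def A(3) [symmetric]
    by (rule orbit_stabilizer_card [OF A(1), of _ Q]) (use A(2) in \<open>auto simp: subset_iff\<close>)
  have St: "perm_group St" "perm_group SA" "SA \<subseteq> St"
    using perm_groupD [OF perm_group_G] perm_groupD [OF A(1)] A(2)
    by (auto simp: perm_group_def St_def SA_def)
  have "card SA dvd card St" using perm_group_card_dvd [OF St] .
  \<comment> \<open>Comparing powers of 2 in the two orbit-stabilizer equations shows that the orbit
    of \<open>e\<close> under \<open>A\<close> has at least \<open>card Q\<close> elements.\<close>
  then have "2 ^ k * card SA dvd 2 ^ a * n" using cSt by (metis mult_dvd_mono dvd_refl)
  moreover have "card SA dvd 2 ^ a" using cA by (metis dvd_triv_right)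
  then obtain b where b: "card SA = 2 ^ b" by (auto simp: divides_primepow_nat)
  ultimately have "2 ^ (k + b) dvd (2 ^ a * n :: nat)" by (simp add: power_add)
  then have "2 ^ (k + b) dvd (2 ^ a :: nat)" using A(5) by (simp add: coprime_dvd_mult_left_iff)
  then have "2 ^ (k + b) \<le> (2 ^ a :: nat)" by (rule dvd_imp_le) simp
  then have "2 ^ k * 2 ^ b \<le> card ((\<lambda>g. g \<langle>$\<rangle> e) ` A) * 2 ^ b" using cA b by (simp add: power_add)
  then have "card Q \<le> card ((\<lambda>g. g \<langle>$\<rangle> e) ` A)" using k by simp
  moreover have "(\<lambda>g. g \<langle>$\<rangle> e) ` A \<subseteq> Q" using A(2) by (auto simp: subset_iff)
  ultimately have trans: "(\<lambda>g. g \<langle>$\<rangle> e) ` A = Q" using card_seteq [OF finite_Q] by blast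
  let ?X = "(\<lambda>g. (*) g ` A) ` G"
  have "card ?X * 2 ^ a = 2 ^ a * n" using coset_card [OF perm_group_G A(1,2)] A by simp
  then have "card ?X = n" by simp
  then have oddX: "odd (card ?X)" using A(5) by simp
  have J2: "perm_group {1, Jp}" "card {1, Jp} = 2 ^ 1"
    using Jp1 Jp_Jp by (auto simp: perm_group_def)
  \<comment> \<open>Acting on the odd number of cosets of \<open>A\<close>, the involution
    \<open>Jp\<close> fixes one; so a conjugate of \<open>Jp\<close> lies in
    \<open>A\<close>.\<close>
  have "even (card ?X) \<longleftrightarrow> even (card {S \<in> ?X. \<forall>j\<in>{1, Jp}. (*) j ` S = S})"
  proof (rule parity_fixed_points [OF J2])
    show "finite ?X" using perm_groupD(1) [OF perm_group_G] by simp
    fix p S assume p: "p \<in> {1, Jp}" and "S \<in> ?X"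
    then obtain g where g: "g \<in> G" "S = (*) g ` A" by blast
    have "p * g \<in> G" using p g Jp_G perm_groupD [OF perm_group_G] by auto
    then show "(*) p ` S \<in> ?X" unfolding g image_mult_perm [symmetric] by (rule imageI)
  qed (simp_all only: image_mult_perm, simp add: image_def)
  then have "card {S \<in> ?X. \<forall>j\<in>{1, Jp}. (*) j ` S = S} \<noteq> 0" using oddX by (metis even_zero)
  then obtain S where "S \<in> {S \<in> ?X. \<forall>j\<in>{1, Jp}. (*) j ` S = S}"
    by (metis (no_types, lifting) all_not_in_conv card.empty)
  then have S: "S \<in> ?X" "(*) Jp ` S = S" by simp_all
  from S(1) obtain g where g: "g \<in> G" "S = (*) g ` A" by (elim imageE)
  have "g * 1 \<in> S" unfolding g(2) using perm_groupD(2) [OF A(1)] by (rule imageI)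
  then have "Jp * (g * 1) \<in> (*) Jp ` S" by (rule imageI)
  then have "Jp * (g * 1) \<in> (*) g ` A" using S(2) g(2) by simp
  then obtain c where c: "c \<in> A" "Jp * g = g * c" by auto
  have gi: "inverse g \<in> G" using g perm_group_inverse [OF perm_group_G] by blast
  define y where "y = inverse g \<langle>$\<rangle> e"
  have y: "y \<in> Q" using gi by (simp add: y_def)
  have "c = inverse g * Jc e * g" using c Jc_e by (simp add: mult.assoc)
  then have cy: "c = Jc y" using Jc_conj [OF gi unit_closed] by (simp add: y_def)
  have orbit: "\<exists>p\<in>A. p \<langle>$\<rangle> e = x" if "x \<in> Q" for x
  proof -
    have "x \<in> (\<lambda>g. g \<langle>$\<rangle> e) ` A" unfolding trans by (rule that)
    then show ?thesis by blast
  qed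
  \<comment> \<open>\<open>A\<close> is transitive and permutes the \<open>Jc x\<close> by
    conjugation, so one of them in \<open>A\<close> brings in all.\<close>
  have all: "Jc x \<in> A" if x: "x \<in> Q" for x
  proof -
    obtain p where p: "p \<in> A" "p \<langle>$\<rangle> e = x" using orbit [OF x] by blast
    obtain q where q: "q \<in> A" "q \<langle>$\<rangle> e = y" using orbit [OF y] by blast
    define r where "r = p * inverse q"
    have r: "r \<in> A" using p q perm_groupD(3) [OF A(1)] perm_group_inverse [OF A(1)] by (simp add: r_def)
    have "inverse q \<langle>$\<rangle> y = e" using q(2) by (metis perm_apply_inverse(1))
    then have "r \<langle>$\<rangle> y = x" using p by (simp add: r_def)
    then have "Jc x = r * c * inverse r" using Jc_conj [of r y] r A(2) y cy by auto
    then show ?thesis using r c perm_groupD(3) [OF A(1)] perm_group_inverse [OF A(1)] by simp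
  qed
  have "a \<noteq> 0"
  proof
    assume "a = 0"
    then obtain z where "A = {z}" using A(3) by (auto simp: card_1_singleton_iff)
    then have "Jc x = Jc e" if "x \<in> Q" for x using all that unit_closed by blast
    then show False using inj unit_closed that by blast
  qed
  then obtain z where z: "z \<in> A" "z \<noteq> 1" "\<And>b. b \<in> A \<Longrightarrow> b * z = z * b"
    using two_group_center [OF A(1,3)] by metis
  have zG: "z \<in> G" using z A by blast
  \<comment> \<open>\<open>z\<close> centralizes every \<open>Jc x\<close>, and injectivity turns
    this into fixing every point.\<close>
  have "z \<langle>$\<rangle> x = x" if "x \<in> Q" for x
  proof -
    have "Jc (z \<langle>$\<rangle> x) = z * Jc x * inverse z" using Jc_conj [OF zG that] by simp
    also have "\<dots> = Jc x" using z(3) [OF all [OF that], symmetric] by (simp add: mult.assoc)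
    finally show ?thesis using inj zG that by simp
  qed
  then have "z = 1" using zG by (intro sym_perms_eqI [of _ Q]) auto
  then show False using z by simp
qed

text \<open>\<open>Jc x = Jp\<close> says that \<open>L x\<close> commutes with \<open>J\<close>.
  These \<open>x\<close> form an invariant subloop, which is all of \<open>Q\<close> by
  \<open>Jc_not_injective\<close>; evaluating at \<open>e\<close> gives \<open>J x = x\<close>, so
  the antiautomorphism \<open>J\<close> is the identity.\<close>

theorem exponent_two:
  assumes "x \<in> Q"
  shows "x \<cdot> x = e"
    and "y \<in> Q \<Longrightarrow> x \<cdot> y = y \<cdot> x"
proof -
  define F where "F = {x \<in> Q. Jc x = Jp}"
  have "F = {e} \<or> F = Q"
  proof (rule char_simple)
    fix x y assume xy: "x \<in> F" "y \<in> F"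
    then have "Jc (x \<cdot> y) = L x * Jp * inverse (L x)"
      using Jc_conj [OF L_G, of x y] by (simp add: F_def)
    then show "x \<cdot> y \<in> F" using xy by (simp add: F_def Jc_def)
  next
    fix h x assume hx: "h \<in> H" "x \<in> F"
    have "h \<in> G" using G_intro(1) [of e h] hx by simp
    then have "Jc (h \<langle>$\<rangle> x) = h * Jp * inverse h" using Jc_conj [of h x] hx by (simp add: F_def)
    then show "h \<langle>$\<rangle> x \<in> F" using hx by (simp add: F_def Jp_H mult.assoc)
  qed (auto simp: F_def Jc_def)
  moreover have "Q = {e}" if "F = {e}" using Jc_not_injective that by (auto simp: F_def)
  ultimately have F: "F = Q" by auto
  have J: "J x = x" if x: "x \<in> Q" for x
  proof -
    have "L x * Jp * inverse (L x) * L x = Jp * L x" using x F by (auto simp: F_def Jc_def)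
    then have "(L x * Jp) \<langle>$\<rangle> e = (Jp * L x) \<langle>$\<rangle> e" by (simp add: mult.assoc)
    then show ?thesis using x by (simp add: J_def)
  qed
  show "x \<cdot> x = e" using mult_J [OF assms] J assms by simp
  show "x \<cdot> y = y \<cdot> x" if "y \<in> Q" using antiautomorphic_inverse [OF assms that] J assms that by simp
qed

end

lemma finite_maximizer:
  fixes f :: "'b \<Rightarrow> nat"
  assumes "finite X" "x \<in> X"
  obtains p where "p \<in> X" "\<And>y. y \<in> X \<Longrightarrow> f y \<le> f p"
proof -
  have "Max (f ` X) \<in> f ` X" using assms by (intro Max_in) auto
  then obtain p where "p \<in> X" "f p = Max (f ` X)" by auto
  then show ?thesis using that [of p] assms by simp
qed

section \<open>Commutative automorphic loops of exponent two\<close>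

context char_simple_aloop
begin

lemma sq [simp]: "x \<in> Q \<Longrightarrow> x \<cdot> x = e"
  by (rule exponent_two)

lemma comm: "x \<in> Q \<Longrightarrow> y \<in> Q \<Longrightarrow> x \<cdot> y = y \<cdot> x"
  by (rule exponent_two)

lemma ld_unit [simp]: "x \<in> Q \<Longrightarrow> ld x e = x"
  by (auto intro: ld_eqI)

lemma ld_mult' [simp]: "x \<in> Q \<Longrightarrow> y \<in> Q \<Longrightarrow> ld x (y \<cdot> x) = y"
  by (simp add: comm [of y x])

lemma mult_ld' [simp]: "x \<in> Q \<Longrightarrow> y \<in> Q \<Longrightarrow> ld x y \<cdot> x = y"
  by (simp add: comm [of "ld x y" x])

lemma ld_ld [simp]: "x \<in> Q \<Longrightarrow> y \<in> Q \<Longrightarrow> ld (ld x y) y = x"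
  by (rule ld_eqI) auto

text \<open>Since \<open>x \<cdot> x = e\<close>, this square is \<open>hh x x\<close> and hence an
  automorphism.\<close>

definition s :: "'a \<Rightarrow> 'a perm" where
  "s x = L x * L x"

lemma hh_self: "x \<in> Q \<Longrightarrow> hh x x = s x"
  by (simp add: hh_def s_def)

lemma s_H [simp]: "x \<in> Q \<Longrightarrow> s x \<in> H"
  using hh_H [of x x] by (simp add: hh_self)

lemma s_apply: "x \<in> Q \<Longrightarrow> y \<in> Q \<Longrightarrow> s x \<langle>$\<rangle> y = x \<cdot> (x \<cdot> y)"
  by (simp add: s_def)

lemma H_inv_L: "h \<in> H \<Longrightarrow> x \<in> Q \<Longrightarrow> h * inverse (L x) = inverse (L (h \<langle>$\<rangle> x)) * h"
  using H_L [of h x] by (metis mult.assoc perm_inverse_mult_cancel perm_mult_inverse_cancel perm_right_cancel perm.left_inverse mult_1_right)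

lemma H_s: "h \<in> H \<Longrightarrow> x \<in> Q \<Longrightarrow> h * s x = s (h \<langle>$\<rangle> x) * h"
  unfolding s_def using H_L [of h x] by (metis mult.assoc)

lemma H_hh:
  assumes "h \<in> H" "x \<in> Q" "y \<in> Q"
  shows "h * hh x y = hh (h \<langle>$\<rangle> x) (h \<langle>$\<rangle> y) * h"
proof -
  have "h * hh x y = (h * inverse (L (x \<cdot> y))) * L x * L y" by (simp add: hh_def mult.assoc)
  also have "\<dots> = inverse (L (h \<langle>$\<rangle> (x \<cdot> y))) * (h * L x) * L y"
    using assms by (simp add: H_inv_L mult.assoc)
  also have "\<dots> = inverse (L (h \<langle>$\<rangle> (x \<cdot> y))) * L (h \<langle>$\<rangle> x) * (h * L y)"
    using assms by (simp add: H_L mult.assoc)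
  finally show ?thesis using assms by (simp add: H_L hh_def H_apply_mult mult.assoc)
qed

lemma hh_fst [simp]: "x \<in> Q \<Longrightarrow> y \<in> Q \<Longrightarrow> hh x y \<langle>$\<rangle> x = x"
  by (simp add: hh_apply flexible [symmetric])

text \<open>The commutator of two left translations; as a quotient of \<open>hh x y\<close> and
  \<open>hh y x\<close> it is an automorphism.\<close>

definition cc :: "'a \<Rightarrow> 'a \<Rightarrow> 'a perm" where
  "cc x y = inverse (L x) * inverse (L y) * L x * L y"

lemma cc_swap: "L x * L y = L y * L x * cc x y"
  by (simp add: cc_def mult.assoc)

lemma inverse_cc: "inverse (cc x y) = cc y x"
  by (simp add: cc_def mult.assoc)

lemma hh_cc: "x \<in> Q \<Longrightarrow> y \<in> Q \<Longrightarrow> hh x y = hh y x * cc x y"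
  by (simp add: hh_def cc_def comm [of y x] mult.assoc)

lemma cc_H [simp]:
  assumes "x \<in> Q" "y \<in> Q"
  shows "cc x y \<in> H"
proof -
  have "cc x y = inverse (hh y x) * hh x y" using assms by (simp add: hh_cc [of x y])
  then show ?thesis using assms by simp
qed

text \<open>With \<open>x = p \ z\<close> and \<open>q = z \ x\<close>, the automorphisms \<open>hh x p\<close> and \<open>hh z q\<close> send \<open>p\<close> to \<open>q\<close> and
  \<open>q\<close> back to \<open>p\<close>, so conjugating translations by them determines \<open>L q\<close> and \<open>L p\<close>.\<close>
lemma
  assumes p: "p \<in> Q" and z: "z \<in> Q"
  shows cc_fst: "cc p z \<langle>$\<rangle> p = ld z (ld p z)"
    and cc_cc: "cc p z * cc p z = 1"
    and L_L_cc: "L p * L (cc p z \<langle>$\<rangle> p) = inverse (L z) * s p * L z"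
    and hh_cc_fst: "hh z (cc p z \<langle>$\<rangle> p) = hh z p"
    and mult_cc_fst: "z \<cdot> (p \<cdot> (cc p z \<langle>$\<rangle> p)) = s p \<langle>$\<rangle> z"
    and hh_L_ld: "hh z p * L (ld p z) = L z * L p"
proof -
  note [simp] = p z
  define x where "x = ld p z"
  define q where "q = ld z x"
  define h where "h = hh x p"
  define g where "g = hh z q"
  have [simp]: "x \<in> Q" "q \<in> Q" by (simp_all add: x_def q_def)
  have [simp]: "h \<in> H" "g \<in> H" by (simp_all add: h_def g_def)
  have xp: "x \<cdot> p = z" and zq: "z \<cdot> q = x" by (simp_all add: x_def q_def)
  have hp: "h \<langle>$\<rangle> p = q" by (simp add: h_def hh_apply xp q_def)
  have gq: "g \<langle>$\<rangle> q = p" by (simp add: g_def hh_apply zq) (simp add: x_def)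
  have hx: "h \<langle>$\<rangle> x = x" and gz: "g \<langle>$\<rangle> z = z" by (simp_all add: h_def g_def)
  have LxLp: "L x * L p = L z * h" by (simp add: L_L xp h_def)
  have LzLq: "L z * L q = L x * g" by (simp add: L_L zq g_def)
  have Lp: "L p = inverse (L x) * (L z * h)" unfolding LxLp [symmetric] by simp
  have Lq: "L q = inverse (L z) * (L x * g)" unfolding LzLq [symmetric] by simp
  have "L q * h = h * L p" using H_L [of h p] hp by simp
  also have "\<dots> = (h * inverse (L x)) * L z * h" by (simp add: Lp mult.assoc)
  also have "\<dots> = inverse (L x) * h * L z * h" by (simp add: H_inv_L hx)
  finally have Lq': "L q = inverse (L x) * h * L z" by (simp only: perm_right_cancel)
  have "L p * g = g * L q" using H_L [of g q] gq by simp
  also have "\<dots> = (g * inverse (L z)) * L x * g" by (simp add: Lq mult.assoc)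
  also have "\<dots> = inverse (L z) * g * L x * g" by (simp add: H_inv_L gz)
  finally have Lp': "L p = inverse (L z) * g * L x" by (simp only: perm_right_cancel)
  have gh: "s p = g * h"
  proof -
    have "s p = inverse (L z) * g * L x * (inverse (L x) * (L z * h))"
      unfolding s_def using Lp Lp' by simp
    also have "\<dots> = inverse (L z) * (g * L z) * h" by (simp add: mult.assoc)
    also have "\<dots> = g * h" by (simp add: H_L gz mult.assoc)
    finally show ?thesis .
  qed
  have LpLq: "L p * L q = inverse (L z) * s p * L z"
    unfolding gh by (subst Lp', subst Lq') (simp add: mult.assoc)
  have LzLp: "L z * L p = g * L x" by (subst Lp') (simp add: mult.assoc)
  then have "(L z * L p) \<langle>$\<rangle> e = (g * L x) \<langle>$\<rangle> e" by simp
  then have gx: "g \<langle>$\<rangle> x = z \<cdot> p" by simp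
  have "L (z \<cdot> p) * g = g * L x" using H_L [of g x] gx by simp
  then have hzp: "hh z p = g" using L_L [of z p] LzLp by (metis perm_left_cancel)
  have "(L p * L q) \<langle>$\<rangle> e = (inverse (L z) * s p * L z) \<langle>$\<rangle> e" using LpLq by simp
  then have pq: "p \<cdot> q = ld z (s p \<langle>$\<rangle> z)" by simp
  have "cc p z \<langle>$\<rangle> p = ld p (ld z (p \<cdot> (z \<cdot> p)))" by (simp add: cc_def)
  also have "\<dots> = ld p (ld z (s p \<langle>$\<rangle> z))" by (simp add: s_apply comm [of z p])
  also have "\<dots> = q" unfolding pq [symmetric] by simp
  finally have cq: "cc p z \<langle>$\<rangle> p = q" .
  then show "cc p z \<langle>$\<rangle> p = ld z (ld p z)" by (simp add: q_def x_def)
  show "L p * L (cc p z \<langle>$\<rangle> p) = inverse (L z) * s p * L z" unfolding cq by (rule LpLq)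
  show "hh z (cc p z \<langle>$\<rangle> p) = hh z p" unfolding cq hzp by (simp add: g_def)
  show "z \<cdot> (p \<cdot> (cc p z \<langle>$\<rangle> p)) = s p \<langle>$\<rangle> z" unfolding cq pq by simp
  show "hh z p * L (ld p z) = L z * L p" unfolding hzp LzLp x_def ..
  \<comment> \<open>\<open>L p * cc p z\<close> is a conjugate of \<open>L p\<close> by
    \<open>L z\<close>, so its square is the conjugate of \<open>s p\<close>, which equals
    \<open>L p * L q\<close>. Since \<open>cc p z\<close> also carries \<open>L p\<close> to
    \<open>L q\<close>, its square is trivial.\<close>
  have "L p * (cc p z * L p * cc p z) = (L p * cc p z) * (L p * cc p z)" by (simp add: mult.assoc)
  also have "\<dots> = inverse (L z) * s p * L z" by (simp add: cc_def s_def mult.assoc)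
  finally have "cc p z * L p * cc p z = L q" unfolding LpLq [symmetric] by simp
  then have "L q * (cc p z * cc p z) = L q" using H_L [of "cc p z" p] cq by (simp add: mult.assoc)
  then have "L q * (cc p z * cc p z) = L q * 1" by simp
  then show "cc p z * cc p z = 1" by (simp only: perm_left_cancel)
qed

lemma cc_sym: "x \<in> Q \<Longrightarrow> y \<in> Q \<Longrightarrow> cc y x = cc x y"
  using cc_cc [of x y] inverse_cc [of x y] by (metis mult_1_right perm_inverse_mult_cancel)

lemma cc_eq: "x \<in> Q \<Longrightarrow> y \<in> Q \<Longrightarrow> cc x y = inverse (L y) * inverse (L x) * L y * L x"
  using cc_sym [of x y] by (simp add: cc_def)

subsection \<open>Elements acting as involutions\<close>

definition N :: "'a set" where
  "N = {u \<in> Q. s u = 1}"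

lemma N_Q [simp]: "u \<in> N \<Longrightarrow> u \<in> Q"
  and N_s [simp]: "u \<in> N \<Longrightarrow> s u = 1"
  by (auto simp: N_def)

lemma N_L_L [simp]: "u \<in> N \<Longrightarrow> L u * L u = 1" "u \<in> N \<Longrightarrow> L u * (L u * p) = p"
  using N_s [of u] by (simp_all add: s_def mult.assoc [symmetric])

lemma N_inverse_L [simp]: "u \<in> N \<Longrightarrow> inverse (L u) = L u"
  by (metis N_L_L(1) mult_1_right perm_inverse_mult_cancel)

lemma N_mult [simp]: "u \<in> N \<Longrightarrow> x \<in> Q \<Longrightarrow> u \<cdot> (u \<cdot> x) = x"
  using s_apply [of u x] by simp

lemma N_mult' [simp]: "u \<in> N \<Longrightarrow> x \<in> Q \<Longrightarrow> (x \<cdot> u) \<cdot> u = x" "u \<in> N \<Longrightarrow> x \<in> Q \<Longrightarrow> u \<cdot> (x \<cdot> u) = x"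
    "u \<in> N \<Longrightarrow> x \<in> Q \<Longrightarrow> (u \<cdot> x) \<cdot> u = x"
  by (simp_all add: comm [of x u] comm [of "u \<cdot> x" u])

lemma N_ld [simp]: "u \<in> N \<Longrightarrow> x \<in> Q \<Longrightarrow> ld u x = u \<cdot> x"
  by (rule ld_eqI) auto

lemma N_unit [simp]: "e \<in> N"
  unfolding N_def by (simp add: s_def)

lemma N_H [simp]:
  assumes "u \<in> N" "h \<in> H"
  shows "h \<langle>$\<rangle> u \<in> N"
proof -
  have "1 * h = s (h \<langle>$\<rangle> u) * h" using H_s [of h u] assms by simp
  then have "s (h \<langle>$\<rangle> u) = 1" by (simp only: perm_right_cancel)
  then show ?thesis unfolding N_def using assms by simp
qed

text \<open>With \<open>s n = 1\<close>, \<open>mult_cc_fst\<close> says that the product of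
  \<open>n\<close> with this element is \<open>e\<close>, and so is
  \<open>n \<cdot> n\<close>.\<close>

lemma N_cc [simp]:
  assumes "n \<in> N" "y \<in> Q"
  shows "cc n y \<langle>$\<rangle> n = n"
proof -
  have "y \<cdot> (n \<cdot> (cc n y \<langle>$\<rangle> n)) = y \<cdot> e" using mult_cc_fst [of n y] assms by simp
  then have "n \<cdot> (cc n y \<langle>$\<rangle> n) = n \<cdot> n" using assms by (subst (asm) mult_left_cancel) simp_all
  then show ?thesis using assms by (simp del: sq)
qed

lemma N_hh [simp]: "n \<in> N \<Longrightarrow> y \<in> Q \<Longrightarrow> hh y n \<langle>$\<rangle> n = n"
  by (simp add: hh_apply) (rule ld_eqI, auto)

text \<open>Conjugation by \<open>cc n y\<close> fixes \<open>n\<close> and replaces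
  \<open>y\<close> by \<open>cc n y \<langle>$\<rangle> y\<close>, which by \<open>hh_cc_fst\<close>
  does not change \<open>hh n y\<close>.\<close>

lemma N_cc_hh:
  assumes "n \<in> N" "y \<in> Q"
  shows "cc n y * hh n y = hh n y * cc n y" and "cc n y * hh y n = hh y n * cc n y"
proof -
  have "cc n y * hh n y = hh n (cc y n \<langle>$\<rangle> y) * cc n y"
    using H_hh [of "cc n y" n y] assms cc_sym [of n y] by simp
  then show 1: "cc n y * hh n y = hh n y * cc n y" using hh_cc_fst [of y n] assms by simp
  have "hh y n * cc n y = hh n y" using hh_cc [of n y] assms by simp
  moreover have "hh y n = hh n y * cc n y" using hh_cc [of y n] assms cc_sym [of n y] by simp
  ultimately show "cc n y * hh y n = hh y n * cc n y" using 1 by (metis mult.assoc)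
qed

text \<open>Substituting \<open>L n * L y * inverse (hh n y)\<close> for
  \<open>L (n \<cdot> y)\<close> gives a conjugate of \<open>cc n y\<close> by
  \<open>hh n y\<close>, and these commute.\<close>

lemma N_cc_mult:
  assumes "n \<in> N" "y \<in> Q"
  shows "cc n (n \<cdot> y) = cc n y"
proof -
  let ?h = "hh n y"
  have L: "L (n \<cdot> y) = L n * L y * inverse ?h" by (simp add: L_L mult.assoc)
  have "cc n (n \<cdot> y) = L n * (?h * inverse (L y) * L n) * L n * (L n * L y * inverse ?h)"
    unfolding cc_def L using assms by (simp add: mult.assoc)
  also have "\<dots> = (L n * ?h) * inverse (L y) * L n * L y * inverse ?h"
    using assms by (simp add: mult.assoc)
  also have "\<dots> = ?h * cc n y * inverse ?h"
    using assms H_L [of ?h n] by (simp add: cc_def mult.assoc) (metis mult.assoc)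
  also have "\<dots> = cc n y" using N_cc_hh(1) [OF assms, symmetric] by (simp add: mult.assoc)
  finally show ?thesis .
qed

lemma N_L_cc: "n \<in> N \<Longrightarrow> y \<in> Q \<Longrightarrow> inverse (L y) * L n * L y = L n * cc n y"
  by (simp add: cc_def mult.assoc)

text \<open>The conjugate \<open>b\<close> of \<open>L v\<close> by \<open>L x\<close> is also a
  conjugate of \<open>L n\<close>, because \<open>s x\<close> carries \<open>L n\<close> to
  \<open>L v\<close>; it differs from \<open>L v\<close> by an automorphism \<open>c\<close> fixing
  both \<open>n\<close> and \<open>v\<close>.\<close>

lemma N_L_commute:
  assumes n: "n \<in> N" and x: "x \<in> Q"
  shows "L n * L (s x \<langle>$\<rangle> n) = L (s x \<langle>$\<rangle> n) * L n"
proof -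
  define v where "v = s x \<langle>$\<rangle> n"
  have v: "v \<in> N" using assms by (simp add: v_def)
  note [simp] = n x v
  define c where "c = cc v x"
  define b where "b = L v * c"
  have c: "c \<in> H" "c \<langle>$\<rangle> v = v" by (simp_all add: c_def)
  have b: "b = inverse (L x) * L v * L x" using N_L_cc [of v x] by (simp add: b_def c_def)
  have "s x * L n = L v * s x" using H_L [of "s x" n] by (simp add: v_def)
  then have b': "b = L x * L n * inverse (L x)"
    unfolding b s_def by (metis mult.assoc mult_1_right perm.right_inverse perm_inverse_mult_cancel)
  have "cc x n \<langle>$\<rangle> x = n \<cdot> ld x n" using cc_fst [of x n] by simp
  then have "n \<cdot> (x \<cdot> (n \<cdot> ld x n)) = v" using mult_cc_fst [of x n] by (simp add: v_def)
  \<comment> \<open>Evaluating both forms of \<open>b\<close> at \<open>n\<close> shows that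
    \<open>c\<close> fixes \<open>n\<close>.\<close>
  then have "b \<langle>$\<rangle> n = n \<cdot> v" unfolding b' by (simp, metis N_Q N_mult ld_closed mult_closed n x)
  then have "c \<langle>$\<rangle> n = n" unfolding b_def using c comm [of n v] by simp
  then have cn: "c * L n = L n * c" using H_L [of c n] c by simp
  have cv: "c * L v = L v * c" using H_L [of c v] c by simp
  have bv: "b * L v = L v * b" unfolding b_def using cv by (simp add: mult.assoc)
  \<comment> \<open>Conjugating \<open>b * L v = L v * b\<close> by \<open>L x\<close> makes
    \<open>L n\<close> commute with \<open>b\<close>.\<close>
  have "inverse (L x) * b * L x = L n" unfolding b' by (simp add: mult.assoc)
  then have "L n * b = inverse (L x) * (b * L v) * L x" unfolding b by (metis mult.assoc perm_mult_inverse_cancel)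
  also have "\<dots> = b * L n" unfolding bv unfolding \<open>inverse (L x) * b * L x = L n\<close> [symmetric]
    by (simp add: b mult.assoc)
  finally have "L n * b = b * L n" .
  then have "L n * L v * c = L v * L n * c" unfolding b_def using cn by (simp add: mult.assoc)
  then show ?thesis by (simp add: v_def)
qed

text \<open>The common value is also where the inverse of \<open>hh y u\<close> sends
  \<open>v\<close>. It is needed to show that the divisions \<open>y \<mapsto> ld y u\<close> with
  \<open>u\<close> in \<open>N\<close> commute.\<close>

lemma
  assumes u: "u \<in> N" and v: "v \<in> N" and y: "y \<in> Q"
  defines "w \<equiv> u \<cdot> v"
  shows hh_N_N: "hh y u \<langle>$\<rangle> v = u \<cdot> (cc v y \<langle>$\<rangle> w)"
    and mult_cc_N_N: "w \<cdot> (cc w y \<langle>$\<rangle> u) = u \<cdot> (cc v y \<langle>$\<rangle> w)"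
proof -
  have w: "w \<in> Q" using u v by (simp add: w_def)
  note [simp] = u v y w
  have wu: "w \<cdot> u = v" "u \<cdot> w = v" and wv: "w \<cdot> v = u" "v \<cdot> w = u"
    by (simp_all add: w_def comm [of u v])
  define h where "h = hh u v"
  have h [simp]: "h \<in> H" by (simp add: h_def)
  have LuLv: "L u * L v = L w * h" by (simp add: L_L w_def h_def)
  have uv: "u \<cdot> (v \<cdot> t) = w \<cdot> (h \<langle>$\<rangle> t)" if "t \<in> Q" for t
  proof -
    have "(L u * L v) \<langle>$\<rangle> t = (L w * h) \<langle>$\<rangle> t" by (simp only: LuLv)
    then show ?thesis using that by simp
  qed
  have cw: "v \<cdot> (cc v y' \<langle>$\<rangle> u) = cc v y' \<langle>$\<rangle> w" if "y' \<in> Q" for y'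
    using that H_apply_mult [of "cc v y'" v u] by (simp add: w_def comm [of u v])
  have B_inv: "ld y' ((y' \<cdot> u) \<cdot> t) = u \<cdot> (inverse (hh y' u) \<langle>$\<rangle> t)" if "y' \<in> Q" "t \<in> Q" for y' t
    using that by (simp add: hh_def)
  have B_inv_v: "inverse (hh y' u) \<langle>$\<rangle> v = u \<cdot> (cc v y' \<langle>$\<rangle> w)" if y': "y' \<in> Q" for y'
  proof -
    have "(inverse (L y') * L v * L y') \<langle>$\<rangle> u = (L v * cc v y') \<langle>$\<rangle> u" using y' by (simp add: N_L_cc)
    then have "ld y' (v \<cdot> (y' \<cdot> u)) = cc v y' \<langle>$\<rangle> w" using y' cw by simp
    moreover have "v \<cdot> (y' \<cdot> u) = (y' \<cdot> u) \<cdot> v" using y' by (simp add: comm)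
    ultimately have "u \<cdot> (inverse (hh y' u) \<langle>$\<rangle> v) = cc v y' \<langle>$\<rangle> w" using B_inv [OF y', of v] by simp
    then show ?thesis using y' by (metis H_inverse H_apply_closed N_Q N_mult hh_H u v)
  qed
  have fix_inv: "inverse (hh y' u) \<langle>$\<rangle> u = u" if "y' \<in> Q" for y'
    using N_hh [of u y'] that by (metis perm_apply_inverse(1) u)
  have B_inv_w: "inverse (hh y' u) \<langle>$\<rangle> w = cc v y' \<langle>$\<rangle> w" if y': "y' \<in> Q" for y'
    using H_apply_mult [of "inverse (hh y' u)" u v] y' B_inv_v [OF y'] fix_inv [OF y']
    by (simp add: w_def)
  have r: "w \<cdot> (cc w y' \<langle>$\<rangle> u) = u \<cdot> (cc v y' \<langle>$\<rangle> w)" if y': "y' \<in> Q" for y'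
  proof -
    have "w \<cdot> (cc w y' \<langle>$\<rangle> u) = ld y' (w \<cdot> (y' \<cdot> u))" using y' by (simp add: cc_def)
    also have "w \<cdot> (y' \<cdot> u) = (y' \<cdot> u) \<cdot> w" using y' by (simp add: comm)
    finally show ?thesis using B_inv [OF y', of w] B_inv_w [OF y'] by simp
  qed
  then show "w \<cdot> (cc w y \<langle>$\<rangle> u) = u \<cdot> (cc v y \<langle>$\<rangle> w)" by simp
  \<comment> \<open>The factor \<open>h\<close> depends only on \<open>u\<close> and
    \<open>v\<close>, so the value at \<open>u\<close> inherits from \<open>cc v y'\<close> the
    invariance under replacing \<open>y'\<close> by \<open>v \<cdot> y'\<close>.\<close>
  have r': "cc w y' \<langle>$\<rangle> u = h \<langle>$\<rangle> (cc v y' \<langle>$\<rangle> u)" if y': "y' \<in> Q" for y'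
    using r [OF y'] cw [OF y'] uv [of "cc v y' \<langle>$\<rangle> u"] y' by (metis H_apply_closed N_Q cc_H h mult_left_cancel u v w)
  define r0 where "r0 = cc w y \<langle>$\<rangle> u"
  have r0 [simp]: "r0 \<in> N" by (simp add: r0_def)
  have "cc w (v \<cdot> y) \<langle>$\<rangle> u = r0" using r' [of y] r' [of "v \<cdot> y"] by (simp add: N_cc_mult r0_def)
  \<comment> \<open>Taking \<open>y' = v \<cdot> y\<close> determines \<open>ld w y\<close>, to
    which \<open>hh_L_ld\<close> applies.\<close>
  moreover have "w \<cdot> (y' \<cdot> (cc w y' \<langle>$\<rangle> u)) = y' \<cdot> v" if y': "y' \<in> Q" for y'
  proof -
    have "(L w * L y' * cc w y') \<langle>$\<rangle> u = (L y' * L w) \<langle>$\<rangle> u"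
      using cc_swap [of y' w] cc_sym [of w y'] y' by simp
    then show ?thesis using y' wu by simp
  qed
  ultimately have "w \<cdot> ((v \<cdot> y) \<cdot> r0) = y" by (metis N_mult'(3) mult_closed N_Q v y)
  then have "(v \<cdot> y) \<cdot> r0 = ld w y" by (metis ld_mult mult_closed N_Q v y w r0)
  then have "r0 \<cdot> ld w y = v \<cdot> y" by (metis N_mult'(2) mult_closed N_Q v y r0)
  then have x_r0: "ld w y \<cdot> r0 = v \<cdot> y" by (simp add: comm)
  have "(hh y w * L (ld w y)) \<langle>$\<rangle> r0 = (L y * L w) \<langle>$\<rangle> r0" by (simp add: hh_L_ld)
  then have "hh y w \<langle>$\<rangle> (v \<cdot> y) = y \<cdot> (w \<cdot> r0)" using x_r0 by simp
  then have "y \<cdot> (hh y w \<langle>$\<rangle> v) = y \<cdot> (w \<cdot> r0)" by (simp add: H_apply_mult) (simp add: comm)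
  then have "hh y w \<langle>$\<rangle> v = w \<cdot> r0" by simp
  then have hyw: "ld (y \<cdot> w) (y \<cdot> u) = w \<cdot> r0" by (simp add: hh_apply wv)
  define n where "n = hh y u \<langle>$\<rangle> v"
  have n [simp]: "n \<in> N" by (simp add: n_def)
  have "(y \<cdot> u) \<cdot> n = y \<cdot> w" by (simp add: n_def hh_apply w_def)
  then have "(y \<cdot> w) \<cdot> n = y \<cdot> u" by (metis N_mult'(1) mult_closed N_Q u y n)
  then have "n = w \<cdot> r0" using hyw by (metis ld_mult mult_closed N_Q y w n)
  then show "hh y u \<langle>$\<rangle> v = u \<cdot> (cc v y \<langle>$\<rangle> w)" using r [of y] by (simp add: n_def r0_def)
qed

text \<open>With \<open>w = u \<cdot> v\<close>, conjugating
  \<open>L u * L w * L u = L v * L w * L v\<close> by \<open>L y\<close> and evaluating at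
  \<open>e\<close> gives the two sides.\<close>

lemma cc_cc_commute:
  assumes u: "u \<in> N" and v: "v \<in> N" and y: "y \<in> Q"
  shows "cc u y \<langle>$\<rangle> (cc v y \<langle>$\<rangle> (u \<cdot> v)) = cc v y \<langle>$\<rangle> (cc u y \<langle>$\<rangle> (u \<cdot> v))"
proof -
  define w where "w = u \<cdot> v"
  have w: "w \<in> Q" and vu: "v \<cdot> u = w" using u v by (simp_all add: w_def comm)
  note [simp] = u v y w
  define h where "h = inverse (hh u v)"
  have [simp]: "h \<in> H" by (simp add: h_def)
  have Lw: "L w = L u * L v * h" by (simp add: L_L w_def h_def mult.assoc)
  have "inverse (hh u v) \<langle>$\<rangle> u = u" "inverse (hh u v) \<langle>$\<rangle> v = v"
    by (metis hh_fst perm_apply_inverse(1) N_Q u v, metis N_hh N_Q perm_apply_inverse(1) u v)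
  then have hu: "h * L u = L u * h" and hv: "h * L v = L v * h"
    using H_L [of h u] H_L [of h v] by (simp_all add: h_def)
  have "L u * L w * L u = L v * (h * L u)" by (simp add: Lw mult.assoc)
  moreover have "L v * L w * L v = L v * L u * (L v * (h * L v))" by (simp add: Lw mult.assoc)
  ultimately have eq: "L u * L w * L u = L v * L w * L v" by (simp add: hu hv mult.assoc)
  let ?c = "\<lambda>p. inverse (L y) * p * L y"
  have conj: "?c (p * q) = ?c p * ?c q" for p q by (simp add: mult.assoc)
  have Lwy: "?c (L w) = L w * cc w y" by (simp add: cc_def mult.assoc)
  have "?c (L u) * ?c (L w) * ?c (L u) = ?c (L v) * ?c (L w) * ?c (L v)"
    using arg_cong [OF eq, of ?c] by (simp only: conj)
  then have eq': "L u * cc u y * (L w * cc w y) * (L u * cc u y)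
      = L v * cc v y * (L w * cc w y) * (L v * cc v y)"
    by (simp only: Lwy N_L_cc u v y)
  have ru: "w \<cdot> (cc w y \<langle>$\<rangle> u) = u \<cdot> (cc v y \<langle>$\<rangle> w)"
    using mult_cc_N_N [OF u v y] by (simp add: w_def)
  have rv: "w \<cdot> (cc w y \<langle>$\<rangle> v) = v \<cdot> (cc u y \<langle>$\<rangle> w)"
    using mult_cc_N_N [OF v u y] by (simp add: vu)
  from arg_cong [OF eq', of "\<lambda>p. p \<langle>$\<rangle> e"] show ?thesis
    by (simp add: ru rv H_apply_mult w_def [symmetric])
qed

text \<open>By \<open>cc_cc_commute\<close> the right side is symmetric in \<open>u\<close> and
  \<open>v\<close>, hence so is the left side.\<close>

lemma ld_N_N_commute_aux:
  assumes u: "u \<in> N" and v: "v \<in> N" and y: "y \<in> Q"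
  shows "ld (u \<cdot> y) (s y \<langle>$\<rangle> v) = y \<cdot> (cc u y \<langle>$\<rangle> (cc v y \<langle>$\<rangle> (u \<cdot> v)))"
proof (rule ld_eqI)
  note [simp] = u v y
  define t where "t = cc v y \<langle>$\<rangle> (u \<cdot> v)"
  have [simp]: "t \<in> Q" by (simp add: t_def)
  have "(L y * cc u y) \<langle>$\<rangle> t = (L u * L y * L u) \<langle>$\<rangle> t"
    using cc_eq [of u y] by (simp add: mult.assoc)
  then have 1: "y \<cdot> (cc u y \<langle>$\<rangle> t) = u \<cdot> (y \<cdot> (u \<cdot> t))" by simp
  have "u \<cdot> t = hh y u \<langle>$\<rangle> v" using hh_N_N [OF u v y] by (simp add: t_def)
  then have 2: "u \<cdot> (y \<cdot> (u \<cdot> t)) = hh y u \<langle>$\<rangle> (u \<cdot> (y \<cdot> v))" by (simp add: H_apply_mult)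
  have "(u \<cdot> y) \<cdot> (hh y u \<langle>$\<rangle> (u \<cdot> (y \<cdot> v))) = s y \<langle>$\<rangle> v"
    by (simp add: hh_apply s_apply comm [of u y])
  then show "(u \<cdot> y) \<cdot> (y \<cdot> (cc u y \<langle>$\<rangle> (cc v y \<langle>$\<rangle> (u \<cdot> v)))) = s y \<langle>$\<rangle> v"
    using 1 2 by (simp add: t_def)
qed (use assms in simp_all)

text \<open>The symmetric formula is applied to the preimages of \<open>u\<close> and
  \<open>v\<close> under \<open>s y\<close>, since multiplying the preimage of \<open>n\<close> by
  \<open>y\<close> gives \<open>ld y n\<close>.\<close>

lemma ld_N_N_commute:
  assumes u: "u \<in> N" and v: "v \<in> N" and y: "y \<in> Q"
  shows "ld (ld y u) v = ld (ld y v) u"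
proof -
  have aux: "ld (u' \<cdot> y) (s y \<langle>$\<rangle> v') = ld (v' \<cdot> y) (s y \<langle>$\<rangle> u')" if "u' \<in> N" "v' \<in> N" for u' v'
    using ld_N_N_commute_aux [OF that y] ld_N_N_commute_aux [OF that(2,1) y] cc_cc_commute [OF that y] that
    by (simp add: comm [of v' u'])
  have div: "inverse (s y) \<langle>$\<rangle> n \<in> N" "s y \<langle>$\<rangle> (inverse (s y) \<langle>$\<rangle> n) = n"
    "(inverse (s y) \<langle>$\<rangle> n) \<cdot> y = ld y n" if "n \<in> N" for n
  proof -
    show 1: "inverse (s y) \<langle>$\<rangle> n \<in> N" "s y \<langle>$\<rangle> (inverse (s y) \<langle>$\<rangle> n) = n" using that y by simp_all
    then have "y \<cdot> (y \<cdot> (inverse (s y) \<langle>$\<rangle> n)) = n"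
      using s_apply [of y "inverse (s y) \<langle>$\<rangle> n"] y by simp
    then show "(inverse (s y) \<langle>$\<rangle> n) \<cdot> y = ld y n" using 1 y by (metis comm ld_mult mult_closed N_Q)
  qed
  show ?thesis using aux [OF div(1) [OF u] div(1) [OF v]] by (simp only: div(2,3) u v)
qed

section \<open>Fixed points of squared left translations\<close>

lemma fix_commutator:
  assumes p: "p \<in> Q" and z: "z \<in> Q"
  defines "y \<equiv> ld z (s p \<langle>$\<rangle> z)"
  shows "s y \<langle>$\<rangle> z = z"
    and "k \<in> Q \<Longrightarrow> s p \<langle>$\<rangle> k = k \<Longrightarrow> s y \<langle>$\<rangle> k = k"
proof -
  have fix_z: "s (ld z (s p \<langle>$\<rangle> z)) \<langle>$\<rangle> z = z" if z: "z \<in> Q" for z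
  proof -
    note [simp] = p z
    define q where "q = cc p z \<langle>$\<rangle> p"
    define t where "t = s p \<langle>$\<rangle> z"
    define y where "y = ld z t"
    have [simp]: "q \<in> Q" "t \<in> Q" "y \<in> Q" by (simp_all add: q_def t_def y_def)
    have pq: "p \<cdot> q = y" using mult_cc_fst [of p z] unfolding y_def q_def t_def by (metis H_apply_closed cc_H ld_mult mult_closed p z)
    \<comment> \<open>\<open>\<rho>\<close> fixes \<open>p\<close> because
      \<open>\<rho> * hh p q = s p\<close> and both \<open>hh p q\<close> and \<open>s p\<close> fix
      \<open>p\<close>; it fixes \<open>z\<close> too, hence \<open>t\<close>, so \<open>L y\<close>
      exchanges \<open>z\<close> and \<open>t\<close>.\<close>
    define \<rho> where "\<rho> = hh z y"
    have [simp]: "\<rho> \<in> H" by (simp add: \<rho>_def)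
    have zy: "z \<cdot> y = t" by (simp add: y_def)
    have "L z * L y = L t * \<rho>" by (simp add: L_L zy \<rho>_def)
    then have Ly: "L y = inverse (L z) * (L t * \<rho>)" by (metis perm_inverse_mult_cancel)
    have "L y * hh p q = inverse (L z) * (s p * L z)"
      using L_L_cc [of p z] L_L [of p q] by (simp add: q_def [symmetric] pq mult.assoc)
    also have "\<dots> = inverse (L z) * (L t * s p)" using H_L [of "s p" z] by (simp add: t_def)
    finally have "\<rho> * hh p q = s p" unfolding Ly by (simp add: mult.assoc)
    then have "(\<rho> * hh p q) \<langle>$\<rangle> p = s p \<langle>$\<rangle> p" by simp
    then have \<rho>p: "\<rho> \<langle>$\<rangle> p = p" by (simp add: s_apply)
    have "\<rho> \<langle>$\<rangle> z = z" by (simp add: \<rho>_def)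
    then have \<rho>t: "\<rho> \<langle>$\<rangle> t = t" using \<rho>p by (simp add: t_def s_apply H_apply_mult)
    have "L y \<langle>$\<rangle> t = z" unfolding Ly by (simp add: \<rho>t)
    then have "s y \<langle>$\<rangle> z = z" using zy by (simp add: s_apply comm [of y z])
    then show ?thesis by (simp add: y_def t_def)
  qed
  note [simp] = p z
  have y [simp]: "y \<in> Q" by (simp add: y_def)
  show sz: "s y \<langle>$\<rangle> z = z" unfolding y_def using z by (rule fix_z)
  fix k assume k [simp]: "k \<in> Q" and "s p \<langle>$\<rangle> k = k"
  \<comment> \<open>The first part is applied to \<open>k \<cdot> z\<close>. Pulling back along
    \<open>?h\<close>, which sends \<open>ld z k\<close> to \<open>k \<cdot> z\<close>, shows that
    \<open>s y\<close> fixes \<open>ld z k\<close>, hence also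
    \<open>k = z \<cdot> ld z k\<close>.\<close>
  let ?h = "hh k z"
  have h: "?h \<in> H" by simp
  have "z \<cdot> y = s p \<langle>$\<rangle> z" by (simp add: y_def)
  then have "ld (k \<cdot> z) (s p \<langle>$\<rangle> (k \<cdot> z)) = ?h \<langle>$\<rangle> y"
    using \<open>s p \<langle>$\<rangle> k = k\<close> by (simp add: hh_apply H_apply_mult)
  then have "s (?h \<langle>$\<rangle> y) \<langle>$\<rangle> (k \<cdot> z) = k \<cdot> z" using fix_z [of "k \<cdot> z"] by simp
  moreover have "?h \<langle>$\<rangle> (ld z k) = k \<cdot> z" by (simp add: hh_apply)
  ultimately have "(s (?h \<langle>$\<rangle> y) * ?h) \<langle>$\<rangle> (ld z k) = ?h \<langle>$\<rangle> (ld z k)" by simp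
  then have "?h \<langle>$\<rangle> (s y \<langle>$\<rangle> (ld z k)) = ?h \<langle>$\<rangle> (ld z k)" unfolding H_s [OF h y, symmetric] by simp
  then have "s y \<langle>$\<rangle> (ld z k) = ld z k" by (metis perm_apply_inverse(1))
  then have "s y \<langle>$\<rangle> (z \<cdot> ld z k) = z \<cdot> ld z k" using sz H_apply_mult [of "s y" z "ld z k"] by simp
  then show "s y \<langle>$\<rangle> k = k" by simp
qed

definition Fix :: "'a perm \<Rightarrow> 'a set" where
  "Fix p = {x \<in> Q. p \<langle>$\<rangle> x = x}"

lemma finite_Fix [simp]: "finite (Fix p)"
  by (simp add: Fix_def)

lemma card_Fix_commutator:
  assumes "p \<in> Q" "z \<in> Q" "s p \<langle>$\<rangle> z \<noteq> z"
  shows "card (Fix (s p)) < card (Fix (s (ld z (s p \<langle>$\<rangle> z))))"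
proof (rule psubset_card_mono)
  have "Fix (s p) \<subseteq> Fix (s (ld z (s p \<langle>$\<rangle> z)))" using fix_commutator(2) assms by (auto simp: Fix_def)
  moreover have "z \<in> Fix (s (ld z (s p \<langle>$\<rangle> z)))" using fix_commutator(1) assms by (auto simp: Fix_def)
  moreover have "z \<notin> Fix (s p)" using assms by (simp add: Fix_def)
  ultimately show "Fix (s p) \<subset> Fix (s (ld z (s p \<langle>$\<rangle> z)))" by blast
qed simp

text \<open>If \<open>p\<close> differs from \<open>e\<close> and \<open>s p\<close> has the most
  fixed points, then \<open>s p = 1\<close>, as otherwise \<open>card_Fix_commutator\<close> finds
  more.\<close>

lemma N_nontrivial:
  assumes "Q \<noteq> {e}"
  shows "N \<noteq> {e}"
proof
  assume N: "N = {e}"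
  let ?X = "Q - {e}"
  obtain x where "x \<in> ?X" using assms unit_closed by blast
  then obtain p where p: "p \<in> ?X" "\<And>y. y \<in> ?X \<Longrightarrow> card (Fix (s y)) \<le> card (Fix (s p))"
    using finite_maximizer [of ?X x "\<lambda>y. card (Fix (s y))"] finite_Q by blast
  have pQ: "p \<in> Q" using p by simp
  have "p \<notin> N" using p N by simp
  then have "s p \<noteq> 1" using pQ unfolding N_def by simp
  then obtain z where z: "z \<in> Q" "s p \<langle>$\<rangle> z \<noteq> z"
    using sym_perms_eqI [of "s p" Q 1] pQ by auto
  have "ld z (s p \<langle>$\<rangle> z) \<noteq> e" using z pQ by (metis H_apply_closed mult_ld s_H unit_right)
  then have "ld z (s p \<langle>$\<rangle> z) \<in> ?X" using z pQ by simp
  then show False using p(2) card_Fix_commutator [OF pQ z] by (meson leD)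
qed

subsection \<open>The elementary abelian group structure\<close>

definition ev :: "'a \<Rightarrow> 'a perm" where
  "ev u = perm_on Q (\<lambda>y. ld y u)"

lemma ev_sym [simp]: "u \<in> Q \<Longrightarrow> ev u \<in> sym_perms Q"
  and ev_apply [simp]: "u \<in> Q \<Longrightarrow> y \<in> Q \<Longrightarrow> ev u \<langle>$\<rangle> y = ld y u"
proof -
  have bij: "bij_betw (\<lambda>y. ld y u) Q Q" if "u \<in> Q"
    by (rule bij_betw_byWitness [where f' = "\<lambda>y. ld y u"]) (use that in auto)
  show "u \<in> Q \<Longrightarrow> ev u \<in> sym_perms Q" "u \<in> Q \<Longrightarrow> y \<in> Q \<Longrightarrow> ev u \<langle>$\<rangle> y = ld y u"
    using bij by (simp_all add: ev_def perm_on_apply perm_on_sym)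
qed

lemma ev_ev: "u \<in> Q \<Longrightarrow> ev u * ev u = 1"
  by (rule sym_perms_eqI [of _ Q]) auto

lemma ev_commute: "u \<in> N \<Longrightarrow> v \<in> N \<Longrightarrow> ev u * ev v = ev v * ev u"
  by (rule sym_perms_eqI [of _ Q]) (auto simp: ld_N_N_commute [of u v])

lemma H_ev: "h \<in> H \<Longrightarrow> u \<in> Q \<Longrightarrow> h * ev u = ev (h \<langle>$\<rangle> u) * h"
  by (rule sym_perms_eqI [of _ Q]) (auto simp: H_apply_ld)

text \<open>The group generated by the \<open>ev u\<close> with \<open>u\<close> in
  \<open>N\<close>; products suffice because these are involutions.\<close>

inductive_set EE :: "'a perm set" where
  EE_one: "1 \<in> EE"
| EE_ev: "u \<in> N \<Longrightarrow> p \<in> EE \<Longrightarrow> ev u * p \<in> EE"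

lemma EE_sym [simp]: "p \<in> EE \<Longrightarrow> p \<in> sym_perms Q"
  by (induction rule: EE.induct) auto

lemma EE_ev_commute: "p \<in> EE \<Longrightarrow> u \<in> N \<Longrightarrow> ev u * p = p * ev u"
proof (induction rule: EE.induct)
  case (EE_ev v p)
  have "ev u * ev v = ev v * ev u" using ev_commute EE_ev by blast
  then have "ev u * (ev v * p) = ev v * (ev u * p)" by (simp only: mult.assoc [symmetric])
  also have "ev u * p = p * ev u" using EE_ev by simp
  finally show ?case by (simp only: mult.assoc)
qed simp

lemma EE_commute: "p \<in> EE \<Longrightarrow> q \<in> EE \<Longrightarrow> p * q = q * p"
proof (induction rule: EE.induct)
  case (EE_ev u p)
  have "ev u * p * q = (ev u * q) * p" using EE_ev by (simp add: mult.assoc)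
  then show ?case using EE_ev_commute [of q u] EE_ev by (simp add: mult.assoc)
qed simp

lemma EE_mult: "p \<in> EE \<Longrightarrow> q \<in> EE \<Longrightarrow> p * q \<in> EE"
  by (induction rule: EE.induct) (auto simp: mult.assoc intro: EE.intros)

lemma EE_sq: "p \<in> EE \<Longrightarrow> p * p = 1"
proof (induction rule: EE.induct)
  case (EE_ev u p)
  have "ev u * p * (ev u * p) = ev u * (p * ev u) * p" by (simp only: mult.assoc)
  also have "\<dots> = (ev u * ev u) * (p * p)"
    unfolding EE_ev_commute [OF EE_ev(2,1), symmetric] by (simp only: mult.assoc)
  finally show ?case using EE_ev by (simp add: ev_ev)
qed simp

lemma EE_H: "p \<in> EE \<Longrightarrow> h \<in> H \<Longrightarrow> h * p * inverse h \<in> EE"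
proof (induction rule: EE.induct)
  case EE_one
  then show ?case by (simp add: EE.EE_one)
next
  case (EE_ev u p)
  have "h * (ev u * p) * inverse h = ev (h \<langle>$\<rangle> u) * (h * p * inverse h)"
    using H_ev [of h u] EE_ev by (simp add: mult.assoc [symmetric])
  then show ?case using EE_ev by (simp add: EE.EE_ev)
qed

text \<open>Right-nested products are enough: \<open>gen_N_mult\<close> reassociates arbitrary ones
  by an inner mapping.\<close>

inductive_set gen_N :: "'a set" where
  gen_unit: "e \<in> gen_N"
| gen_mult: "u \<in> N \<Longrightarrow> x \<in> gen_N \<Longrightarrow> u \<cdot> x \<in> gen_N"

lemma gen_N_Q: "x \<in> gen_N \<Longrightarrow> x \<in> Q"
  by (induction rule: gen_N.induct) auto

lemma gen_N_H: "x \<in> gen_N \<Longrightarrow> h \<in> H \<Longrightarrow> h \<langle>$\<rangle> x \<in> gen_N"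
  by (induction rule: gen_N.induct) (auto simp: H_apply_mult gen_N_Q intro: gen_N.intros)

lemma gen_N_mult: "x \<in> gen_N \<Longrightarrow> y \<in> gen_N \<Longrightarrow> x \<cdot> y \<in> gen_N"
proof (induction arbitrary: y rule: gen_N.induct)
  case gen_unit
  then show ?case by (simp add: gen_N_Q)
next
  case (gen_mult u x)
  define t where "t = inverse (hh u x) \<langle>$\<rangle> y"
  have Q: "u \<in> Q" "x \<in> Q" "y \<in> Q" using gen_mult gen_N_Q by auto
  then have t: "t \<in> gen_N" using gen_mult gen_N_H by (simp add: t_def)
  have "(L u * L x) \<langle>$\<rangle> t = (L (u \<cdot> x) * hh u x) \<langle>$\<rangle> t" by (simp only: L_L)
  then have "(u \<cdot> x) \<cdot> y = u \<cdot> (x \<cdot> t)" using Q gen_N_Q [OF t] by (simp add: t_def)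
  then show ?case using gen_mult t by (simp add: gen_N.gen_mult)
qed

text \<open>\<open>gen_N\<close> is an invariant subloop, hence all of \<open>Q\<close>, and each
  factor from \<open>N\<close> is realized by one generator of \<open>EE\<close>.\<close>

lemma EE_surj:
  assumes "x \<in> Q"
  shows "\<exists>p\<in>EE. p \<langle>$\<rangle> e = x"
proof (cases "Q = {e}")
  case True
  then show ?thesis using assms EE_one by force
next
  case False
  then obtain u where u: "u \<in> N" "u \<noteq> e" using N_nontrivial N_unit by blast
  have "u \<cdot> e \<in> gen_N" using u by (intro gen_N.intros)
  then have "gen_N \<noteq> {e}" using u by auto
  moreover have "gen_N = {e} \<or> gen_N = Q"
    by (rule char_simple) (auto simp: gen_N_Q gen_N_H gen_N_mult gen_unit)
  ultimately have "x \<in> gen_N" using assms by simp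
  then show ?thesis
  proof (induction rule: gen_N.induct)
    case gen_unit
    then show ?case using EE_one by force
  next
    case (gen_mult u x)
    then obtain p where p: "p \<in> EE" "p \<langle>$\<rangle> e = x" by blast
    have x: "x \<in> Q" using gen_mult gen_N_Q by blast
    \<comment> \<open>\<open>ev (s x \<langle>$\<rangle> u)\<close> sends \<open>x\<close> to
      \<open>ld x (x \<cdot> (x \<cdot> u)) = x \<cdot> u\<close>.\<close>
    have "(ev (s x \<langle>$\<rangle> u) * p) \<langle>$\<rangle> e = u \<cdot> x"
      using p x gen_mult by (simp add: s_apply) (simp add: comm)
    moreover have "ev (s x \<langle>$\<rangle> u) * p \<in> EE" using p x gen_mult by (simp add: EE_ev)
    ultimately show ?case by blast
  qed
qed

text \<open>A transitive commutative group of permutations is regular.\<close>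

lemma EE_inj:
  assumes p: "p \<in> EE" and q: "q \<in> EE" and pq: "p \<langle>$\<rangle> e = q \<langle>$\<rangle> e"
  shows "p = q"
proof (rule sym_perms_eqI [of _ Q])
  fix x assume "x \<in> Q"
  then obtain r where r: "r \<in> EE" "r \<langle>$\<rangle> e = x" using EE_surj by blast
  have "(p * r) \<langle>$\<rangle> e = (q * r) \<langle>$\<rangle> e"
    using pq EE_commute [OF p r(1)] EE_commute [OF q r(1)] by simp
  then show "p \<langle>$\<rangle> x = q \<langle>$\<rangle> x" using r by simp
qed (use p q in auto)

definition E :: "'a \<Rightarrow> 'a perm" where
  "E x = (THE p. p \<in> EE \<and> p \<langle>$\<rangle> e = x)"

lemma E: "x \<in> Q \<Longrightarrow> E x \<in> EE \<and> E x \<langle>$\<rangle> e = x"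
  unfolding E_def by (rule theI') (use EE_surj EE_inj in blast)

lemma E_eqI: "p \<in> EE \<Longrightarrow> p \<langle>$\<rangle> e = x \<Longrightarrow> E x = p"
  using E [of x] EE_inj [of "E x" p] by (metis EE_sym sym_perms_apply unit_closed)

text \<open>The value outside \<open>Q\<close> makes \<open>\<uplus>\<close> a commutative monoid operation on the whole type, so that
  finite sums are available.\<close>
definition add :: "'a \<Rightarrow> 'a \<Rightarrow> 'a" (infixl "\<uplus>" 65) where
  "x \<uplus> y = (if x \<in> Q then E x \<langle>$\<rangle> y else if y \<in> Q then x else (SOME w. w \<notin> Q))"

lemma add_closed [simp]: "x \<in> Q \<Longrightarrow> x \<uplus> y \<in> Q \<longleftrightarrow> y \<in> Q"
  using E [of x] by (simp add: add_def)

lemma add_in: "x \<in> Q \<Longrightarrow> x \<uplus> y = E x \<langle>$\<rangle> y"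
  by (simp add: add_def)

lemma add_outside: "y \<notin> Q \<Longrightarrow> x \<uplus> y = (if x \<in> Q then y else (SOME w. w \<notin> Q))"
  using E [of x] EE_sym [of "E x"] by (auto simp: add_def sym_perms_def)

lemma add_outside': "x \<notin> Q \<Longrightarrow> x \<uplus> y = (if y \<in> Q then x else (SOME w. w \<notin> Q))"
  by (simp add: add_def)

lemma some_outside: "x \<notin> Q \<Longrightarrow> (SOME w. w \<notin> Q) \<notin> Q"
  by (rule someI)

lemma add_comm: "x \<uplus> y = y \<uplus> x"
proof (cases "x \<in> Q \<and> y \<in> Q")
  case True
  then have "(E x * E y) \<langle>$\<rangle> e = (E y * E x) \<langle>$\<rangle> e" using E EE_commute by metis
  then show ?thesis using True E by (simp add: add_in)
next
  case False
  then show ?thesis by (cases "x \<in> Q"; cases "y \<in> Q") (simp_all add: add_outside, simp_all add: add_def)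
qed

lemma E_add: "x \<in> Q \<Longrightarrow> y \<in> Q \<Longrightarrow> E (x \<uplus> y) = E x * E y"
  using E [of x] E [of y] by (intro E_eqI) (auto simp: EE_mult add_in)

lemma add_assoc: "(x \<uplus> y) \<uplus> z = x \<uplus> (y \<uplus> z)"
proof (cases "x \<in> Q \<and> y \<in> Q")
  case True
  then have "(x \<uplus> y) \<uplus> z = E (x \<uplus> y) \<langle>$\<rangle> z" by (intro add_in) simp
  also have "\<dots> = E x \<langle>$\<rangle> (E y \<langle>$\<rangle> z)" using True by (simp add: E_add)
  finally show ?thesis using True by (simp add: add_in)
next
  case False
  then show ?thesis
    by (cases "x \<in> Q"; cases "y \<in> Q"; cases "z \<in> Q")
      (simp_all add: add_outside add_outside' some_outside)
qed

lemma add_unit [simp]: "x \<uplus> e = x" "e \<uplus> x = x"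
proof -
  have "E e = 1" by (rule E_eqI) (auto simp: EE_one)
  then show "e \<uplus> x = x" by (simp add: add_in)
  then show "x \<uplus> e = x" by (simp add: add_comm [of x e])
qed

lemma add_left_comm: "x \<uplus> (y \<uplus> z) = y \<uplus> (x \<uplus> z)"
  by (metis add_assoc add_comm)

lemmas add_ac = add_assoc add_comm add_left_comm

lemma add_self [simp]: "x \<in> Q \<Longrightarrow> x \<uplus> x = e" "x \<in> Q \<Longrightarrow> x \<uplus> (x \<uplus> y) = y"
proof -
  show 1: "x \<uplus> (x \<uplus> y) = y" if "x \<in> Q" for y
  proof -
    have "(E x * E x) \<langle>$\<rangle> y = y" using EE_sq E [OF that] by simp
    then show ?thesis using that by (simp add: add_in)
  qed
  show "x \<in> Q \<Longrightarrow> x \<uplus> x = e" using 1 [of e] by simp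
qed

lemma add_eq_unit: "x \<in> Q \<Longrightarrow> x \<uplus> y = e \<longleftrightarrow> y = x"
  by (metis add_self(1,2) add_unit(1))

lemma add_cancel: "x \<in> Q \<Longrightarrow> x \<uplus> y = x \<uplus> z \<longleftrightarrow> y = z"
  by (metis add_self(2))

sublocale psum: comm_monoid_set add e
  by unfold_locales (simp_all add: add_ac)

lemma psum_closed: "(\<And>i. i \<in> I \<Longrightarrow> f i \<in> Q) \<Longrightarrow> psum.F f I \<in> Q"
  by (induction I rule: infinite_finite_induct) auto

lemma psum_const: "finite I \<Longrightarrow> x \<in> Q \<Longrightarrow> psum.F (\<lambda>_. x) I = (if even (card I) then e else x)"
  by (induction I rule: finite_induct) auto

lemma add_N: "u \<in> N \<Longrightarrow> x \<in> Q \<Longrightarrow> u \<uplus> x = ld x u"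
proof -
  assume u: "u \<in> N" and x: "x \<in> Q"
  have "E u = ev u" by (rule E_eqI) (use u EE_ev [OF u EE_one] in auto)
  then show ?thesis using u x by (simp add: add_in)
qed

text \<open>Translates products with a factor in \<open>N\<close> into sums; the twist by
  \<open>s x\<close> measures how the two operations differ.\<close>

lemma N_mult_add: "u \<in> N \<Longrightarrow> x \<in> Q \<Longrightarrow> u \<cdot> x = (s x \<langle>$\<rangle> u) \<uplus> x"
  by (simp add: add_N [OF N_H]) (simp add: s_apply comm)

lemma N_N_mult: "u \<in> N \<Longrightarrow> f \<in> N \<Longrightarrow> u \<cdot> f = u \<uplus> f"
  by (simp add: N_mult_add)

text \<open>\<open>N\<close> spans \<open>Q\<close> additively, by transitivity of
  \<open>EE\<close>.\<close>

lemma Q_induct [consumes 1, case_names unit add]: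
  assumes "x \<in> Q" and "P e" and step: "\<And>u x. u \<in> N \<Longrightarrow> x \<in> Q \<Longrightarrow> P x \<Longrightarrow> P (u \<uplus> x)"
  shows "P x"
proof -
  obtain p where p: "p \<in> EE" "p \<langle>$\<rangle> e = x" using EE_surj assms by blast
  from p(1) have "P (p \<langle>$\<rangle> e)"
  proof (induction rule: EE.induct)
    case EE_one
    then show ?case using assms by simp
  next
    case (EE_ev u p)
    then show ?case using step [of u "p \<langle>$\<rangle> e"] by (simp add: add_N)
  qed
  then show ?thesis using p by simp
qed

definition additive :: "('a \<Rightarrow> 'a) \<Rightarrow> bool" where
  "additive f \<longleftrightarrow> (\<forall>x\<in>Q. f x \<in> Q) \<and> (\<forall>x\<in>Q. \<forall>y\<in>Q. f (x \<uplus> y) = f x \<uplus> f y)"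

lemma additive_closed: "additive f \<Longrightarrow> x \<in> Q \<Longrightarrow> f x \<in> Q"
  and additive_add: "additive f \<Longrightarrow> x \<in> Q \<Longrightarrow> y \<in> Q \<Longrightarrow> f (x \<uplus> y) = f x \<uplus> f y"
  by (auto simp: additive_def)

lemma additive_unit: "additive f \<Longrightarrow> f e = e"
  using additive_add [of f e e] additive_closed [of f e] by simp

lemma additive_psum:
  "additive f \<Longrightarrow> (\<And>i. i \<in> I \<Longrightarrow> g i \<in> Q) \<Longrightarrow> f (psum.F g I) = psum.F (\<lambda>i. f (g i)) I"
  by (induction I rule: infinite_finite_induct) (auto simp: additive_unit additive_add psum_closed)

lemma additive_eqI:
  assumes "additive f" "additive g" "\<And>u. u \<in> N \<Longrightarrow> f u = g u" "x \<in> Q"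
  shows "f x = g x"
  using assms(4) by (induction rule: Q_induct) (use assms in \<open>auto simp: additive_unit additive_add\<close>)

text \<open>Conjugation by \<open>h\<close> preserves \<open>EE\<close> and, by regularity, sends
  \<open>E x\<close> to \<open>E (h \<langle>$\<rangle> x)\<close>.\<close>

lemma H_additive: "h \<in> H \<Longrightarrow> additive (apply h)"
  unfolding additive_def
proof (intro conjI ballI)
  fix x y assume h: "h \<in> H" and xy: "x \<in> Q" "y \<in> Q"
  have "h * E x * inverse h = E (h \<langle>$\<rangle> x)"
    by (rule sym, rule E_eqI) (use h xy EE_H E [of x] in auto)
  then have "h * E x = E (h \<langle>$\<rangle> x) * h" by (metis mult.assoc mult_1_right perm.left_inverse)
  then have "(h * E x) \<langle>$\<rangle> y = (E (h \<langle>$\<rangle> x) * h) \<langle>$\<rangle> y" by simp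
  then show "h \<langle>$\<rangle> (x \<uplus> y) = (h \<langle>$\<rangle> x) \<uplus> (h \<langle>$\<rangle> y)" using h xy by (simp add: add_in)
qed auto

lemma H_add: "h \<in> H \<Longrightarrow> x \<in> Q \<Longrightarrow> y \<in> Q \<Longrightarrow> h \<langle>$\<rangle> (x \<uplus> y) = (h \<langle>$\<rangle> x) \<uplus> (h \<langle>$\<rangle> y)"
  by (rule additive_add [OF H_additive])

lemma additive_comp: "additive f \<Longrightarrow> additive g \<Longrightarrow> additive (\<lambda>x. f (g x))"
  by (auto simp: additive_def)

lemma additive_plus: "additive f \<Longrightarrow> additive g \<Longrightarrow> additive (\<lambda>x. f x \<uplus> g x)"
  by (auto simp: additive_def add_ac)

lemma additive_id: "additive (\<lambda>x. x)"
  by (auto simp: additive_def)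

lemma additive_sum: "(\<And>i. i \<in> I \<Longrightarrow> additive (f i)) \<Longrightarrow> additive (\<lambda>x. psum.F (\<lambda>i. f i x) I)"
  by (induction I rule: infinite_finite_induct) (auto simp: additive_def add_ac psum_closed)

subsection \<open>Pairs of involutory elements\<close>

definition bt :: "'a \<Rightarrow> 'a \<Rightarrow> 'a perm" where
  "bt u f = s (u \<cdot> f)"

definition eps :: "'a \<Rightarrow> 'a \<Rightarrow> 'a \<Rightarrow> 'a" where
  "eps u f z = z \<uplus> (bt u f \<langle>$\<rangle> z)"

lemma bt_H [simp]: "u \<in> Q \<Longrightarrow> f \<in> Q \<Longrightarrow> bt u f \<in> H"
  by (simp add: bt_def)

lemma bt_comm: "u \<in> Q \<Longrightarrow> f \<in> Q \<Longrightarrow> bt u f = bt f u"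
  by (simp add: bt_def comm)

lemma eps_comm: "u \<in> Q \<Longrightarrow> f \<in> Q \<Longrightarrow> eps u f z = eps f u z"
  by (simp add: eps_def bt_comm)

lemma H_bt: "h \<in> H \<Longrightarrow> u \<in> Q \<Longrightarrow> f \<in> Q \<Longrightarrow> h * bt u f = bt (h \<langle>$\<rangle> u) (h \<langle>$\<rangle> f) * h"
  by (simp add: bt_def H_s H_apply_mult)

lemma bt_fst [simp]: "u \<in> N \<Longrightarrow> f \<in> N \<Longrightarrow> bt u f \<langle>$\<rangle> u = u"
  by (simp add: bt_def s_apply)

lemma bt_snd [simp]: "u \<in> N \<Longrightarrow> f \<in> N \<Longrightarrow> bt u f \<langle>$\<rangle> f = f"
  by (simp add: bt_def s_apply)

lemma eps_additive: "u \<in> Q \<Longrightarrow> f \<in> Q \<Longrightarrow> additive (eps u f)"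
  unfolding eps_def by (intro additive_plus additive_id H_additive) simp

lemma eps_closed [simp]: "u \<in> Q \<Longrightarrow> f \<in> Q \<Longrightarrow> z \<in> Q \<Longrightarrow> eps u f z \<in> Q"
  by (rule additive_closed [OF eps_additive])

lemma eps_add: "u \<in> Q \<Longrightarrow> f \<in> Q \<Longrightarrow> x \<in> Q \<Longrightarrow> y \<in> Q \<Longrightarrow> eps u f (x \<uplus> y) = eps u f x \<uplus> eps u f y"
  by (rule additive_add [OF eps_additive])

lemma bt_eps: "z \<in> Q \<Longrightarrow> bt u f \<langle>$\<rangle> z = z \<uplus> eps u f z"
  by (simp add: eps_def)

lemma eps_fst [simp]: "u \<in> N \<Longrightarrow> f \<in> N \<Longrightarrow> eps u f u = e"
  and eps_snd [simp]: "u \<in> N \<Longrightarrow> f \<in> N \<Longrightarrow> eps u f f = e"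
  by (simp_all add: eps_def)

definition Phi :: "'a \<Rightarrow> 'a \<Rightarrow> 'a perm" where
  "Phi u f = bt u f * hh f u"

lemma Phi_H [simp]: "u \<in> Q \<Longrightarrow> f \<in> Q \<Longrightarrow> Phi u f \<in> H"
  by (simp add: Phi_def)

text \<open>Two expansions of \<open>f \<cdot> (u \<cdot> n)\<close> as a sum are compared. As
  \<open>Phi u f\<close> is additive, this is the source of the additivity of
  \<open>eps u n f\<close> in \<open>n\<close>.\<close>

lemma Phi_apply:
  assumes u: "u \<in> N" and f: "f \<in> N" and n: "n \<in> N"
  shows "Phi u f \<langle>$\<rangle> n = n \<uplus> eps u n f"
proof -
  note [simp] = u f n
  define y where "y = hh f u \<langle>$\<rangle> n"
  have y [simp]: "y \<in> N" by (simp add: y_def)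
  have "(f \<cdot> u) \<cdot> y = f \<cdot> (u \<cdot> n)" by (simp add: y_def hh_apply)
  also have "\<dots> = (bt u n \<langle>$\<rangle> f) \<uplus> (u \<uplus> n)" by (simp add: N_N_mult bt_def N_mult_add [of f "u \<uplus> n"])
  also have "\<dots> = (f \<uplus> u) \<uplus> (n \<uplus> eps u n f)" by (simp add: bt_eps add_ac)
  finally have "(f \<cdot> u) \<cdot> y = (f \<uplus> u) \<uplus> (n \<uplus> eps u n f)" .
  moreover have "(f \<cdot> u) \<cdot> y = (f \<uplus> u) \<uplus> (s (f \<cdot> u) \<langle>$\<rangle> y)"
    using N_mult_add [of y "f \<cdot> u"] comm [of y "f \<cdot> u"] by (simp add: N_N_mult add_comm)
  ultimately have "s (f \<cdot> u) \<langle>$\<rangle> y = n \<uplus> eps u n f" by (simp add: add_cancel del: add_assoc)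
  then show ?thesis by (simp add: Phi_def y_def bt_def comm [of u f])
qed

text \<open>Rewrites \<open>(L f * L u) * (L u * L f) = 1\<close> in terms of \<open>s a\<close>,
  \<open>hh f u\<close> and \<open>hh u f\<close>, where \<open>hh f u\<close> fixes
  \<open>a\<close>.\<close>

lemma Phi_Phi:
  assumes u: "u \<in> N" and f: "f \<in> N"
  shows "Phi u f * Phi f u = bt u f"
proof -
  note [simp] = u f
  define a where "a = u \<cdot> f"
  have a [simp]: "a \<in> Q" "f \<cdot> u = a" by (simp_all add: a_def comm)
  have ha: "hh f u \<langle>$\<rangle> a = a" using H_apply_mult [of "hh f u" f u] by simp
  have Luf: "L u * L f = L a * hh u f" "L f * L u = L a * hh f u" using L_L [of u f] L_L [of f u] by (simp_all add: a_def)
  have "1 = (L f * L u) * (L u * L f)" by (simp add: mult.assoc)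
  also have "\<dots> = L a * (hh f u * L a) * hh u f" unfolding Luf by (simp add: mult.assoc)
  also have "\<dots> = s a * (hh f u * hh u f)" using H_L [of "hh f u" a] ha by (simp add: s_def mult.assoc)
  finally have one: "s a * (hh f u * hh u f) = 1" by simp
  have "Phi u f * Phi f u = s a * (hh f u * s a) * hh u f"
    by (simp add: Phi_def bt_def a_def comm [of f u] mult.assoc)
  also have "\<dots> = s a * (s a * (hh f u * hh u f))" using H_s [of "hh f u" a] ha by (simp add: mult.assoc)
  finally show ?thesis using one by (simp add: bt_def a_def)
qed

text \<open>At \<open>f\<close> in \<open>N\<close> the claim is additivity of
  \<open>Phi u f\<close>, and both sides are additive in \<open>z\<close>. Membership of the total
  in \<open>N\<close> is assumed, as \<open>N\<close> is not yet known to be closed under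
  \<open>\<uplus>\<close>.\<close>

lemma eps_add_psum:
  assumes u: "u \<in> N" and a: "a \<in> N" and g: "\<And>l. g l \<in> N" and n: "a \<uplus> psum.F g I \<in> N" and z: "z \<in> Q"
  shows "eps u (a \<uplus> psum.F g I) z = eps u a z \<uplus> psum.F (\<lambda>l. eps u (g l) z) I"
proof (rule additive_eqI [where x = z])
  note [simp] = u a g n z
  let ?n = "a \<uplus> psum.F g I"
  have [simp]: "psum.F g I \<in> Q" by (simp add: psum_closed)
  show "additive (eps u ?n)" by (simp add: eps_additive)
  show "additive (\<lambda>z. eps u a z \<uplus> psum.F (\<lambda>l. eps u (g l) z) I)"
    by (intro additive_plus additive_sum eps_additive) simp_all
  fix f assume f [simp]: "f \<in> N"
  have "?n \<uplus> eps u ?n f = Phi u f \<langle>$\<rangle> ?n" by (simp add: Phi_apply)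
  also have "\<dots> = (Phi u f \<langle>$\<rangle> a) \<uplus> psum.F (\<lambda>l. Phi u f \<langle>$\<rangle> (g l)) I"
    using additive_psum [OF H_additive, of "Phi u f" I g] by (simp add: H_add)
  also have "\<dots> = (a \<uplus> eps u a f) \<uplus> psum.F (\<lambda>l. g l \<uplus> eps u (g l) f) I" by (simp add: Phi_apply)
  also have "\<dots> = ?n \<uplus> (eps u a f \<uplus> psum.F (\<lambda>l. eps u (g l) f) I)"
    by (simp add: psum.distrib add_ac)
  finally show "eps u ?n f = eps u a f \<uplus> psum.F (\<lambda>l. eps u (g l) f) I"
    using add_cancel [of ?n] n by (metis N_Q)
qed (use z in simp)

text \<open>By \<open>N_L_commute\<close> the mappings \<open>hh n v\<close> and
  \<open>hh v n\<close> coincide, so \<open>Phi n v = Phi v n\<close>; their values at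
  \<open>z\<close> are compared.\<close>

lemma eps_exchange:
  assumes n: "n \<in> N" and x: "x \<in> Q" and z: "z \<in> N"
  shows "eps z n (s x \<langle>$\<rangle> n) = eps z (s x \<langle>$\<rangle> n) n"
proof -
  define v where "v = s x \<langle>$\<rangle> n"
  have v: "v \<in> N" using n x by (simp add: v_def)
  note [simp] = n x z v
  have "L (n \<cdot> v) * hh n v = L (n \<cdot> v) * hh v n"
    using N_L_commute [OF n x] L_L [of n v] L_L [of v n] comm [of v n] by (simp add: v_def)
  then have "hh n v = hh v n" by (simp only: perm_left_cancel)
  then have "Phi n v = Phi v n" by (simp add: Phi_def bt_comm [of v n])
  then have "z \<uplus> eps n z v = z \<uplus> eps v z n" using Phi_apply [of n v z] Phi_apply [of v n z] by simp
  then have "eps n z v = eps v z n" by (simp add: add_cancel)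
  then show ?thesis by (simp add: v_def [symmetric] eps_comm [of z])
qed

text \<open>Polarization: expanding \<open>eps u n n = e\<close> at
  \<open>n = f \<uplus> (w \<uplus> v)\<close> with \<open>v = bt u f \<langle>$\<rangle> w\<close>
  gives the value of \<open>Phi u f\<close> at \<open>w \<uplus> v\<close>, and \<open>w\<close>
  ranges over the spanning set \<open>N\<close>.\<close>

lemma Phi_eps:
  assumes u: "u \<in> N" and f: "f \<in> N" and z: "z \<in> Q"
  shows "Phi u f \<langle>$\<rangle> (eps u f z) = bt u f \<langle>$\<rangle> (eps u f z)"
proof (rule additive_eqI [where x = z])
  note [simp] = u f
  show "additive (\<lambda>z. Phi u f \<langle>$\<rangle> (eps u f z))" "additive (\<lambda>z. bt u f \<langle>$\<rangle> (eps u f z))"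
    by (intro additive_comp [OF H_additive] eps_additive; simp)+
  fix w assume w [simp]: "w \<in> N"
  define v where "v = bt u f \<langle>$\<rangle> w"
  have v [simp]: "v \<in> N" by (simp add: v_def)
  let ?w1 = "w \<uplus> v"
  have w1: "eps u f w = ?w1" by (simp add: eps_def v_def)
  have "f \<uplus> eps u f w = Phi u w \<langle>$\<rangle> f" by (simp add: Phi_apply)
  \<comment> \<open>The sum lies in \<open>N\<close> as the image of \<open>f\<close> under an
    automorphism.\<close>
  then have n [simp]: "f \<uplus> ?w1 \<in> N" unfolding w1 by simp
  define g where "g l = (if l = 0 then w else v)" for l :: nat
  have psg: "psum.F q {..<2} = q 0 \<uplus> q 1" for q :: "nat \<Rightarrow> 'a"
    by (simp add: numeral_2_eq_2 add_comm)
  have "eps u (f \<uplus> ?w1) (f \<uplus> ?w1) = eps u f (f \<uplus> ?w1) \<uplus> (eps u w (f \<uplus> ?w1) \<uplus> eps u v (f \<uplus> ?w1))"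
    using eps_add_psum [of u f g "{..<2}" "f \<uplus> ?w1"] by (simp add: psg g_def)
  then have "e = eps u f ?w1 \<uplus> ((eps u w f \<uplus> eps u w v) \<uplus> (eps u v f \<uplus> eps u v w))"
    by (simp add: eps_add)
  \<comment> \<open>Exchange makes the two mixed terms equal, so they cancel.\<close>
  also have "eps u v w = eps u w v" using eps_exchange [of w "u \<cdot> f" u] by (simp add: v_def bt_def)
  finally have "e = eps u f ?w1 \<uplus> (eps u w f \<uplus> eps u v f)" by (simp add: add_ac)
  then have key: "eps u w f \<uplus> eps u v f = eps u f ?w1" using add_eq_unit [of "eps u f ?w1"] by force
  have "Phi u f \<langle>$\<rangle> ?w1 = (w \<uplus> eps u w f) \<uplus> (v \<uplus> eps u v f)" by (simp add: H_add Phi_apply)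
  also have "\<dots> = ?w1 \<uplus> (eps u w f \<uplus> eps u v f)" by (simp add: add_ac)
  also have "\<dots> = bt u f \<langle>$\<rangle> ?w1" unfolding key by (simp add: bt_eps)
  finally show "Phi u f \<langle>$\<rangle> (eps u f w) = bt u f \<langle>$\<rangle> (eps u f w)" unfolding w1 .
qed (use z in simp)

text \<open>On the image of \<open>eps u f\<close> both factors of
  \<open>Phi u f * Phi f u = bt u f\<close> act as \<open>bt u f\<close>; so there
  \<open>bt u f\<close> agrees with its square and is the identity.\<close>

lemma eps_eps:
  assumes u: "u \<in> N" and f: "f \<in> N" and z: "z \<in> Q"
  shows "eps u f (eps u f z) = e"
proof -
  note [simp] = u f z
  have c: "bt u f \<langle>$\<rangle> (eps u f z) = eps u f (bt u f \<langle>$\<rangle> z)" by (simp add: eps_def H_add)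
  have "bt u f \<langle>$\<rangle> (eps u f z) = Phi u f \<langle>$\<rangle> (Phi f u \<langle>$\<rangle> (eps u f z))"
    unfolding Phi_Phi [OF u f, symmetric] by simp
  also have "Phi f u \<langle>$\<rangle> (eps u f z) = bt u f \<langle>$\<rangle> (eps u f z)"
    using Phi_eps [OF f u z] by (simp add: eps_comm [of f u] bt_comm [of f u])
  also have "Phi u f \<langle>$\<rangle> (bt u f \<langle>$\<rangle> (eps u f z)) = bt u f \<langle>$\<rangle> (bt u f \<langle>$\<rangle> (eps u f z))"
    unfolding c by (rule Phi_eps) simp_all
  finally have "bt u f \<langle>$\<rangle> (eps u f z) = eps u f z" by (metis perm_apply_inverse(1))
  then show ?thesis by (simp add: eps_def [of u f "eps u f z"])
qed

lemma bt_bt: "u \<in> N \<Longrightarrow> f \<in> N \<Longrightarrow> bt u f * bt u f = 1"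
proof (rule sym_perms_eqI [of _ Q])
  fix z assume *: "u \<in> N" "f \<in> N" "z \<in> Q"
  then have "bt u f \<langle>$\<rangle> (z \<uplus> eps u f z) = z" by (simp add: H_add bt_eps eps_eps add_ac)
  then show "(bt u f * bt u f) \<langle>$\<rangle> z = 1 \<langle>$\<rangle> z" using * by (simp add: bt_eps [of z])
qed auto

text \<open>If \<open>bt u f\<close> moves \<open>z\<close> to
  \<open>z \<cdot> (m1 \<cdot> m2)\<close> with both \<open>m1\<close> and \<open>m2\<close> in
  \<open>N\<close>, then \<open>bt m1 m2\<close> has more fixed points, so maximality forces
  \<open>m1 \<cdot> m2\<close> into \<open>N\<close>.\<close>

lemma
  assumes u: "u \<in> N" and f: "f \<in> N"
    and maximal: "\<And>u' f'. u' \<in> N \<Longrightarrow> f' \<in> N \<Longrightarrow> bt u' f' \<noteq> 1 \<Longrightarrow> card (Fix (bt u' f')) \<le> card (Fix (bt u f))"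
  shows eps_in_N: "z \<in> Q \<Longrightarrow> eps u f z \<in> N"
    and bt_eps_eps: "x \<in> Q \<Longrightarrow> y \<in> Q \<Longrightarrow> bt (eps u f x) (eps u f y) = 1"
proof -
  note [simp] = u f
  have key: "m1 \<cdot> m2 \<in> N"
    if m: "m1 \<in> N" "m2 \<in> N" and z: "z \<in> Q" and eq: "bt u f \<langle>$\<rangle> z = z \<cdot> (m1 \<cdot> m2)" and ne: "bt u f \<langle>$\<rangle> z \<noteq> z"
    for m1 m2 z
  proof -
    have "ld z (bt u f \<langle>$\<rangle> z) = m1 \<cdot> m2" using m z eq by simp
    then have "card (Fix (bt u f)) < card (Fix (bt m1 m2))"
      using card_Fix_commutator [of "u \<cdot> f" z] z ne by (simp add: bt_def)
    then have "bt m1 m2 = 1" using maximal [OF m] by (meson leD)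
    then show ?thesis unfolding N_def using m by (simp add: bt_def)
  qed
  have of_N: "eps u f z \<in> N" if z [simp]: "z \<in> N" for z
  proof (cases "bt u f \<langle>$\<rangle> z = z")
    case True
    then show ?thesis by (simp add: eps_def)
  next
    case False
    have "z \<cdot> (bt u f \<langle>$\<rangle> z) \<in> N" by (rule key [of _ _ z]) (simp_all add: False)
    then show ?thesis by (simp add: eps_def N_N_mult)
  qed
  have step: "eps u f (z1 \<uplus> z2) \<in> N"
    if z12: "z1 \<in> Q" "z2 \<in> Q" and n12: "eps u f z1 \<in> N" "eps u f z2 \<in> N" for z1 z2
  proof (cases "bt u f \<langle>$\<rangle> (z1 \<uplus> z2) = z1 \<uplus> z2")
    case True
    then show ?thesis using that by (simp add: eps_def)
  next
    case False
    note [simp] = z12 n12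
    define z where "z = z1 \<uplus> z2"
    have z [simp]: "z \<in> Q" by (simp add: z_def)
    \<comment> \<open>The twists by \<open>inverse (s z)\<close> and \<open>inverse (s t)\<close>
      turn adding \<open>eps u f z2\<close> to \<open>z\<close> and \<open>eps u f z1\<close> to
      \<open>t\<close> into the loop products \<open>m2 \<cdot> z\<close> and
      \<open>m1 \<cdot> t\<close>.\<close>
    define m2 where "m2 = inverse (s z) \<langle>$\<rangle> (eps u f z2)"
    have m2 [simp]: "m2 \<in> N" by (simp add: m2_def)
    define t where "t = m2 \<cdot> z"
    have t [simp]: "t \<in> Q" by (simp add: t_def)
    define m1 where "m1 = inverse (s t) \<langle>$\<rangle> (eps u f z1)"
    have m1 [simp]: "m1 \<in> N" by (simp add: m1_def)
    have "t = eps u f z2 \<uplus> z" using N_mult_add [of m2 z] by (simp add: t_def m2_def)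
    moreover have "m1 \<cdot> t = eps u f z1 \<uplus> t" using N_mult_add [of m1 t] by (simp add: m1_def)
    ultimately have "m1 \<cdot> t = z \<uplus> eps u f z" by (simp add: z_def eps_add add_ac)
    then have bz: "bt u f \<langle>$\<rangle> z = m1 \<cdot> (z \<cdot> m2)" by (simp add: bt_eps t_def comm [of m2 z])
    \<comment> \<open>Moving \<open>m1\<close> past \<open>z\<close> puts
      \<open>bt u f \<langle>$\<rangle> z\<close> into the form required by
      \<open>key\<close>.\<close>
    define y where "y = m1 \<cdot> (cc m1 z \<langle>$\<rangle> m2)"
    have "(L m1 * L z) \<langle>$\<rangle> m2 = (L z * L m1 * cc m1 z) \<langle>$\<rangle> m2" by (simp only: cc_swap [of m1 z])
    then have bzy: "bt u f \<langle>$\<rangle> z = z \<cdot> y" unfolding bz y_def by simp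
    have y: "y \<in> N" unfolding y_def
      by (rule key [of _ _ z]) (use False bzy in \<open>simp_all add: z_def y_def\<close>)
    have "z \<uplus> eps u f z = z \<uplus> (s z \<langle>$\<rangle> y)"
      using bzy N_mult_add [OF y z] y comm [of z y] by (simp add: bt_eps add_comm)
    then have "eps u f z = s z \<langle>$\<rangle> y" by (simp add: add_cancel)
    then show ?thesis using y by (simp add: z_def)
  qed
  show img: "eps u f z \<in> N" if "z \<in> Q" for z
    using that
  proof (induction rule: Q_induct)
    case unit
    then show ?case by (simp add: additive_unit [OF eps_additive])
  next
    case (add n x)
    then show ?case using step [of n x] of_N by simp
  qed
  show "bt (eps u f x) (eps u f y) = 1" if "x \<in> Q" "y \<in> Q"
  proof -
    \<comment> \<open>Product and sum agree on \<open>N\<close>, so this product is again a value of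
      \<open>eps u f\<close> and lies in \<open>N\<close>.\<close>
    have "eps u f x \<cdot> eps u f y = eps u f (x \<uplus> y)" using that img by (simp add: N_N_mult eps_add)
    then show ?thesis using that img [of "x \<uplus> y"] by (simp add: bt_def)
  qed
qed

section \<open>Averaging over an automorphism of odd order\<close>

lemma square_zero_sum:
  assumes I: "finite I" "odd (card I)" and P: "\<And>i. i \<in> I \<Longrightarrow> additive (P i)"
    and sq0: "\<And>i z. i \<in> I \<Longrightarrow> z \<in> Q \<Longrightarrow> P i (P i z) = e"
    and Z: "\<And>z. z \<in> Q \<Longrightarrow> Z z = psum.F (\<lambda>i. P i z) I"
    and R: "\<And>i z. i \<in> I \<Longrightarrow> z \<in> Q \<Longrightarrow> P i (P i z \<uplus> Z z) \<uplus> Z (P i z \<uplus> Z z) = e"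
    and z: "z \<in> Q"
  shows "Z (Z z) = e"
proof -
  have PQ [simp]: "P i x \<in> Q" if "i \<in> I" "x \<in> Q" for i x using additive_closed [OF P] that by simp
  have ZQ [simp]: "Z x \<in> Q" if "x \<in> Q" for x using that by (simp add: Z psum_closed)
  have Za: "Z (x \<uplus> y) = Z x \<uplus> Z y" if "x \<in> Q" "y \<in> Q" for x y
    using that P by (simp add: Z additive_add psum.distrib [symmetric] cong: psum.cong)
  \<comment> \<open>This expands the square of the sum of \<open>P i\<close> and \<open>Z\<close>,
    in which \<open>P i (P i z)\<close> vanishes.\<close>
  have "P i (Z z) \<uplus> (Z (P i z) \<uplus> Z (Z z)) = e" if "i \<in> I" for i
    using R [OF that z] that z sq0 [OF that z] by (simp add: additive_add [OF P] Za)
  then have "psum.F (\<lambda>i. P i (Z z) \<uplus> (Z (P i z) \<uplus> Z (Z z))) I = e" by (simp cong: psum.cong)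
  \<comment> \<open>Each of the three terms equals \<open>Z (Z z)\<close>, the last because
    \<open>card I\<close> is odd; two of them cancel.\<close>
  then have "psum.F (\<lambda>i. P i (Z z)) I \<uplus> (psum.F (\<lambda>i. Z (P i z)) I \<uplus> Z (Z z)) = e"
    using I z by (simp add: psum.distrib psum_const)
  moreover have "psum.F (\<lambda>i. P i (Z z)) I = Z (Z z)" using z by (simp add: Z [of "Z z"])
  moreover have "psum.F (\<lambda>i. Z (P i z)) I = Z (psum.F (\<lambda>i. P i z) I)"
    by (rule additive_psum [symmetric]) (use z Za in \<open>auto simp: additive_def\<close>)
  ultimately show ?thesis using z by (simp add: Z [of z, symmetric])
qed

lemma psum_cyclic:
  assumes "g k = g 0" "\<And>i. g i \<in> Q"
  shows "psum.F (\<lambda>i. g (Suc i)) {..<k} = psum.F g {..<k}"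
proof -
  have "g 0 \<uplus> psum.F (\<lambda>i. g (Suc i)) {..<k} = g 0 \<uplus> psum.F g {..<k}"
    using psum.lessThan_Suc_shift [of g k] psum.lessThan_Suc [of g k] assms(1) by (simp add: add_comm)
  then show ?thesis using assms by (simp add: add_cancel)
qed

lemma psum_fold:
  fixes n :: nat
  shows "psum.F g {..<2 * n} = psum.F (\<lambda>i. g i \<uplus> g (2 * n - 1 - i)) {..<n}"
proof (induction n arbitrary: g)
  case (Suc n)
  have "psum.F g {..<2 * Suc n} = (g 0 \<uplus> g (2 * n + 1)) \<uplus> psum.F (\<lambda>i. g (Suc i)) {..<2 * n}"
    using psum.lessThan_Suc_shift [of g "Suc (2 * n)"] by (simp add: add_ac)
  also have "psum.F (\<lambda>i. g (Suc i)) {..<2 * n} = psum.F (\<lambda>i. g (Suc i) \<uplus> g (Suc (2 * n - 1 - i))) {..<n}"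
    by (rule Suc.IH)
  also have "\<dots> = psum.F (\<lambda>i. g (Suc i) \<uplus> g (2 * Suc n - 1 - Suc i)) {..<n}"
    by (rule psum.cong) (auto simp: Suc_diff_Suc)
  finally show ?case using psum.lessThan_Suc_shift [of "\<lambda>i. g i \<uplus> g (2 * Suc n - 1 - i)" n] by simp
qed simp

lemma inverted_power:
  fixes b t :: "'a perm"
  assumes "b * t = inverse t * b"
  shows "b * t ^ i = inverse (t ^ i) * b"
proof (induction i)
  case (Suc i)
  have "b * t ^ Suc i = (b * t) * t ^ i" by (simp add: mult.assoc)
  also have "\<dots> = inverse t * (b * t ^ i)" unfolding assms by (simp only: mult.assoc)
  also have "\<dots> = inverse (t ^ i * t) * b" unfolding Suc by (simp add: mult.assoc)
  finally show ?case by (simp only: power_Suc2)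
qed simp

text \<open>\<open>bt u f\<close> exchanges the terms of exponents \<open>j\<close> and
  \<open>k - j\<close>, so each such pair is a value of \<open>eps u f\<close>; the leading
  \<open>a\<close> cancels the term of exponent \<open>0\<close>.\<close>

lemma orbit_sum_in_image:
  assumes u: "u \<in> N" and f: "f \<in> N" and \<theta>: "\<theta> \<in> H" and inv: "bt u f * \<theta> = inverse \<theta> * bt u f"
    and k: "\<theta> ^ k = 1" "odd k" and a: "a \<in> N" "bt u f \<langle>$\<rangle> a = a"
  shows "\<exists>z\<in>Q. a \<uplus> psum.F (\<lambda>i. (\<theta> ^ i) \<langle>$\<rangle> a) {..<k} = eps u f z"
proof -
  note [simp] = u f \<theta> a(1)
  have pH [simp]: "\<theta> ^ i \<in> H" for i using perm_group_power [OF perm_group_H] by simp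
  obtain n where n: "k = Suc (2 * n)" using k(2) by (metis oddE Suc_eq_plus1)
  define g where "g i = (\<theta> ^ i) \<langle>$\<rangle> a" for i
  have [simp]: "g i \<in> Q" for i by (simp add: g_def)
  have "bt u f \<langle>$\<rangle> (g j) = g (k - j)" if "j \<le> k" for j
  proof -
    have "\<theta> ^ (k - j) * \<theta> ^ j = 1" using that k(1) by (simp add: power_add [symmetric])
    then have "inverse (\<theta> ^ j) = \<theta> ^ (k - j)"
      by (metis mult.assoc mult_1_left mult_1_right perm.right_inverse)
    moreover have "(bt u f * \<theta> ^ j) \<langle>$\<rangle> a = (inverse (\<theta> ^ j) * bt u f) \<langle>$\<rangle> a"
      using inverted_power [OF inv, of j] by simp
    ultimately show ?thesis using a by (simp add: g_def)
  qed
  \<comment> \<open>With \<open>k = Suc (2 * n)\<close>, the partner of \<open>Suc i\<close> is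
    \<open>2 * n - i\<close>, written as \<open>Suc (2 * n - 1 - i)\<close> to match
    \<open>psum_fold\<close>.\<close>
  then have eps_g: "eps u f (g (Suc i)) = g (Suc i) \<uplus> g (Suc (2 * n - 1 - i))" if "i < n" for i
    using that by (simp add: eps_def n Suc_diff_Suc)
  have "a \<uplus> psum.F g {..<k} = psum.F (\<lambda>i. g (Suc i)) {..<2 * n}"
    unfolding n psum.lessThan_Suc_shift by (simp add: g_def)
  also have "\<dots> = psum.F (\<lambda>i. eps u f (g (Suc i))) {..<n}"
    unfolding psum_fold by (rule psum.cong) (auto simp: eps_g)
  also have "\<dots> = eps u f (psum.F (\<lambda>i. g (Suc i)) {..<n})"
    by (rule additive_psum [OF eps_additive, symmetric]) simp_all
  finally show ?thesis unfolding g_def [abs_def, symmetric] by (rule bexI) (simp add: psum_closed)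
qed

text \<open>Averaging \<open>eps\<close> over the orbits of \<open>u\<close> and \<open>f\<close>
  gives a map \<open>\<Theta>\<close> of square zero that is the identity plus \<open>W\<close>
  after \<open>bt u f\<close>, while \<open>\<theta> * \<theta>\<close> fixes the image of
  \<open>W\<close>. This forces \<open>\<theta> * \<theta> = 1\<close>, and odd order
  finishes.\<close>

lemma inverted_odd_trivial:
  assumes u: "u \<in> N" and f: "f \<in> N"
    and maximal: "\<And>u' f'. u' \<in> N \<Longrightarrow> f' \<in> N \<Longrightarrow> bt u' f' \<noteq> 1 \<Longrightarrow> card (Fix (bt u' f')) \<le> card (Fix (bt u f))"
    and \<theta>: "\<theta> \<in> H" and inv: "bt u f * \<theta> = inverse \<theta> * bt u f"
    and k: "\<theta> ^ k = 1" "odd k"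
  shows "\<theta> = 1"
proof -
  note [simp] = u f \<theta>
  have pH [simp]: "\<theta> ^ i \<in> H" for i using perm_group_power [OF perm_group_H] by simp
  let ?I = "{..<k}"
  have I: "finite ?I" "odd (card ?I)" using k by auto
  define U where "U i = (\<theta> ^ i) \<langle>$\<rangle> u" for i
  define V where "V i = (\<theta> ^ i) \<langle>$\<rangle> f" for i
  have UV [simp]: "U i \<in> N" "V i \<in> N" for i by (simp_all add: U_def V_def)
  have orbit: "(\<theta> ^ i) \<langle>$\<rangle> (a \<uplus> psum.F (\<lambda>i. (\<theta> ^ i) \<langle>$\<rangle> a) ?I)
      = ((\<theta> ^ i) \<langle>$\<rangle> a) \<uplus> psum.F (\<lambda>i. (\<theta> ^ i) \<langle>$\<rangle> a) ?I" if a: "a \<in> N" for a i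
  proof -
    let ?S = "psum.F (\<lambda>i. (\<theta> ^ i) \<langle>$\<rangle> a) ?I"
    have S [simp]: "?S \<in> Q" using a by (simp add: psum_closed)
    have "\<theta> \<langle>$\<rangle> ?S = psum.F (\<lambda>i. (\<theta> ^ Suc i) \<langle>$\<rangle> a) ?I"
      using additive_psum [OF H_additive, of \<theta> ?I "\<lambda>i. (\<theta> ^ i) \<langle>$\<rangle> a"] a by simp
    also have "\<dots> = ?S" by (rule psum_cyclic) (use k a in simp_all)
    finally have "\<theta> \<langle>$\<rangle> ?S = ?S" .
    then have "(\<theta> ^ i) \<langle>$\<rangle> ?S = ?S" by (induction i) simp_all
    then show ?thesis using a by (simp add: H_add)
  qed
  obtain z1 where z1: "z1 \<in> Q" "u \<uplus> psum.F U ?I = eps u f z1"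
    using orbit_sum_in_image [OF u f \<theta> inv k u] by (auto simp: U_def [abs_def])
  obtain z2 where z2: "z2 \<in> Q" "f \<uplus> psum.F V ?I = eps u f z2"
    using orbit_sum_in_image [OF u f \<theta> inv k f] by (auto simp: V_def [abs_def])
  \<comment> \<open>Adding the full orbit sum turns \<open>U i\<close> and \<open>V i\<close> into
    images under \<open>\<theta> ^ i\<close> of values of \<open>eps u f\<close>, where
    \<open>bt_eps_eps\<close> makes \<open>bt\<close> trivial.\<close>
  define \<upsilon> where "\<upsilon> i = U i \<uplus> psum.F U ?I" for i
  define \<phi> where "\<phi> i = V i \<uplus> psum.F V ?I" for i
  have \<upsilon>_eq: "\<upsilon> i = (\<theta> ^ i) \<langle>$\<rangle> (eps u f z1)" for i
    using orbit [OF u, of i] by (simp add: \<upsilon>_def U_def [abs_def] z1(2) [symmetric])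
  have \<phi>_eq: "\<phi> i = (\<theta> ^ i) \<langle>$\<rangle> (eps u f z2)" for i
    using orbit [OF f, of i] by (simp add: \<phi>_def V_def [abs_def] z2(2) [symmetric])
  have e12 [simp]: "eps u f z1 \<in> N" "eps u f z2 \<in> N" using eps_in_N [OF u f maximal] z1 z2 by auto
  have \<upsilon>\<phi> [simp]: "\<upsilon> i \<in> N" "\<phi> i \<in> N" for i by (simp_all add: \<upsilon>_eq \<phi>_eq)
  have bt1: "bt (\<upsilon> i) (\<phi> i) = 1" for i
  proof -
    have "bt (eps u f z1) (eps u f z2) = 1" using bt_eps_eps [OF u f maximal] z1 z2 by blast
    then have "\<theta> ^ i * 1 = bt (\<upsilon> i) (\<phi> i) * \<theta> ^ i"
      using H_bt [of "\<theta> ^ i" "eps u f z1" "eps u f z2"] by (simp add: \<upsilon>_eq \<phi>_eq)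
    then show ?thesis by (metis mult_1_left mult_1_right perm_right_cancel)
  qed
  have expand_\<upsilon>: "eps (\<upsilon> i) y z = eps (U i) y z \<uplus> psum.F (\<lambda>l. eps (U l) y z) ?I"
    if "y \<in> N" "z \<in> Q" for i y z
    using eps_add_psum [of y "U i" U ?I z] that \<upsilon>\<phi>(1) [of i] by (simp add: \<upsilon>_def eps_comm [of _ y])
  have expand_\<phi>: "eps y (\<phi> i) z = eps y (V i) z \<uplus> psum.F (\<lambda>l. eps y (V l) z) ?I"
    if "y \<in> N" "z \<in> Q" for i y z
    using eps_add_psum [of y "V i" V ?I z] that \<upsilon>\<phi>(2) [of i] by (simp add: \<phi>_def)
  \<comment> \<open>First average, over the orbit of \<open>u\<close>: adding \<open>Z y\<close> to
    \<open>eps (U i) y\<close> gives \<open>eps (\<upsilon> i) y\<close>, which has square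
    zero.\<close>
  define Z where "Z y z = psum.F (\<lambda>i. eps (U i) y z) ?I" for y z
  have ZQ [simp]: "Z y z \<in> Q" if "y \<in> N" "z \<in> Q" for y z using that by (simp add: Z_def psum_closed)
  have Z_additive: "additive (Z y)" if "y \<in> N" for y
    unfolding Z_def using that by (intro additive_sum eps_additive) simp_all
  have ZZ: "Z y (Z y z) = e" if y: "y \<in> N" and z: "z \<in> Q" for y z
  proof (rule square_zero_sum [OF I, where P = "\<lambda>i. eps (U i) y" and Z = "Z y"])
    fix i z assume "i \<in> ?I" and z: "z \<in> Q"
    have "eps (U i) y x \<uplus> Z y x = eps (\<upsilon> i) y x" if "x \<in> Q" for x
      using expand_\<upsilon> [OF y that] by (simp add: Z_def)
    then show "eps (U i) y (eps (U i) y z \<uplus> Z y z) \<uplus> Z y (eps (U i) y z \<uplus> Z y z) = e"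
      using y z by (simp add: eps_eps)
  qed (use y z in \<open>simp_all add: eps_additive eps_eps Z_def\<close>)
  \<comment> \<open>Second average, over the orbit of \<open>f\<close>: adding
    \<open>\<Theta>\<close> to \<open>Z (V j)\<close> gives \<open>Z (\<phi> j)\<close>, again of
    square zero.\<close>
  define \<Theta> where "\<Theta> z = psum.F (\<lambda>j. Z (V j) z) ?I" for z
  have \<Theta>Q [simp]: "\<Theta> z \<in> Q" if "z \<in> Q" for z using that by (simp add: \<Theta>_def psum_closed)
  have swap: "psum.F (\<lambda>i. psum.F (\<lambda>l. eps (U i) (V l) z) ?I) ?I = \<Theta> z" for z
    unfolding \<Theta>_def Z_def by (rule psum.swap)
  have Z\<phi>: "Z (\<phi> j) z = Z (V j) z \<uplus> \<Theta> z" if "z \<in> Q" for j z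
    using that by (simp add: Z_def expand_\<phi> psum.distrib swap)
  have \<Theta>\<Theta>: "\<Theta> (\<Theta> z) = e" if z: "z \<in> Q" for z
  proof (rule square_zero_sum [OF I, where P = "\<lambda>j. Z (V j)" and Z = \<Theta>])
    fix j z assume "j \<in> ?I" and z: "z \<in> Q"
    show "Z (V j) (Z (V j) z \<uplus> \<Theta> z) \<uplus> \<Theta> (Z (V j) z \<uplus> \<Theta> z) = e"
      using Z\<phi> [of "Z (\<phi> j) z" j] Z\<phi> [OF z, of j] ZZ [of "\<phi> j" z] z by simp
  qed (use z in \<open>simp_all add: Z_additive ZZ \<Theta>_def\<close>)
  \<comment> \<open>Since \<open>eps (\<upsilon> i) (\<phi> i)\<close> vanishes, expanding it and
    summing over the odd index set leaves the diagonal sum plus three copies of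
    \<open>\<Theta>\<close>.\<close>
  have diag: "psum.F (\<lambda>i. eps (U i) (V i) z) ?I = \<Theta> z" if z: "z \<in> Q" for z
  proof -
    have "eps (\<upsilon> i) (\<phi> i) z = e" for i using z by (simp add: eps_def bt1)
    then have "e = (eps (U i) (V i) z \<uplus> psum.F (\<lambda>l. eps (U i) (V l) z) ?I) \<uplus> (Z (V i) z \<uplus> \<Theta> z)" for i
      using expand_\<upsilon> [of "\<phi> i" z i] expand_\<phi> [of "U i" z i] Z\<phi> [OF z, of i] z by (simp add: Z_def)
    then have "psum.F (\<lambda>i. (eps (U i) (V i) z \<uplus> psum.F (\<lambda>l. eps (U i) (V l) z) ?I) \<uplus> (Z (V i) z \<uplus> \<Theta> z)) ?I
        = psum.F (\<lambda>i. e) ?I" by (simp only:)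
    then have "(psum.F (\<lambda>i. eps (U i) (V i) z) ?I \<uplus> \<Theta> z) \<uplus> (\<Theta> z \<uplus> \<Theta> z) = e"
      using z k by (simp only: psum.distrib swap) (simp add: \<Theta>_def [symmetric] psum_const)
    then have "\<Theta> z \<uplus> psum.F (\<lambda>i. eps (U i) (V i) z) ?I = e" using z by (simp add: add_comm)
    then show ?thesis using z by (simp add: add_eq_unit)
  qed
  \<comment> \<open>The sum of the powers \<open>\<theta> ^ (2 * i)\<close>; a cyclic shift of the
    index is application of \<open>\<theta> * \<theta>\<close>.\<close>
  define W where "W x = psum.F (\<lambda>i. (\<theta> ^ i) \<langle>$\<rangle> ((\<theta> ^ i) \<langle>$\<rangle> x)) ?I" for x
  have WQ [simp]: "W x \<in> Q" if "x \<in> Q" for x using that by (simp add: W_def psum_closed)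
  have W_inv: "\<theta> \<langle>$\<rangle> (\<theta> \<langle>$\<rangle> (W x)) = W x" if x: "x \<in> Q" for x
  proof -
    have "(\<theta> * \<theta>) \<langle>$\<rangle> (W x) = psum.F (\<lambda>i. (\<theta> * \<theta>) \<langle>$\<rangle> ((\<theta> ^ i) \<langle>$\<rangle> ((\<theta> ^ i) \<langle>$\<rangle> x))) ?I"
      unfolding W_def by (rule additive_psum [OF H_additive]) (use x in simp_all)
    also have "\<dots> = psum.F (\<lambda>i. (\<theta> ^ Suc i) \<langle>$\<rangle> ((\<theta> ^ Suc i) \<langle>$\<rangle> x)) ?I"
    proof (rule psum.cong [OF refl])
      fix i
      have "\<theta> * \<theta> * (\<theta> ^ i * \<theta> ^ i) = \<theta> ^ Suc i * \<theta> ^ Suc i"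
        by (simp only: power_add [symmetric] power_Suc [symmetric] mult.assoc) simp
      then have "(\<theta> * \<theta> * (\<theta> ^ i * \<theta> ^ i)) \<langle>$\<rangle> x = (\<theta> ^ Suc i * \<theta> ^ Suc i) \<langle>$\<rangle> x" by (simp only:)
      then show "(\<theta> * \<theta>) \<langle>$\<rangle> ((\<theta> ^ i) \<langle>$\<rangle> ((\<theta> ^ i) \<langle>$\<rangle> x)) = (\<theta> ^ Suc i) \<langle>$\<rangle> ((\<theta> ^ Suc i) \<langle>$\<rangle> x)"
        by (simp only: perm_apply_mult)
    qed
    also have "\<dots> = W x" unfolding W_def
      by (rule psum_cyclic [of "\<lambda>i. (\<theta> ^ i) \<langle>$\<rangle> ((\<theta> ^ i) \<langle>$\<rangle> x)"]) (use k x in simp_all)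
    finally show ?thesis by simp
  qed
  have \<Theta>W: "\<Theta> z = z \<uplus> W (bt u f \<langle>$\<rangle> z)" if z: "z \<in> Q" for z
  proof -
    \<comment> \<open>Conjugating \<open>bt u f\<close> by \<open>\<theta> ^ i\<close> multiplies it
      on the left by \<open>\<theta> ^ i * \<theta> ^ i\<close>, because \<open>bt u f\<close>
      inverts \<open>\<theta>\<close>.\<close>
    have "bt (U i) (V i) \<langle>$\<rangle> z = (\<theta> ^ i) \<langle>$\<rangle> ((\<theta> ^ i) \<langle>$\<rangle> (bt u f \<langle>$\<rangle> z))" for i
    proof -
      have "bt (U i) (V i) * \<theta> ^ i = \<theta> ^ i * bt u f"
        using H_bt [of "\<theta> ^ i" u f] by (simp add: U_def V_def)
      also have "\<dots> = \<theta> ^ i * (\<theta> ^ i * (inverse (\<theta> ^ i) * bt u f))" by simp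
      also have "\<dots> = \<theta> ^ i * \<theta> ^ i * bt u f * \<theta> ^ i"
        unfolding inverted_power [OF inv, symmetric] by (simp only: mult.assoc)
      finally have "bt (U i) (V i) = \<theta> ^ i * \<theta> ^ i * bt u f" by (simp only: perm_right_cancel)
      then show ?thesis by simp
    qed
    then have "\<Theta> z = psum.F (\<lambda>i. z \<uplus> ((\<theta> ^ i) \<langle>$\<rangle> ((\<theta> ^ i) \<langle>$\<rangle> (bt u f \<langle>$\<rangle> z)))) ?I"
      using diag [OF z] by (simp add: eps_def)
    then show ?thesis using z k by (simp add: psum.distrib psum_const W_def)
  qed
  have "\<theta> * \<theta> = 1"
  proof (rule sym_perms_eqI [of _ Q])
    fix z assume z [simp]: "z \<in> Q"
    define t where "t = \<Theta> z"
    have t [simp]: "t \<in> Q" by (simp add: t_def)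
    \<comment> \<open>Both \<open>t\<close> and \<open>z \<uplus> t\<close> lie in the image of
      \<open>W\<close>, on which \<open>\<theta> * \<theta>\<close> is the identity.\<close>
    have "t \<uplus> W (bt u f \<langle>$\<rangle> t) = e" using \<Theta>\<Theta> [OF z] \<Theta>W [OF t] by (simp add: t_def)
    then have "t = W (bt u f \<langle>$\<rangle> t)" by (simp add: add_eq_unit)
    then have tt: "\<theta> \<langle>$\<rangle> (\<theta> \<langle>$\<rangle> t) = t" using W_inv [of "bt u f \<langle>$\<rangle> t"] by simp
    have "z = t \<uplus> W (bt u f \<langle>$\<rangle> z)" using \<Theta>W [OF z] by (simp add: t_def add_ac)
    then have "\<theta> \<langle>$\<rangle> (\<theta> \<langle>$\<rangle> z) = z"
      using tt W_inv [of "bt u f \<langle>$\<rangle> z"] H_add [OF \<theta>, of t "W (bt u f \<langle>$\<rangle> z)"]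
        H_add [OF \<theta>, of "\<theta> \<langle>$\<rangle> t" "\<theta> \<langle>$\<rangle> (W (bt u f \<langle>$\<rangle> z))"] by simp
    then show "(\<theta> * \<theta>) \<langle>$\<rangle> z = 1 \<langle>$\<rangle> z" by simp
  qed simp_all
  then show ?thesis
    using perm_group_coprime_powers [OF perm_group_H \<theta>, of 2 k] k by (simp add: power2_eq_square)
qed

lemma bt_trivial:
  assumes "u \<in> N" "f \<in> N"
  shows "bt u f = 1"
proof (rule ccontr)
  assume "bt u f \<noteq> 1"
  define X where "X = {(u, f). u \<in> N \<and> f \<in> N \<and> bt u f \<noteq> 1}"
  have "X \<subseteq> Q \<times> Q" by (auto simp: X_def)
  then have "finite X" by (rule finite_subset) simp
  moreover have "(u, f) \<in> X" using assms \<open>bt u f \<noteq> 1\<close> by (simp add: X_def)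
  ultimately obtain q where q: "q \<in> X" "\<And>q'. q' \<in> X \<Longrightarrow> card (Fix (case q' of (u, f) \<Rightarrow> bt u f)) \<le> card (Fix (case q of (u, f) \<Rightarrow> bt u f))"
    using finite_maximizer [of X "(u, f)" "\<lambda>q. card (Fix (case q of (u, f) \<Rightarrow> bt u f))"] by blast
  obtain a c where ac: "q = (a, c)" by fastforce
  have a: "a \<in> N" and c: "c \<in> N" and ne: "bt a c \<noteq> 1" using q ac by (auto simp: X_def)
  have maximal: "card (Fix (bt u' f')) \<le> card (Fix (bt a c))" if "u' \<in> N" "f' \<in> N" "bt u' f' \<noteq> 1" for u' f'
    using q(2) [of "(u', f')"] that ac by (simp add: X_def)
  define b where "b = bt a c"
  have b: "b \<in> H" "b * b = 1" using a c bt_bt by (auto simp: b_def)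
  obtain z where z: "z \<in> Q" "b \<langle>$\<rangle> z \<noteq> z" using ne sym_perms_eqI [of b Q 1] b by (auto simp: b_def)
  show False
  proof (cases "\<forall>g\<in>H. \<exists>n. (b * (g * b * inverse g)) ^ (2 ^ n) = 1")
    case True
    then obtain P where P: "two_group P" "P \<subseteq> H" "\<And>g. g \<in> H \<Longrightarrow> g * b * inverse g \<in> P"
      using baer_suzuki [OF perm_group_H b] by blast
    \<comment> \<open>Common fixed points of the conjugates of \<open>b\<close>: an invariant
      subloop, proper because \<open>b\<close> is nontrivial.\<close>
    define F where "F = {x \<in> Q. \<forall>g\<in>H. (g * b * inverse g) \<langle>$\<rangle> x = x}"
    have conjH: "g * b * inverse g \<in> H" if "g \<in> H" for g using that b by simp
    have "F = {e} \<or> F = Q"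
    proof (rule char_simple)
      show "F \<subseteq> Q" by (auto simp: F_def)
      show "e \<in> F" using H_unit [OF conjH] by (simp add: F_def)
      show "x \<cdot> y \<in> F" if "x \<in> F" "y \<in> F" for x y
        using that H_apply_mult [OF conjH] by (simp add: F_def del: perm_apply_mult)
      fix h x assume h: "h \<in> H" and x: "x \<in> F"
      have "(g * b * inverse g) \<langle>$\<rangle> (h \<langle>$\<rangle> x) = h \<langle>$\<rangle> x" if g: "g \<in> H" for g
      proof -
        let ?k = "inverse h * g"
        have "(?k * b * inverse ?k) \<langle>$\<rangle> x = x" using x g h by (simp add: F_def del: perm_apply_mult perm.inverse_distrib_swap)
        then have "h \<langle>$\<rangle> ((?k * b * inverse ?k) \<langle>$\<rangle> x) = h \<langle>$\<rangle> x" by (simp only:)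
        then show ?thesis by simp
      qed
      then show "h \<langle>$\<rangle> x \<in> F" using x h by (simp add: F_def)
    qed
    moreover have "F \<noteq> Q"
    proof
      assume "F = Q"
      then have "(1 * b * inverse 1) \<langle>$\<rangle> z = z" using z H_one unfolding F_def by blast
      then show False using z by simp
    qed
    ultimately have Fe: "F = {e}" by blast
    obtain n where n: "card P = 2 ^ n" using two_group_card P by blast
    let ?F = "{x \<in> Q. \<forall>p\<in>P. p \<langle>$\<rangle> x = x}"
    \<comment> \<open>The 2-group \<open>P\<close> fixes only \<open>e\<close>, so
      \<open>card Q\<close> is odd, hence one.\<close>
    have "even (card Q) \<longleftrightarrow> even (card ?F)"
      by (rule parity_fixed_points [of P n Q "\<lambda>p x. p \<langle>$\<rangle> x"]) (use P n in \<open>auto simp: two_group_def subset_iff\<close>)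
    moreover have "?F = {e}"
    proof
      show "?F \<subseteq> {e}" unfolding Fe [symmetric] F_def using P(3) by blast
      show "{e} \<subseteq> ?F" using P(2) by auto
    qed
    ultimately have "odd (card Q)" by simp
    moreover obtain k where "card Q = 2 ^ k" using card_Q by blast
    ultimately have "card Q = 1" by (cases k) auto
    then have "Q = {e}" using unit_closed by (metis card_1_singletonE singletonD)
    then show False using z b by simp
  next
    case False
    then obtain g where g: "g \<in> H" "\<And>n. (b * (g * b * inverse g)) ^ (2 ^ n) \<noteq> 1" by blast
    define d where "d = g * b * inverse g"
    define t where "t = b * d"
    have "d * d = g * (b * b) * inverse g" by (simp add: d_def mult.assoc)
    then have d: "d \<in> H" "d * d = 1" using g b by (simp_all add: d_def)
    have t: "t \<in> H" using b d by (simp add: t_def)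
    have "inverse t = d * b" using b d by (metis mult.assoc mult_1_left mult_1_right perm.right_inverse t_def perm_left_cancel)
    then have inv: "b * t = inverse t * b" using b by (simp add: t_def mult.assoc) (metis mult.assoc mult_1_left mult_1_right)
    obtain A a' k where k: "card H = 2 ^ a' * k" "odd k" using sylow_two_subgroup [OF perm_group_H] by metis
    \<comment> \<open>The odd part of \<open>t\<close>: after raising to the 2-part of
      \<open>card H\<close> an odd power vanishes, while no 2-power of \<open>t\<close> is
      \<open>1\<close>.\<close>
    define \<theta> where "\<theta> = t ^ (2 ^ a')"
    have \<theta>: "\<theta> \<in> H" using perm_group_power [OF perm_group_H t] by (simp add: \<theta>_def)
    have "\<theta> ^ k = 1" using perm_group_power_card [OF perm_group_H t] k by (simp add: \<theta>_def power_mult)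
    moreover have "b * \<theta> = inverse \<theta> * b" unfolding \<theta>_def by (rule inverted_power [OF inv])
    ultimately have "\<theta> = 1" using inverted_odd_trivial [OF a c maximal \<theta>] k(2) by (simp add: b_def)
    then show False using g(2) [of a'] by (simp add: \<theta>_def t_def d_def)
  qed
qed

text \<open>With every \<open>bt\<close> trivial, \<open>N\<close> is closed under products; being
  nontrivial unless \<open>Q\<close> is, it equals \<open>Q\<close>, and on \<open>N\<close> the
  product is the addition.\<close>

theorem char_simple_abelian_group:
  assumes "x \<in> Q" "y \<in> Q" "z \<in> Q"
  shows "(x \<cdot> y) \<cdot> z = x \<cdot> (y \<cdot> z)" and "x \<cdot> y = y \<cdot> x"
proof -
  have closed: "u \<cdot> f \<in> N" if "u \<in> N" "f \<in> N" for u f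
  proof -
    have "s (u \<cdot> f) = 1" "u \<cdot> f \<in> Q" using bt_trivial [OF that] that by (simp_all add: bt_def)
    then show ?thesis unfolding N_def by simp
  qed
  have "N = {e} \<or> N = Q" by (rule char_simple) (auto simp: closed)
  then have "N = Q" using N_nontrivial by blast
  then have "u \<cdot> f = u \<uplus> f" if "u \<in> Q" "f \<in> Q" for u f using that N_N_mult by simp
  then show "(x \<cdot> y) \<cdot> z = x \<cdot> (y \<cdot> z)" using assms by (simp add: add_assoc)
  show "x \<cdot> y = y \<cdot> x" using assms by (intro comm)
qed

end

section \<open>Quotients by inner-invariant subloops\<close>

context loop_on
begin

text \<open>Normality as needed for forming quotients; for finite \<open>Q\<close>, closure under
  division follows from closure under products.\<close>

definition inner_invariant :: "'a set \<Rightarrow> bool" where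
  "inner_invariant K \<longleftrightarrow> K \<subseteq> Q \<and> e \<in> K \<and> (\<forall>x\<in>K. \<forall>y\<in>K. x \<cdot> y \<in> K)
     \<and> (\<forall>x\<in>Q. \<forall>k\<in>K. inner_T x k \<in> K) \<and> (\<forall>x\<in>Q. \<forall>y\<in>Q. \<forall>k\<in>K. inner_L x y k \<in> K)"

end

locale aloop_quotient = finite_aloop +
  fixes K
  assumes inv_K: "inner_invariant K"
begin

lemma K_sub: "K \<subseteq> Q"
  and K_unit [simp]: "e \<in> K"
  and K_mult: "x \<in> K \<Longrightarrow> y \<in> K \<Longrightarrow> x \<cdot> y \<in> K"
  and K_T: "x \<in> Q \<Longrightarrow> k \<in> K \<Longrightarrow> inner_T x k \<in> K"
  and K_L: "x \<in> Q \<Longrightarrow> y \<in> Q \<Longrightarrow> k \<in> K \<Longrightarrow> inner_L x y k \<in> K"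
  using inv_K by (auto simp: inner_invariant_def)

lemma K_Q [simp]: "k \<in> K \<Longrightarrow> k \<in> Q"
  using K_sub by blast

lemma finite_K [simp]: "finite K"
  using K_sub finite_Q finite_subset by blast

abbreviation coset :: "'a \<Rightarrow> 'a set" where
  "coset x \<equiv> lcoset m x K"

lemma mem_coset: "z \<in> coset x \<longleftrightarrow> (\<exists>k\<in>K. z = x \<cdot> k)"
  by (auto simp: lcoset_def)

lemma coset_self [simp]: "x \<in> Q \<Longrightarrow> x \<in> coset x"
  unfolding mem_coset by (rule bexI [of _ e]) auto

lemma coset_sub: "x \<in> Q \<Longrightarrow> z \<in> coset x \<Longrightarrow> z \<in> Q"
  by (auto simp: mem_coset)

lemma image_mult_K: "k \<in> K \<Longrightarrow> (\<lambda>x. k \<cdot> x) ` K = K"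
  by (rule endo_inj_surj) (auto simp: K_mult inj_on_def)

lemma image_inner_L: "x \<in> Q \<Longrightarrow> y \<in> Q \<Longrightarrow> inner_L x y ` K = K"
proof (rule endo_inj_surj)
  assume xy: "x \<in> Q" "y \<in> Q"
  show "inner_L x y ` K \<subseteq> K" using K_L xy by blast
  show "inj_on (inner_L x y) K"
  proof (rule inj_onI)
    fix k l assume kl: "k \<in> K" "l \<in> K" "inner_L x y k = inner_L x y l"
    then have "(x \<cdot> y) \<cdot> inner_L x y k = (x \<cdot> y) \<cdot> inner_L x y l" by simp
    then show "k = l" using kl xy by (simp add: inner_L_def)
  qed
qed simp

lemma mult_inner_L: "x \<in> Q \<Longrightarrow> y \<in> Q \<Longrightarrow> z \<in> Q \<Longrightarrow> (x \<cdot> y) \<cdot> inner_L x y z = x \<cdot> (y \<cdot> z)"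
  by (simp add: inner_L_def)

lemma mult_inner_T: "x \<in> Q \<Longrightarrow> y \<in> Q \<Longrightarrow> x \<cdot> inner_T x y = y \<cdot> x"
  by (simp add: inner_T_def)

text \<open>\<open>inner_L x y\<close> permutes \<open>K\<close>, so reassociation does not change
  the coset.\<close>

lemma coset_mult: "x \<in> Q \<Longrightarrow> y \<in> Q \<Longrightarrow> coset (x \<cdot> y) = (\<lambda>z. x \<cdot> z) ` coset y"
proof -
  assume xy: "x \<in> Q" "y \<in> Q"
  have "coset (x \<cdot> y) = (\<lambda>k. (x \<cdot> y) \<cdot> k) ` (inner_L x y ` K)"
    using xy by (simp add: lcoset_def image_inner_L)
  also have "\<dots> = (\<lambda>z. x \<cdot> z) ` coset y"
    unfolding lcoset_def image_image by (rule image_cong) (use xy in \<open>simp_all add: mult_inner_L\<close>)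
  finally show ?thesis .
qed

lemma coset_eq: "y \<in> Q \<Longrightarrow> x \<in> coset y \<Longrightarrow> coset x = coset y"
proof -
  assume y: "y \<in> Q" and "x \<in> coset y"
  then obtain k where k: "k \<in> K" "x = y \<cdot> k" by (auto simp: mem_coset)
  have "coset k = K" using k image_mult_K by (simp add: lcoset_def)
  then show ?thesis using coset_mult [OF y, of k] k by (simp add: lcoset_def)
qed

lemma coset_eq_iff: "x \<in> Q \<Longrightarrow> y \<in> Q \<Longrightarrow> coset x = coset y \<longleftrightarrow> x \<in> coset y"
  using coset_eq coset_self by blast

lemma card_coset: "x \<in> Q \<Longrightarrow> card (coset x) = card K"
  unfolding lcoset_def by (rule card_image) (simp add: inj_on_def)

text \<open>\<open>inner_T y\<close> turns right into left multiplication by \<open>y\<close> and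
  preserves \<open>K\<close>; the inclusion becomes an equality by counting.\<close>

lemma coset_mult_right: "x \<in> Q \<Longrightarrow> y \<in> Q \<Longrightarrow> (\<lambda>z. z \<cdot> y) ` coset x = coset (x \<cdot> y)"
proof (rule card_subset_eq)
  assume xy: "x \<in> Q" "y \<in> Q"
  show "finite (coset (x \<cdot> y))" by (simp add: lcoset_def)
  show "(\<lambda>z. z \<cdot> y) ` coset x \<subseteq> coset (x \<cdot> y)"
  proof
    fix a assume "a \<in> (\<lambda>z. z \<cdot> y) ` coset x"
    then obtain k where k: "k \<in> K" "a = (x \<cdot> k) \<cdot> y" by (auto simp: mem_coset)
    have "a = y \<cdot> (inner_T y x \<cdot> inner_T y k)"
      using k xy mult_inner_T [of y "x \<cdot> k"] by (simp add: endo_mult [OF endo_T])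
    moreover have "inner_T y x \<cdot> inner_T y k \<in> coset (inner_T y x)" using k xy K_T by (auto simp: mem_coset)
    ultimately have "a \<in> coset (y \<cdot> inner_T y x)" using coset_mult [of y "inner_T y x"] xy by simp
    then show "a \<in> coset (x \<cdot> y)" using xy by (simp add: mult_inner_T)
  qed
  have "inj_on (\<lambda>z. z \<cdot> y) (coset x)" using xy coset_sub by (auto simp: inj_on_def)
  then show "card ((\<lambda>z. z \<cdot> y) ` coset x) = card (coset (x \<cdot> y))"
    using xy by (simp add: card_image card_coset)
qed

abbreviation QQ :: "'a set set" where
  "QQ \<equiv> quot_carrier Q K m"

abbreviation mm :: "'a set \<Rightarrow> 'a set \<Rightarrow> 'a set" where
  "mm \<equiv> quot_mult K m"

lemma coset_QQ [simp]: "x \<in> Q \<Longrightarrow> coset x \<in> QQ"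
  by (simp add: quot_carrier_def)

lemma QQ_cases: "A \<in> QQ \<Longrightarrow> (\<And>x. x \<in> Q \<Longrightarrow> A = coset x \<Longrightarrow> P) \<Longrightarrow> P"
  by (auto simp: quot_carrier_def)

text \<open>The chosen representatives do not matter, as cosets are compatible with multiplication
  on either side.\<close>

lemma mm_coset [simp]: "x \<in> Q \<Longrightarrow> y \<in> Q \<Longrightarrow> mm (coset x) (coset y) = coset (x \<cdot> y)"
proof -
  assume xy: "x \<in> Q" "y \<in> Q"
  define a where "a = (SOME a. a \<in> coset x)"
  define b where "b = (SOME b. b \<in> coset y)"
  have a: "a \<in> coset x" unfolding a_def by (rule someI [of _ x]) (use xy in simp)
  have b: "b \<in> coset y" unfolding b_def by (rule someI [of _ y]) (use xy in simp)
  have Q: "a \<in> Q" "b \<in> Q" using a b xy coset_sub by auto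
  have "a \<cdot> b \<in> coset (x \<cdot> b)" using coset_mult_right [of x b] a xy Q by blast
  moreover have "x \<cdot> b \<in> coset (x \<cdot> y)" using coset_mult [of x y] b xy by blast
  ultimately have "coset (a \<cdot> b) = coset (x \<cdot> y)" using coset_eq xy Q by (metis mult_closed)
  then show ?thesis by (simp add: quot_mult_def a_def b_def)
qed

lemma coset_left_cancel: "x \<in> Q \<Longrightarrow> a \<in> Q \<Longrightarrow> b \<in> Q \<Longrightarrow> coset (x \<cdot> a) = coset (x \<cdot> b) \<Longrightarrow> coset a = coset b"
proof -
  assume *: "x \<in> Q" "a \<in> Q" "b \<in> Q" "coset (x \<cdot> a) = coset (x \<cdot> b)"
  then have "x \<cdot> a \<in> coset (x \<cdot> b)" by (simp add: coset_eq_iff)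
  then have "x \<cdot> a \<in> (\<lambda>z. x \<cdot> z) ` coset b" using * by (simp add: coset_mult)
  then have "a \<in> coset b" using * coset_sub by auto
  then show ?thesis using * by (simp add: coset_eq_iff)
qed

lemma coset_right_cancel: "x \<in> Q \<Longrightarrow> a \<in> Q \<Longrightarrow> b \<in> Q \<Longrightarrow> coset (a \<cdot> x) = coset (b \<cdot> x) \<Longrightarrow> coset a = coset b"
proof -
  assume *: "x \<in> Q" "a \<in> Q" "b \<in> Q" "coset (a \<cdot> x) = coset (b \<cdot> x)"
  then have "a \<cdot> x \<in> coset (b \<cdot> x)" by (simp add: coset_eq_iff)
  then have "a \<cdot> x \<in> (\<lambda>z. z \<cdot> x) ` coset b" using * by (simp add: coset_mult_right)
  then have "a \<in> coset b" using * coset_sub by auto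
  then show ?thesis using * by (simp add: coset_eq_iff)
qed

lemma loop_quotient: "loop QQ mm (coset e)"
  unfolding loop_def
proof (intro conjI ballI)
  show "coset e \<in> QQ" by simp
  fix A assume "A \<in> QQ"
  then obtain x where x: "x \<in> Q" "A = coset x" by (rule QQ_cases)
  show "mm (coset e) A = A" "mm A (coset e) = A" using x by simp_all
  fix B assume "B \<in> QQ"
  then obtain y where y: "y \<in> Q" "B = coset y" by (rule QQ_cases)
  show "mm A B \<in> QQ" using x y by simp
  show "\<exists>!X. X \<in> QQ \<and> mm A X = B"
  proof (rule ex1I [of _ "coset (ld x y)"])
    fix X assume X: "X \<in> QQ \<and> mm A X = B"
    then obtain z where z: "z \<in> Q" "X = coset z" using QQ_cases by blast
    then have "coset (x \<cdot> z) = coset (x \<cdot> ld x y)" using X x y by simp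
    then show "X = coset (ld x y)" using coset_left_cancel [of x z "ld x y"] x y z by simp
  qed (use x y in simp)
  obtain w where w: "w \<in> Q" "w \<cdot> x = y" using obtain_left_factor x y by metis
  show "\<exists>!X. X \<in> QQ \<and> mm X A = B"
  proof (rule ex1I [of _ "coset w"])
    fix X assume X: "X \<in> QQ \<and> mm X A = B"
    then obtain z where z: "z \<in> Q" "X = coset z" using QQ_cases by blast
    then have "coset (z \<cdot> x) = coset (w \<cdot> x)" using X x y w by simp
    then show "X = coset w" using coset_right_cancel [of x z w] x w z by simp
  qed (use x y w in simp)
qed

sublocale quot: loop_on QQ mm "coset e"
  by unfold_locales (rule loop_quotient)

lemma quot_ld: "x \<in> Q \<Longrightarrow> y \<in> Q \<Longrightarrow> quot.ld (coset x) (coset y) = coset (ld x y)"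
  by (rule quot.ld_eqI) simp_all

lemma quot_inner_T: "x \<in> Q \<Longrightarrow> y \<in> Q \<Longrightarrow> quot.inner_T (coset x) (coset y) = coset (inner_T x y)"
  by (simp add: quot.inner_T_def inner_T_def quot_ld)

lemma quot_inner_L:
  "x \<in> Q \<Longrightarrow> y \<in> Q \<Longrightarrow> z \<in> Q \<Longrightarrow> quot.inner_L (coset x) (coset y) (coset z) = coset (inner_L x y z)"
  by (simp add: quot.inner_L_def inner_L_def quot_ld)

lemma finite_aloop_quotient: "finite_aloop QQ mm (coset e)"
proof
  show "finite QQ" by (simp add: quot_carrier_def)
  fix A assume "A \<in> QQ"
  then obtain x where x: "x \<in> Q" "A = coset x" by (rule QQ_cases)
  show "quot.endo (quot.inner_T A)"
    unfolding quot.endo_def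
    using x by (auto elim!: QQ_cases simp: quot_inner_T endo_mult [OF endo_T])
  fix B assume "B \<in> QQ"
  then obtain y where y: "y \<in> Q" "B = coset y" by (rule QQ_cases)
  show "quot.endo (quot.inner_L A B)"
    unfolding quot.endo_def
    using x y by (auto elim!: QQ_cases simp: quot_inner_L endo_mult [OF endo_L])
qed

lemma card_QQ: "card K * card QQ = card Q"
proof -
  have U: "\<Union>QQ = Q" using coset_sub coset_self by (auto simp: quot_carrier_def)
  have "card K * card QQ = card (\<Union>QQ)"
  proof (rule card_partition)
    show "finite QQ" by (simp add: quot_carrier_def)
    show "finite (\<Union>QQ)" unfolding U by simp
    show "\<And>c. c \<in> QQ \<Longrightarrow> card c = card K" by (auto elim!: QQ_cases simp: card_coset)
    fix A B assume "A \<in> QQ" "B \<in> QQ" "A \<noteq> B"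
    then obtain x y where "x \<in> Q" "y \<in> Q" "A = coset x" "B = coset y" by (metis QQ_cases)
    then show "A \<inter> B = {}" using coset_eq \<open>A \<noteq> B\<close> by blast
  qed
  then show ?thesis by (simp only: U)
qed

lemma loop_K: "loop K m e"
proof -
  have ex: "\<exists>y\<in>K. x \<cdot> y = z" if "x \<in> K" "z \<in> K" for x z
  proof -
    have "z \<in> (\<lambda>y. x \<cdot> y) ` K" unfolding image_mult_K [OF that(1)] by (rule that(2))
    then show ?thesis by blast
  qed
  have "inj_on (\<lambda>y. y \<cdot> x) K" if "x \<in> K" for x using that by (simp add: inj_on_def)
  then have "(\<lambda>y. y \<cdot> x) ` K = K" if "x \<in> K" for x
    by (intro endo_inj_surj) (use that K_mult in auto)
  then have "z \<in> (\<lambda>y. y \<cdot> x) ` K" if "x \<in> K" "z \<in> K" for x z using that by simp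
  then have ex': "\<exists>y\<in>K. y \<cdot> x = z" if "x \<in> K" "z \<in> K" for x z using that by (metis imageE)
  show ?thesis unfolding loop_def
  proof (intro conjI ballI)
    fix a b assume ab: "a \<in> K" "b \<in> K"
    show "\<exists>!x. x \<in> K \<and> m a x = b" using ex [OF ab] ab by (metis K_Q mult_left_cancel)
    show "\<exists>!x. x \<in> K \<and> m x a = b" using ex' [OF ab] ab by (metis K_Q mult_right_cancel)
  qed (auto simp: K_mult)
qed

sublocale sub: loop_on K m e
  by unfold_locales (rule loop_K)

lemma aloop_K: "aloop K m e"
proof
  have ld_K: "sub.ld x y = ld x y" if "x \<in> K" "y \<in> K" for x y
    using sub.ld [OF that] that by (metis K_Q ld_eqI)
  fix x assume x: "x \<in> K"
  have T: "sub.inner_T x y = inner_T x y" if "y \<in> K" for y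
    using x that by (simp add: sub.inner_T_def inner_T_def ld_K K_mult)
  show "sub.endo (sub.inner_T x)"
    unfolding sub.endo_def using x by (simp add: T K_mult K_T endo_mult [OF endo_T])
  fix y assume y: "y \<in> K"
  have L: "sub.inner_L x y z = inner_L x y z" if "z \<in> K" for z
    using x y that by (simp add: sub.inner_L_def inner_L_def ld_K K_mult)
  show "sub.endo (sub.inner_L x y)"
    unfolding sub.endo_def using x y by (simp add: L K_mult K_L endo_mult [OF endo_L])
qed

lemma normal_subloop_K: "normal_subloop K Q m e"
  unfolding normal_subloop_def
proof (intro exI conjI)
  show "loop QQ mm (coset e)" by (rule loop_quotient)
  show "loop_hom coset Q m QQ mm" by (auto simp: loop_hom_def)
  have "x \<in> coset e \<longleftrightarrow> x \<in> K" for x unfolding lcoset_def image_mult_K [OF K_unit] ..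
  then show "K = {x \<in> Q. coset x = coset e}" using coset_eq_iff [OF _ unit_closed] K_sub by blast
qed

end

section \<open>Solvability by induction on the order\<close>

lemma aloop_abelian_quotient:
  fixes Q :: "'a set"
  assumes Q: "finite_aloop Q m e" "Q \<noteq> {e}" "card Q = 2 ^ k"
  obtains K where "aloop_quotient Q m e K" "K \<noteq> Q" "quot_abelian_group Q K m"
proof -
  interpret finite_aloop Q m e by (rule Q(1))
  \<comment> \<open>Proper inner-invariant subloops, among them \<open>{e}\<close>; one of largest
    size is taken as \<open>K\<close>.\<close>
  let ?X = "{K. inner_invariant K \<and> K \<noteq> Q}"
  have "?X \<subseteq> Pow Q" by (auto simp: inner_invariant_def)
  then have "finite ?X" by (rule finite_subset) simp
  moreover have "{e} \<in> ?X" using Q(2) by (auto simp: inner_invariant_def endo_unit [OF endo_T] endo_unit [OF endo_L])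
  ultimately obtain K where K: "K \<in> ?X" "\<And>K'. K' \<in> ?X \<Longrightarrow> card K' \<le> card K"
    using finite_maximizer [of ?X "{e}" card] by blast
  interpret aloop_quotient Q m e K by unfold_locales (use K in simp)
  interpret q: finite_aloop QQ mm "coset e" by (rule finite_aloop_quotient)
  have "char_simple_aloop QQ mm (coset e)"
  proof
    have "card QQ dvd 2 ^ k" using card_QQ Q(3) by (metis dvd_triv_right)
    then show "\<exists>k. card QQ = 2 ^ k" by (auto simp: divides_primepow_nat)
    fix S assume S: "S \<subseteq> QQ" "coset e \<in> S" and mult: "\<And>x y. x \<in> S \<Longrightarrow> y \<in> S \<Longrightarrow> mm x y \<in> S"
      and H: "\<And>h x. h \<in> q.H \<Longrightarrow> x \<in> S \<Longrightarrow> h \<langle>$\<rangle> x \<in> S"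
    \<comment> \<open>The preimage of \<open>S\<close>. Inner mappings of the quotient belong to
      \<open>q.H\<close>, so it is inner-invariant; as it contains \<open>K\<close>, maximality
      leaves only \<open>K\<close> and \<open>Q\<close>.\<close>
    define K' where "K' = {x \<in> Q. coset x \<in> S}"
    have "inner_invariant K'"
      unfolding inner_invariant_def
    proof (intro conjI ballI)
      show "K' \<subseteq> Q" "e \<in> K'" using S by (auto simp: K'_def)
      show "m x y \<in> K'" if "x \<in> K'" "y \<in> K'" for x y
        using that mult [of "coset x" "coset y"] by (simp add: K'_def)
      show "inner_T x z \<in> K'" if "x \<in> Q" "z \<in> K'" for x z
        using that H [of "q.T (coset x)" "coset z"] by (simp add: K'_def quot_inner_T)
      show "inner_L x y z \<in> K'" if "x \<in> Q" "y \<in> Q" "z \<in> K'" for x y z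
        using that H [of "q.hh (coset x) (coset y)" "coset z"]
        by (simp add: K'_def q.hh_apply quot_inner_L [symmetric] quot.inner_L_def)
    qed
    have KK': "K \<subseteq> K'"
    proof
      fix x assume "x \<in> K"
      then have "x \<in> coset e" by (simp add: lcoset_def image_mult_K)
      then have "coset x = coset e" using coset_eq by simp
      then show "x \<in> K'" using S \<open>x \<in> K\<close> by (simp add: K'_def)
    qed
    show "S = {coset e} \<or> S = QQ"
    proof (cases "K' = Q")
      case True
      then have "QQ \<subseteq> S" by (auto elim!: QQ_cases simp: K'_def)
      then show ?thesis using S by blast
    next
      case False
      then have "card K' \<le> card K" using K \<open>inner_invariant K'\<close> by simp
      moreover have "finite K'" by (simp add: K'_def)
      ultimately have "K' = K" using KK' card_seteq by metis
      have "S \<subseteq> {coset e}"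
      proof
        fix A assume A: "A \<in> S"
        then have "A \<in> QQ" using S by blast
        then obtain x where x: "x \<in> Q" "A = coset x" by (rule QQ_cases)
        then have "x \<in> K" using A \<open>K' = K\<close> by (auto simp: K'_def)
        then have "x \<in> coset e" by (simp add: lcoset_def image_mult_K)
        then have "coset x = coset e" by (rule coset_eq [OF unit_closed])
        then show "A \<in> {coset e}" using x by simp
      qed
      then have "S = {coset e}" using S(2) by (simp add: subset_antisym)
      then show ?thesis ..
    qed
  qed
  then interpret c: char_simple_aloop QQ mm "coset e" .
  have "quot_abelian_group Q K m"
    unfolding quot_abelian_group_def using c.char_simple_abelian_group by blast
  then show ?thesis using that [of K] K aloop_quotient_axioms by blast
qed

text \<open>Strong induction on the order: the abelian quotient by a proper \<open>K\<close> is put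
  on top of a series of \<open>K\<close>.\<close>

lemma aloop_solvable:
  assumes "aloop Q m e" "finite Q" "card Q = 2 ^ k"
  shows "solvable_loop Q m e"
  using assms
proof (induction "card Q" arbitrary: Q k rule: less_induct)
  case less
  interpret finite_aloop Q m e
    using less.prems by (simp add: finite_aloop_def finite_aloop_axioms_def)
  show ?case
  proof (cases "Q = {e}")
    case True
    show ?thesis unfolding solvable_loop_def
      by (intro exI [of _ 0] exI [of _ "\<lambda>_. {e}"]) (use True in simp)
  next
    case False
    obtain K where K: "aloop_quotient Q m e K" "K \<noteq> Q" and ab: "quot_abelian_group Q K m"
      using aloop_abelian_quotient [OF finite_aloop_axioms False less.prems(3)] by blast
    interpret aloop_quotient Q m e K by (rule K(1))
    have "card K < card Q" using K(2) K_sub by (intro psubset_card_mono) auto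
    moreover have "card K dvd 2 ^ k" using card_QQ less.prems(3) by (metis dvd_triv_left)
    then obtain j where "card K = 2 ^ j" by (auto simp: divides_primepow_nat)
    ultimately have "solvable_loop K m e" using less.hyps [of K j] aloop_K by simp
    then obtain n S where S: "S 0 = {e}" "S n = K"
      and step: "\<And>i. i < n \<Longrightarrow> subloop (S i) K m e \<and> subloop (S (Suc i)) K m e \<and> S i \<subseteq> S (Suc i)
              \<and> normal_subloop (S i) (S (Suc i)) m e \<and> quot_abelian_group (S (Suc i)) (S i) m"
      unfolding solvable_loop_def by blast
    \<comment> \<open>All indices beyond \<open>n\<close> carry \<open>Q\<close>; the new series
      ends at \<open>Suc n\<close>.\<close>
    define S' where "S' i = (if i \<le> n then S i else Q)" for i
    have sub: "subloop A Q m e" if "subloop A K m e" for A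
      using that K_sub by (auto simp: subloop_def)
    show ?thesis unfolding solvable_loop_def
    proof (intro exI [of _ "Suc n"] exI [of _ S'] conjI allI impI)
      show "S' 0 = {e}" "S' (Suc n) = Q" by (simp_all add: S'_def S)
      fix i assume i: "i < Suc n"
      have "subloop (S' i) Q m e \<and> subloop (S' (Suc i)) Q m e \<and> S' i \<subseteq> S' (Suc i)
              \<and> normal_subloop (S' i) (S' (Suc i)) m e \<and> quot_abelian_group (S' (Suc i)) (S' i) m"
      proof (cases "i < n")
        case True
        then show ?thesis using step [OF True] sub by (simp add: S'_def)
      next
        case False
        then have "i = n" using i by simp
        then have "S' i = K" "S' (Suc i) = Q" using S by (simp_all add: S'_def)
        moreover have "subloop K Q m e" "subloop Q Q m e"
          using loop_K is_loop K_sub by (simp_all add: subloop_def)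
        ultimately show ?thesis using K_sub normal_subloop_K ab by simp
      qed
      then show "subloop (S' i) Q m e" "subloop (S' (Suc i)) Q m e" "S' i \<subseteq> S' (Suc i)"
        "normal_subloop (S' i) (S' (Suc i)) m e" "quot_abelian_group (S' (Suc i)) (S' i) m"
        by blast+
    qed
  qed
qed

theorem theorem1p3:
  fixes Q :: "'a set" and m :: "'a \<Rightarrow> 'a \<Rightarrow> 'a" and e :: 'a
  assumes "automorphic_loop Q m e"
    and "two_loop Q m e"
  shows "solvable_loop Q m e"
  using assms automorphic_loop_aloop [OF assms(1)] aloop_solvable by (auto simp: two_loop_def)

end
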